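(* Let $d\ge 1$ be fixed and let $\beta\ge 0$ satisfy $$\tanh(\beta)<\frac1d .$$ Let $G$ be a random graph distributed as $G(n,d/n)$. For any $\gamma>0$ there exist constants $r=r(d,\beta,\gamma)$ and $C=C(d,\beta,\gamma)$ such that, with probability $1-o(1)$ over $G$ as $n\to\infty$, the sequential self-avoiding-walk-tree sampling algorithm (defined in the context) with radius parameter $L=r\log n$ has running time $O(n^{C})$ and its output distribution $Q$ satisfies $d_{TV}(P,Q)<n^{-\gamma}$, where $P$ is the Ising distribution on $G$. This holds both for the homogeneous Ising model with inverse temperature $\beta$ and for the inhomogeneous Ising model with interactions $\beta_{u,v}\ge0$, $\max_{u,v}\beta_{u,v}=\beta$, and arbitrary external fields $h_v$.
   Context: $G(n,p)$ is the Erdős–Rényi random graph on $n$ vertices with each potential edge present independently with probability $p$; $d_{TV}$ is total variation distance; $\log$ is the natural logarithm, and non-integer radii are rounded to integers. Ising model. For a finite graph $G=(V,E)$, interactions $\beta_{u,v}\ge 0$ ($\{u,v\}\in E$) and external fields $h_v\in\mathbb{R}$, the inhomogeneous Ising model is the distribution on $\{\pm\}^V$ (with $\pm$ identified with $\pm1$) $P(\sigma)=\frac1Z\exp\big(\sum_{\{u,v\}\in E}\beta_{u,v}\sigma(u)\sigma(v)+\sum_{v}h_v\sigma(v)\big)$, with $\beta=\max_{u,v}\beta_{u,v}$. The homogeneous model with inverse temperature $\beta$ has $\beta_{u,v}=\beta$ on all edges and $h\equiv0$. Tree of self-avoiding walks. For a vertex $v$ of $G$, $T_{SAW}(v)$ is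 the rooted tree whose vertices are the walks $(v_0,\dots,v_l)$, $l\ge0$, in $G$ with $v_0=v$, with $v_0,\dots,v_{l-1}$ distinct, and with $v_l$ either different from $v_0,\dots,v_{l-1}$ or equal to some $v_j$ with $j<l-2$ (so the walk closes a cycle at its terminal vertex and does not backtrack); the parent of a walk is the walk with its last step deleted, and the root is $(v)$. A walk that closes a cycle is a leaf; let $A$ be the set of these leaves. Each vertex (edge) of $T_{SAW}(v)$ is a copy of a vertex (edge) of $G$, namely the terminal vertex (last edge) of the walk, and $P_{T_{SAW}}$ denotes the Ising model on the tree with the corresponding external fields and interactions. Fix for every vertex $w$ of $G$ a linear order on its neighbors; for a leaf $(v_0,\dots,v_l)\in A$ with $v_l=v_j=w$, $j<l$, put $\tau=+$ if $v_{l-1}>v_{j+1}$ in the order at $w$ and $\tau=-$ otherwise. This defines the configuration $\tau_A$ on $A$ (Weitz's construction). $T_{SAW}^{L}(v)$ is the tree $T_{SAW}(v)$ truncated at distance $L$ from the root. Algorithm (with radius parameter $L$). Label the vertices $v_1,\dots,v_n$ and let $V_{i-1}=\{v_1,\dots,v_{i-1}\}$. For $i=1,\dots,n$ successively: construct $T_{SAW}^L(v_i)$; compute $p_i=P_{T_{SAW}^L}(\sigma_{v_i}=+\mid \sigma_{V_{i-1}},\tau_{A-V_{i-1}})$, i.e. the probability that the root is $+$ when every copy of a vertex of $V_{i-1}$ in the tree is conditioned to have the spin already assigned to that vertex, and the vertices of $A$ in the tree that are not copies of vertices of $V_{i-1}$ are conditioned to have spins $\tau$ (the boundary condition at depth $L$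 may be chosen arbitrarily; in particular there may be none); assign to $v_i$ the spin $+$ with probability $p_i$ and $-$ with probability $1-p_i$. The output is the resulting configuration in $\{\pm\}^V$, and $Q$ is its distribution. *)

theory Defs
  imports "HOL-Probability.Probability" "HOL-Library.Ramsey"
begin

section \<open>Random graphs and total variation distance\<close>

text \<open>
  A graph on the vertices \<open>0, \<dots>, n - 1\<close> is given by its edge set, a set of two-element sets.
\<close>

definition gnp :: "nat \<Rightarrow> real \<Rightarrow> nat set set pmf" where
  "gnp n p = map_pmf (\<lambda>f. {e \<in> nsets {..<n} 2. f e})
               (Pi_pmf (nsets {..<n} 2) False (\<lambda>_. bernoulli_pmf p))"

definition tv_dist :: "'a pmf \<Rightarrow> 'a pmf \<Rightarrow> real" where
  "tv_dist p q = (SUP A. \<bar>measure_pmf.prob p A - measure_pmf.prob q A\<bar>)"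


section \<open>The Ising model\<close>

text \<open>
  The spin \<open>+\<close> is \<^const>\<open>True\<close>.  Partial spin configurations are maps, and a configuration on
  \<open>V\<close> is a map with domain \<open>V\<close>; thus \<open>c \<subseteq>\<^sub>m \<sigma>\<close> says that \<open>\<sigma>\<close> has the spins prescribed by \<open>c\<close>.
\<close>

definition configs :: "'v set \<Rightarrow> ('v \<rightharpoonup> bool) set" where
  "configs V = {\<sigma>. dom \<sigma> = V}"

definition spin :: "('v \<rightharpoonup> bool) \<Rightarrow> 'v \<Rightarrow> real" where
  "spin \<sigma> v = (if \<sigma> v = Some True then 1 else - 1)"

definition ising_weight ::
  "'v set \<Rightarrow> 'v set set \<Rightarrow> ('v set \<Rightarrow> real) \<Rightarrow> ('v \<Rightarrow> real) \<Rightarrow> ('v \<rightharpoonup> bool) \<Rightarrow> real" where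
  "ising_weight V E J h \<sigma> =
     exp ((\<Sum>e\<in>E. J e * (\<Prod>v\<in>e. spin \<sigma> v)) + (\<Sum>v\<in>V. h v * spin \<sigma> v))"

definition ising ::
  "'v set \<Rightarrow> 'v set set \<Rightarrow> ('v set \<Rightarrow> real) \<Rightarrow> ('v \<Rightarrow> real) \<Rightarrow> ('v \<rightharpoonup> bool) pmf" where
  "ising V E J h = embed_pmf (\<lambda>\<sigma>.
     if \<sigma> \<in> configs V
     then ising_weight V E J h \<sigma> / (\<Sum>\<sigma>'\<in>configs V. ising_weight V E J h \<sigma>') else 0)"

lemma finite_configs: "finite V \<Longrightarrow> finite (configs V)"
  unfolding configs_def using finite_set_of_finite_maps[of V "UNIV :: bool set"] by simp

lemma pmf_ising:
  assumes "finite V"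
  shows "pmf (ising V E J h) \<sigma> =
    (if \<sigma> \<in> configs V
     then ising_weight V E J h \<sigma> / (\<Sum>\<sigma>'\<in>configs V. ising_weight V E J h \<sigma>') else 0)"
proof -
  define f where "f \<sigma> = (if \<sigma> \<in> configs V
     then ising_weight V E J h \<sigma> / (\<Sum>\<sigma>'\<in>configs V. ising_weight V E J h \<sigma>') else 0)" for \<sigma>
  have fin: "finite (configs V)"
    using assms by (rule finite_configs)
  have ne: "(\<lambda>v. if v \<in> V then Some True else None) \<in> configs V"
    by (auto simp: configs_def dom_def)
  have Z: "(\<Sum>\<sigma>'\<in>configs V. ising_weight V E J h \<sigma>') > 0"
    by (rule sum_pos[OF fin]) (use ne in \<open>auto simp: ising_weight_def\<close>)
  have nonneg: "f \<sigma> \<ge> 0" for \<sigma>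
    using Z by (auto simp: f_def ising_weight_def)
  have "(\<integral>\<^sup>+\<sigma>. ennreal (f \<sigma>) \<partial>count_space UNIV) = (\<Sum>\<sigma>\<in>configs V. ennreal (f \<sigma>))"
    by (rule nn_integral_count_space'[OF fin]) (auto simp: f_def)
  also have "\<dots> = ennreal (\<Sum>\<sigma>\<in>configs V. f \<sigma>)"
    using nonneg by simp
  also have "(\<Sum>\<sigma>\<in>configs V. f \<sigma>) = 1"
    using Z by (simp add: f_def flip: sum_divide_distrib)
  finally have "pmf (embed_pmf f) \<sigma> = f \<sigma>"
    by (intro pmf_embed_pmf nonneg) simp
  then show ?thesis
    unfolding ising_def f_def .
qed

definition has_inverse_temperature :: "nat set set \<Rightarrow> (nat set \<Rightarrow> real) \<Rightarrow> real \<Rightarrow> bool" where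
  "has_inverse_temperature E J \<beta> \<longleftrightarrow> (\<forall>e\<in>E. 0 \<le> J e) \<and> (E \<noteq> {} \<longrightarrow> Max (J ` E) = \<beta>)"


section \<open>The tree of self-avoiding walks\<close>

text \<open>
  The walk \<open>(v\<^sub>0, \<dots>, v\<^sub>l)\<close> is the list \<open>[v\<^sub>0, \<dots>, v\<^sub>l]\<close> of length \<open>l + 1\<close>; its parent is its
  \<^const>\<open>butlast\<close>, and it is a copy of the vertex \<open>last w\<close>.
\<close>

definition closes_cycle :: "nat list \<Rightarrow> bool" where
  "closes_cycle w \<longleftrightarrow> last w \<in> set (butlast w)"

definition saw_tree :: "nat set set \<Rightarrow> nat \<Rightarrow> nat list set" where
  "saw_tree E v = {w. w \<noteq> [] \<and> hd w = v
     \<and> (\<forall>i. Suc i < length w \<longrightarrow> {w ! i, w ! Suc i} \<in> E)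
     \<and> distinct (butlast w)
     \<and> (\<not> closes_cycle w \<or> (\<exists>j. j + 2 < length w - 1 \<and> w ! j = last w))}"

definition saw_tree_upto :: "nat set set \<Rightarrow> nat \<Rightarrow> nat \<Rightarrow> nat list set" where
  "saw_tree_upto E L v = {w \<in> saw_tree E v. length w - 1 \<le> L}"

definition tree_edges :: "nat list set \<Rightarrow> nat list set set" where
  "tree_edges T = {{butlast w, w} | w. w \<in> T \<and> length w \<ge> 2}"

text \<open>Every edge and vertex of the tree has the parameters of the edge or vertex it is a copy of.\<close>

definition saw_ising ::
  "nat set set \<Rightarrow> (nat set \<Rightarrow> real) \<Rightarrow> (nat \<Rightarrow> real) \<Rightarrow> nat \<Rightarrow> nat \<Rightarrow> (nat list \<rightharpoonup> bool) pmf" where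
  "saw_ising E J h L v =
     ising (saw_tree_upto E L v) (tree_edges (saw_tree_upto E L v))
       (\<lambda>e. J (last ` e)) (\<lambda>w. h (last w))"

text \<open>\<open>(a, b) \<in> ord u\<close> means that \<open>a \<le> b\<close> in the order on the neighbours of \<open>u\<close>.\<close>

definition precedes :: "(nat \<Rightarrow> nat rel) \<Rightarrow> nat \<Rightarrow> nat \<Rightarrow> nat \<Rightarrow> bool" where
  "precedes ord u a b \<longleftrightarrow> (a, b) \<in> ord u \<and> a \<noteq> b"

definition saw_tau :: "(nat \<Rightarrow> nat rel) \<Rightarrow> nat list \<Rightarrow> bool" where
  "saw_tau ord w =
     (let l = length w - 1; j = (THE j. j < l \<and> w ! j = last w)
      in precedes ord (last w) (w ! Suc j) (w ! (l - 1)))"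

text \<open>
  The conditioning used for the root \<open>v\<close> once the spins \<open>\<sigma>\<close> have been assigned.  The boundary
  condition \<open>bc\<close> at depth \<open>L\<close> may depend on \<open>\<sigma>\<close> and may leave vertices free (value \<^const>\<open>None\<close>);
  it concerns the vertices whose spins are not prescribed otherwise.
\<close>

definition saw_condition ::
  "nat set set \<Rightarrow> (nat \<Rightarrow> nat rel) \<Rightarrow> ((nat \<rightharpoonup> bool) \<Rightarrow> nat list \<rightharpoonup> bool) \<Rightarrow> nat
     \<Rightarrow> (nat \<rightharpoonup> bool) \<Rightarrow> nat \<Rightarrow> (nat list \<rightharpoonup> bool)" where
  "saw_condition E ord bc L \<sigma> v w =
     (if w \<notin> saw_tree_upto E L v then None
      else if last w \<in> dom \<sigma> then \<sigma> (last w)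
      else if closes_cycle w then Some (saw_tau ord w)
      else if length w - 1 = L then bc \<sigma> w
      else None)"

definition saw_prob ::
  "nat set set \<Rightarrow> (nat set \<Rightarrow> real) \<Rightarrow> (nat \<Rightarrow> real) \<Rightarrow> (nat \<Rightarrow> nat rel)
     \<Rightarrow> ((nat \<rightharpoonup> bool) \<Rightarrow> nat list \<rightharpoonup> bool) \<Rightarrow> nat \<Rightarrow> (nat \<rightharpoonup> bool) \<Rightarrow> nat \<Rightarrow> real" where
  "saw_prob E J h ord bc L \<sigma> v =
     \<P>(\<omega> in saw_ising E J h L v. \<omega> [v] = Some True \<bar> saw_condition E ord bc L \<sigma> v \<subseteq>\<^sub>m \<omega>)"


section \<open>The sampling algorithm\<close>

text \<open>
  The output distribution when the vertices of the list are processed in this order,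
  starting with the spins \<open>\<sigma>\<close> already assigned.
\<close>

primrec saw_output ::
  "nat set set \<Rightarrow> (nat set \<Rightarrow> real) \<Rightarrow> (nat \<Rightarrow> real) \<Rightarrow> (nat \<Rightarrow> nat rel)
     \<Rightarrow> ((nat \<rightharpoonup> bool) \<Rightarrow> nat list \<rightharpoonup> bool) \<Rightarrow> nat \<Rightarrow> nat list \<Rightarrow> (nat \<rightharpoonup> bool)
     \<Rightarrow> (nat \<rightharpoonup> bool) pmf" where
  "saw_output E J h ord bc L [] \<sigma> = return_pmf \<sigma>"
| "saw_output E J h ord bc L (v # vs) \<sigma> =
     bernoulli_pmf (saw_prob E J h ord bc L \<sigma> v) \<bind>
       (\<lambda>s. saw_output E J h ord bc L vs (\<sigma>(v \<mapsto> s)))"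


section \<open>Implementation with step counts\<close>

text \<open>
  The running time is that of the following program on a real RAM: arithmetic on reals (including
  \<^const>\<open>exp\<close>), comparisons, list constructors and destructors, access to the array \<open>\<sigma>\<close>, queries to
  the input (\<open>E\<close>, \<open>J\<close>, \<open>h\<close>, \<open>ord\<close>) and the tossing of a coin of given bias all take one step;
  a query to \<open>bc\<close> takes as many steps as the walk is long.  A value of type \<open>'a timed\<close> is a result
  together with the number of steps (up to a constant factor) taken to compute it.

  The program explores the truncated tree of self-avoiding walks depth-first, computing for each
  subtree the pair of its two partition functions with the spin of its root being \<open>+\<close> and \<open>-\<close>.
  Walks are stored in reverse, the terminal vertex first.
\<close>

type_synonym 'a timed = "'a \<times> nat"

text \<open>
  Searches a reversed walk for a visit of \<open>x\<close> and returns the vertex visited directly afterwards;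
  \<open>p\<close> is the vertex visited directly after the given walk.
\<close>

primrec next_after_visit :: "nat \<Rightarrow> nat \<Rightarrow> nat list \<Rightarrow> nat option timed" where
  "next_after_visit x p [] = (None, 1)"
| "next_after_visit x p (y # ys) =
     (if y = x then (Some p, 2)
      else let (r, t) = next_after_visit x y ys in (r, t + 2))"

primrec product_over :: "(nat \<Rightarrow> (real \<times> real) timed) \<Rightarrow> nat list \<Rightarrow> (real \<times> real) timed" where
  "product_over f [] = ((1, 1), 1)"
| "product_over f (u # us) =
     (let ((a, b), s) = f u; ((a', b'), t) = product_over f us in ((a * a', b * b'), s + t + 3))"

text \<open>
  One vertex \<open>x # ys\<close> of the tree, where \<open>rec u\<close> evaluates the subtree of the child reached by the
  step to \<open>u\<close>.  A step from a walk that has not closed a cycle yields a vertex of the tree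
  unless it backtracks.
\<close>

definition eval_vertex ::
  "nat \<Rightarrow> nat set set \<Rightarrow> (nat set \<Rightarrow> real) \<Rightarrow> (nat \<Rightarrow> real) \<Rightarrow> (nat \<Rightarrow> nat rel)
     \<Rightarrow> ((nat \<rightharpoonup> bool) \<Rightarrow> nat list \<rightharpoonup> bool) \<Rightarrow> (nat \<rightharpoonup> bool)
     \<Rightarrow> bool \<Rightarrow> nat \<Rightarrow> nat list \<Rightarrow> (nat \<Rightarrow> (real \<times> real) timed) \<Rightarrow> (real \<times> real) timed" where
  "eval_vertex n E J h ord bc \<sigma> at_bottom x ys rec =
     (let (visit, t1) = next_after_visit x x ys;
          (c, t2) = (case \<sigma> x of
              Some s \<Rightarrow> (Some s, 2)
            | None \<Rightarrow> (case visit of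
                Some y \<Rightarrow> (Some (precedes ord x y (hd ys)), 6)
              | None \<Rightarrow> if at_bottom then (bc \<sigma> (rev (x # ys)), length ys + 4) else (None, 4)));
          ((a, b), t3) =
            (if visit \<noteq> None \<or> at_bottom then ((1, 1), 2)
             else product_over (\<lambda>u.
               if {x, u} \<in> E \<and> (ys = [] \<or> u \<noteq> hd ys)
               then let ((a, b), t) = rec u; e = exp (J {x, u})
                    in ((e * a + b / e, a / e + e * b), t + 14)
               else ((1, 1), 6)) [0..<n])
      in ((if c = Some False then 0 else exp (h x) * a,
           if c = Some True then 0 else exp (- h x) * b), t1 + t2 + t3 + 9))"

text \<open>The subtree of the walk \<open>x # ys\<close>, down to \<open>k\<close> levels further.\<close>

primrec eval_subtree ::
  "nat \<Rightarrow> nat set set \<Rightarrow> (nat set \<Rightarrow> real) \<Rightarrow> (nat \<Rightarrow> real) \<Rightarrow> (nat \<Rightarrow> nat rel)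
     \<Rightarrow> ((nat \<rightharpoonup> bool) \<Rightarrow> nat list \<rightharpoonup> bool) \<Rightarrow> (nat \<rightharpoonup> bool)
     \<Rightarrow> nat \<Rightarrow> nat \<Rightarrow> nat list \<Rightarrow> (real \<times> real) timed" where
  "eval_subtree n E J h ord bc \<sigma> 0 x ys =
     eval_vertex n E J h ord bc \<sigma> True x ys (\<lambda>u. ((1, 1), 0))"
| "eval_subtree n E J h ord bc \<sigma> (Suc k) x ys =
     eval_vertex n E J h ord bc \<sigma> False x ys
       (\<lambda>u. eval_subtree n E J h ord bc \<sigma> k u (x # ys))"

definition compute_prob ::
  "nat \<Rightarrow> nat set set \<Rightarrow> (nat set \<Rightarrow> real) \<Rightarrow> (nat \<Rightarrow> real) \<Rightarrow> (nat \<Rightarrow> nat rel)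
     \<Rightarrow> ((nat \<rightharpoonup> bool) \<Rightarrow> nat list \<rightharpoonup> bool) \<Rightarrow> nat \<Rightarrow> (nat \<rightharpoonup> bool) \<Rightarrow> nat \<Rightarrow> real timed" where
  "compute_prob n E J h ord bc L \<sigma> v =
     (let ((a, b), t) = eval_subtree n E J h ord bc \<sigma> L v [] in (a / (a + b), t + 3))"

text \<open>The steps charged for each vertex include the initialisation of its array cell.\<close>

primrec run_sampler ::
  "nat \<Rightarrow> nat set set \<Rightarrow> (nat set \<Rightarrow> real) \<Rightarrow> (nat \<Rightarrow> real) \<Rightarrow> (nat \<Rightarrow> nat rel)
     \<Rightarrow> ((nat \<rightharpoonup> bool) \<Rightarrow> nat list \<rightharpoonup> bool) \<Rightarrow> nat \<Rightarrow> nat list \<Rightarrow> (nat \<rightharpoonup> bool)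
     \<Rightarrow> (nat \<rightharpoonup> bool) timed pmf" where
  "run_sampler n E J h ord bc L [] \<sigma> = return_pmf (\<sigma>, 1)"
| "run_sampler n E J h ord bc L (v # vs) \<sigma> =
     (let (p, t) = compute_prob n E J h ord bc L \<sigma> v
      in bernoulli_pmf p \<bind>
           (\<lambda>s. map_pmf (\<lambda>(\<sigma>', t'). (\<sigma>', t + t' + 4))
                  (run_sampler n E J h ord bc L vs (\<sigma>(v \<mapsto> s)))))"

text \<open>
  The guarantee, with running time at most \<open>T\<close> and error less than \<open>\<epsilon>\<close>, for every labelling of the
  vertices, every choice of the orders and every boundary condition.  The first conclusion says that
  the program whose steps are counted is an implementation of the algorithm.
\<close>

definition sampler_guarantee ::
  "nat \<Rightarrow> nat set set \<Rightarrow> (nat set \<Rightarrow> real) \<Rightarrow> (nat \<Rightarrow> real) \<Rightarrow> nat \<Rightarrow> real \<Rightarrow> real \<Rightarrow> bool" where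
  "sampler_guarantee n E J h L T \<epsilon> \<longleftrightarrow>
     (\<forall>vs ord bc.
        distinct vs \<longrightarrow> set vs = {..<n} \<longrightarrow>
        (\<forall>u<n. linear_order_on {w. {u, w} \<in> E} (ord u)) \<longrightarrow>
        (let Q = saw_output E J h ord bc L vs Map.empty;
             R = run_sampler n E J h ord bc L vs Map.empty
         in map_pmf fst R = Q
            \<and> (\<forall>(\<sigma>, t) \<in> set_pmf R. real t \<le> T)
            \<and> tv_dist (ising {..<n} E J h) Q < \<epsilon>))"

end

theory Submission
  imports Defs "HOL-Real_Asymp.Real_Asymp"
begin

text \<open>
  By Weitz's construction the log-odds of a spin, given the spins already assigned, satisfy the
  recursion of the tree of self-avoiding walks.  Across an edge of interaction \<open>J\<close> this recursion
  contracts differences of log-odds by the factor \<open>tanh J\<close>, whatever the external fields are, and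
  the conditioned vertices transmit nothing.  Truncation at depth \<open>L\<close> therefore changes the log-odds
  at the root \<open>v\<close> by at most \<open>4 \<beta> tanh\<^sup>L\<^sup>-\<^sup>1 \<beta>\<close> times the number of self-avoiding walks of length \<open>L\<close>
  from \<open>v\<close>.  Summed over all \<open>v\<close> this bounds the total variation distance, since the output is
  sampled vertex by vertex.  The expected number of self-avoiding walks of length \<open>j\<close> in \<open>G(n, d/n)\<close>
  is at most \<open>n d\<^sup>j\<close>, so by Markov's inequality there are at most \<open>n\<^sup>2 (L + 1) d\<^sup>L\<close> of length at most
  \<open>L\<close> with probability \<open>1 - 1/n\<close>; as \<open>d tanh \<beta> < 1\<close>, a depth \<open>L\<close> of logarithmic order suffices.  The same
  count bounds the size of the tree and thus the running time.
\<close>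

section \<open>Gibbs sums\<close>

text \<open>The log-odds of a vertex with an assigned spin are infinite, so an estimate cannot be
  propagated from log-odds to log-odds. What is compared is the message \<open>edge_ratio\<close>
  sent through an edge: it is a function of a pair of weights, one of which may vanish, and lies
  between -2J and 2J. Two messages differ by at most 4J; this is the 4 \<beta> of the error bound,
  valid for every boundary condition at the bottom. The exponent is L - 1 because the log-odds of
  the root cross no further edge.

  That the complete tree has the marginals of the graph is never stated. Instead a graph quantity,
  \<open>walk_pf\<close>, is attached to every self-avoiding walk: the Ising model on the vertices
  not left yet, the others being replaced by external fields. Its log-odds and those of the
  truncated tree satisfy recursions of the same form, the leaves that close a cycle supplying
  exactly these fields on the tree side. The field terms cancel in the difference, and a single
  induction compares the truncated tree with the graph directly.\<close>

lemma dom_configs: "\<eta> \<in> configs V \<Longrightarrow> dom \<eta> = V"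
  by (simp add: configs_def)

lemma configs_empty [simp]: "configs {} = {Map.empty}"
  by (auto simp: configs_def)

lemma configs_value:
  assumes "\<eta> \<in> configs V" "v \<in> V"
  shows "\<exists>s. \<eta> v = Some s"
  using assms by (auto simp: configs_def dom_def)

lemma configs_None: "\<eta> \<in> configs V \<Longrightarrow> v \<notin> V \<Longrightarrow> \<eta> v = None"
  by (auto simp: configs_def dom_def)

lemma sum_configs_Un:
  assumes "A \<inter> B = {}"
  shows "(\<Sum>\<eta>\<in>configs (A \<union> B). f \<eta>) = (\<Sum>\<eta>\<in>configs A. \<Sum>\<eta>'\<in>configs B. f (\<eta> ++ \<eta>'))"
proof -
  have "(\<Sum>\<eta>\<in>configs A. \<Sum>\<eta>'\<in>configs B. f (\<eta> ++ \<eta>')) =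
      (\<Sum>(\<eta>, \<eta>')\<in>configs A \<times> configs B. f (\<eta> ++ \<eta>'))"
    by (simp add: sum.cartesian_product)
  also have "\<dots> = (\<Sum>\<eta>\<in>configs (A \<union> B). f \<eta>)"
  proof (rule sum.reindex_bij_witness[where j = "\<lambda>(\<eta>, \<eta>'). \<eta> ++ \<eta>'"
        and i = "\<lambda>\<eta>. (\<eta> |` A, \<eta> |` B)"])
    fix p assume "p \<in> configs A \<times> configs B"
    then obtain \<eta> \<eta>' where p: "p = (\<eta>, \<eta>')" "dom \<eta> = A" "dom \<eta>' = B"
      by (auto simp: configs_def)
    have "\<eta> v = None" if "v \<notin> A" for v using p that by auto
    moreover have "\<eta>' v = None" if "v \<notin> B" for v using p that by auto
    ultimately have "(\<eta> ++ \<eta>') |` A = \<eta>" "(\<eta> ++ \<eta>') |` B = \<eta>'"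
      using assms by (auto simp: fun_eq_iff restrict_map_def map_add_def disjoint_iff split: option.split)
    then show "(case p of (\<eta>, \<eta>') \<Rightarrow> \<eta> ++ \<eta>') \<in> configs (A \<union> B)"
      and "((case p of (\<eta>, \<eta>') \<Rightarrow> \<eta> ++ \<eta>') |` A, (case p of (\<eta>, \<eta>') \<Rightarrow> \<eta> ++ \<eta>') |` B) = p"
      using p by (auto simp: configs_def)
  next
    fix \<eta> :: "'a \<rightharpoonup> bool" assume \<eta>: "\<eta> \<in> configs (A \<union> B)"
    then show "(\<eta> |` A, \<eta> |` B) \<in> configs A \<times> configs B"
      by (auto simp: configs_def)
    show "(case (\<eta> |` A, \<eta> |` B) of (\<eta>, \<eta>') \<Rightarrow> \<eta> ++ \<eta>') = \<eta>"
      using configs_None[OF \<eta>]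
      by (auto simp: fun_eq_iff restrict_map_def map_add_def split: option.split)
  qed auto
  finally show ?thesis by (rule sym)
qed

lemma configs_singleton: "configs {x} = {[x \<mapsto> True], [x \<mapsto> False]}"
proof -
  have "\<eta> \<in> {[x \<mapsto> True], [x \<mapsto> False]}" if d: "dom \<eta> = {x}" for \<eta> :: "'a \<rightharpoonup> bool"
  proof -
    obtain s where "\<eta> x = Some s" using d by (auto simp: dom_def)
    moreover have "\<eta> y = None" if "y \<noteq> x" for y
      using \<open>dom \<eta> = {x}\<close> that by (metis domIff singletonD)
    ultimately have "\<eta> = [x \<mapsto> s]" by (auto simp: fun_eq_iff)
    then show ?thesis by (cases s) auto
  qed
  then show ?thesis by (auto simp: configs_def split: if_splits)
qed

lemma sum_configs_insert:
  assumes "x \<notin> V"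
  shows "(\<Sum>\<eta>\<in>configs (insert x V). f \<eta>) =
    (\<Sum>\<eta>\<in>configs V. f (\<eta>(x \<mapsto> True))) + (\<Sum>\<eta>\<in>configs V. f (\<eta>(x \<mapsto> False)))"
proof -
  have ne: "[x \<mapsto> True] \<noteq> [x \<mapsto> False]"
    by (metis fun_upd_same option.inject)
  have eq: "[x \<mapsto> s] ++ \<eta> = \<eta>(x \<mapsto> s)" if "\<eta> \<in> configs V" for \<eta> :: "'a \<rightharpoonup> bool" and s
    using that assms by (auto simp: fun_eq_iff map_add_def configs_None split: option.split)
  have "(\<Sum>\<eta>\<in>configs (insert x V). f \<eta>) = (\<Sum>\<eta>\<in>{[x \<mapsto> True], [x \<mapsto> False]}. \<Sum>\<eta>'\<in>configs V. f (\<eta> ++ \<eta>'))"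
    using assms sum_configs_Un[of "{x}" V f] by (simp only: configs_singleton) simp
  also have "\<dots> = (\<Sum>\<eta>'\<in>configs V. f ([x \<mapsto> True] ++ \<eta>')) + (\<Sum>\<eta>'\<in>configs V. f ([x \<mapsto> False] ++ \<eta>'))"
    using ne by simp
  finally show ?thesis
    by (simp add: eq)
qed

text \<open>Distributive law: weights that look only at disjoint blocks of vertices turn a sum over
  joint configurations into a product. It lets the subtrees of the children of a tree vertex be
  summed independently.\<close>

lemma sum_configs_UN:
  fixes W :: "'i \<Rightarrow> ('v \<rightharpoonup> bool) \<Rightarrow> real"
  assumes "finite I" "disjoint_family_on S I"
    and local: "\<And>i \<eta> \<eta>'. i \<in> I \<Longrightarrow> (\<And>v. v \<in> S i \<Longrightarrow> \<eta> v = \<eta>' v) \<Longrightarrow> W i \<eta> = W i \<eta>'"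
  shows "(\<Sum>\<eta>\<in>configs (\<Union>i\<in>I. S i). \<Prod>i\<in>I. W i \<eta>) = (\<Prod>i\<in>I. \<Sum>\<eta>\<in>configs (S i). W i \<eta>)"
  using assms
proof (induction I)
  case empty
  show ?case by simp
next
  case (insert i I)
  define B where "B = (\<Union>i\<in>I. S i)"
  have disj: "S i \<inter> B = {}"
    using insert.prems(1) insert.hyps(2) by (force simp: B_def disjoint_family_on_def)
  have IH: "(\<Sum>\<eta>\<in>configs B. \<Prod>i\<in>I. W i \<eta>) = (\<Prod>i\<in>I. \<Sum>\<eta>\<in>configs (S i). W i \<eta>)"
    unfolding B_def
  proof (rule insert.IH)
    show "disjoint_family_on S I"
      using insert.prems(1) by (auto simp: disjoint_family_on_def)
  next
    fix j and \<eta> \<eta>' :: "'v \<rightharpoonup> bool"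
    assume "j \<in> I" "\<And>v. v \<in> S j \<Longrightarrow> \<eta> v = \<eta>' v"
    then show "W j \<eta> = W j \<eta>'" by (rule insert.prems(2)[OF insertI2])
  qed
  have "(\<Sum>\<eta>\<in>configs (\<Union>i\<in>insert i I. S i). \<Prod>i\<in>insert i I. W i \<eta>) =
      (\<Sum>\<eta>\<in>configs (S i). \<Sum>\<eta>'\<in>configs B. \<Prod>i\<in>insert i I. W i (\<eta> ++ \<eta>'))"
    unfolding UN_insert B_def[symmetric] by (rule sum_configs_Un[OF disj, of "\<lambda>\<eta>. \<Prod>i\<in>insert i I. W i \<eta>"])
  also have "\<dots> = (\<Sum>\<eta>\<in>configs (S i). \<Sum>\<eta>'\<in>configs B. W i \<eta> * (\<Prod>i\<in>I. W i \<eta>'))"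
  proof (intro sum.cong refl)
    fix \<eta> \<eta>' :: "'v \<rightharpoonup> bool" assume *: "\<eta> \<in> configs (S i)" "\<eta>' \<in> configs B"
    have left: "(\<eta> ++ \<eta>') v = \<eta> v" if "v \<in> S i" for v
    proof -
      have "v \<notin> dom \<eta>'" using * disj that by (auto simp: dom_configs simp del: domIff)
      then show ?thesis by (rule map_add_dom_app_simps(3))
    qed
    have right: "(\<eta> ++ \<eta>') v = \<eta>' v" if "v \<in> B" for v
    proof -
      have "v \<in> dom \<eta>'" using * that by (simp add: dom_configs del: domIff)
      then show ?thesis by (rule map_add_dom_app_simps(1))
    qed
    have i: "W i (\<eta> ++ \<eta>') = W i \<eta>"
      by (rule insert.prems(2)[OF insertI1 left])
    have I: "(\<Prod>j\<in>I. W j (\<eta> ++ \<eta>')) = (\<Prod>j\<in>I. W j \<eta>')"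
    proof (rule prod.cong[OF refl])
      fix j assume j: "j \<in> I"
      then have "v \<in> B" if "v \<in> S j" for v using that unfolding B_def by blast
      then show "W j (\<eta> ++ \<eta>') = W j \<eta>'"
        by (rule insert.prems(2)[OF insertI2[OF j] right])
    qed
    show "(\<Prod>i\<in>insert i I. W i (\<eta> ++ \<eta>')) = W i \<eta> * (\<Prod>i\<in>I. W i \<eta>')"
      unfolding prod.insert[OF insert.hyps] i I ..
  qed
  also have "\<dots> = (\<Sum>\<eta>\<in>configs (S i). W i \<eta>) * (\<Sum>\<eta>'\<in>configs B. \<Prod>i\<in>I. W i \<eta>')"
    by (rule sum_product[symmetric])
  finally show ?case
    unfolding IH prod.insert[OF insert.hyps] .
qed


text \<open>
  A conditioned vertex has activity 0 at the wrong spin, so that conditional probabilities are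
  quotients of Gibbs sums.
\<close>

definition sg :: "bool \<Rightarrow> real" where
  "sg s = (if s then 1 else - 1)"

definition act :: "('v \<rightharpoonup> bool) \<Rightarrow> ('v \<Rightarrow> real) \<Rightarrow> 'v \<Rightarrow> bool \<Rightarrow> real" where
  "act c h v s = (if c v = Some (\<not> s) then 0 else exp (h v * sg s))"

definition gibbs :: "'v set \<Rightarrow> 'v set set \<Rightarrow> ('v set \<Rightarrow> real) \<Rightarrow> ('v \<Rightarrow> bool \<Rightarrow> real) \<Rightarrow> ('v \<rightharpoonup> bool) \<Rightarrow> real" where
  "gibbs V E J f \<eta> =
     (\<Prod>e\<in>E. exp (J e * (\<Prod>v\<in>e. spin \<eta> v))) * (\<Prod>v\<in>V. f v (\<eta> v = Some True))"

lemma sg_simps [simp]: "sg True = 1" "sg False = - 1"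
  by (simp_all add: sg_def)

lemma spin_eq_sg: "spin \<eta> v = sg (\<eta> v = Some True)"
  by (simp add: spin_def sg_def)

lemma act_nonneg: "0 \<le> act c h v s"
  by (simp add: act_def)

lemma gibbs_nonneg: "(\<And>v s. v \<in> V \<Longrightarrow> 0 \<le> f v s) \<Longrightarrow> 0 \<le> gibbs V E J f \<eta>"
  by (auto simp: gibbs_def intro!: mult_nonneg_nonneg prod_nonneg)

lemma gibbs_act:
  assumes "finite V" "finite E" "dom c \<subseteq> V" "\<eta> \<in> configs V"
  shows "gibbs V E J (act c h) \<eta> = (if c \<subseteq>\<^sub>m \<eta> then ising_weight V E J h \<eta> else 0)"
proof (cases "c \<subseteq>\<^sub>m \<eta>")
  case True
  have "act c h v (\<eta> v = Some True) = exp (h v * spin \<eta> v)" if v: "v \<in> V" for v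
  proof -
    obtain s where "\<eta> v = Some s" using configs_value[OF assms(4) v] ..
    moreover have "c v = None \<or> c v = \<eta> v"
      using True by (auto simp: map_le_def dom_def)
    ultimately show ?thesis by (auto simp: act_def spin_eq_sg)
  qed
  then have "(\<Prod>v\<in>V. act c h v (\<eta> v = Some True)) = exp (\<Sum>v\<in>V. h v * spin \<eta> v)"
    using assms(1) by (simp add: exp_sum)
  then show ?thesis
    using True assms(2) by (simp add: gibbs_def ising_weight_def exp_add exp_sum)
next
  case False
  then obtain v where v: "v \<in> dom c" "c v \<noteq> \<eta> v" by (auto simp: map_le_def)
  then have "v \<in> V" using assms(3) by blast
  from v(1) obtain s' where s': "c v = Some s'" by (auto simp: dom_def)
  obtain s where s: "\<eta> v = Some s" using configs_value[OF assms(4) \<open>v \<in> V\<close>] ..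
  have "s' \<noteq> s" using v(2) s s' by simp
  then have "act c h v (\<eta> v = Some True) = 0"
    using s s' by (cases s; cases s'; simp add: act_def)
  then show ?thesis
    using False \<open>v \<in> V\<close> assms(1) by (auto simp: gibbs_def intro: prod_zero)
qed

lemma prob_ising:
  assumes "finite V"
  shows "measure_pmf.prob (ising V E J h) A =
    (\<Sum>\<eta>\<in>{\<eta>\<in>configs V. \<eta> \<in> A}. ising_weight V E J h \<eta>) / (\<Sum>\<eta>\<in>configs V. ising_weight V E J h \<eta>)"
proof -
  have "set_pmf (ising V E J h) \<subseteq> configs V"
    using assms by (auto simp: set_pmf_iff pmf_ising split: if_splits)
  then have "measure_pmf.prob (ising V E J h) A = measure_pmf.prob (ising V E J h) {\<eta>\<in>configs V. \<eta> \<in> A}"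
    by (intro measure_pmf.finite_measure_eq_AE) (auto simp: AE_measure_pmf_iff)
  also have "\<dots> = (\<Sum>\<eta>\<in>{\<eta>\<in>configs V. \<eta> \<in> A}. pmf (ising V E J h) \<eta>)"
    using assms by (intro measure_measure_pmf_finite) (simp add: finite_configs)
  also have "\<dots> = (\<Sum>\<eta>\<in>{\<eta>\<in>configs V. \<eta> \<in> A}. ising_weight V E J h \<eta> / (\<Sum>\<eta>\<in>configs V. ising_weight V E J h \<eta>))"
    using assms by (intro sum.cong) (auto simp: pmf_ising)
  finally show ?thesis by (simp add: sum_divide_distrib)
qed

lemma sum_ising_weight_pos:
  assumes "finite V"
  shows "(\<Sum>\<eta>\<in>configs V. ising_weight V E J h \<eta>) > 0"
proof (rule sum_pos)
  show "configs V \<noteq> {}"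
    by (auto simp: configs_def dom_def intro!: exI[of _ "\<lambda>v. if v \<in> V then Some True else None"] split: if_splits)
qed (auto simp: finite_configs assms ising_weight_def)

text \<open>Incompatible configurations vanish through zero activities, and the normalising sum
  cancels between numerator and denominator. Into the quotient on the right the partition functions
  of the tree can be inserted.\<close>

lemma cond_prob_ising:
  assumes "finite V" "finite E" "dom c \<subseteq> V"
  shows "\<P>(\<eta> in ising V E J h. P \<eta> \<bar> c \<subseteq>\<^sub>m \<eta>) =
    (\<Sum>\<eta>\<in>{\<eta>\<in>configs V. P \<eta>}. gibbs V E J (act c h) \<eta>) / (\<Sum>\<eta>\<in>configs V. gibbs V E J (act c h) \<eta>)"
    (is "_ = ?thesis_rhs")
proof -
  define Z where "Z = (\<Sum>\<eta>\<in>configs V. ising_weight V E J h \<eta>)"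
  have Z: "Z > 0" unfolding Z_def by (rule sum_ising_weight_pos[OF assms(1)])
  have *: "measure_pmf.prob (ising V E J h) {\<eta>. Q \<eta> \<and> c \<subseteq>\<^sub>m \<eta>} =
      (\<Sum>\<eta>\<in>{\<eta>\<in>configs V. Q \<eta>}. gibbs V E J (act c h) \<eta>) / Z" for Q
  proof -
    have "(\<Sum>\<eta>\<in>{\<eta>\<in>configs V. \<eta> \<in> {\<eta>. Q \<eta> \<and> c \<subseteq>\<^sub>m \<eta>}}. ising_weight V E J h \<eta>) =
        (\<Sum>\<eta>\<in>{\<eta>\<in>configs V. Q \<eta>}. gibbs V E J (act c h) \<eta>)"
    proof (rule sum.mono_neutral_cong_left)
      show "finite {\<eta>\<in>configs V. Q \<eta>}"
        using finite_configs[OF assms(1)] by simp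
      show "{\<eta>\<in>configs V. \<eta> \<in> {\<eta>. Q \<eta> \<and> c \<subseteq>\<^sub>m \<eta>}} \<subseteq> {\<eta>\<in>configs V. Q \<eta>}"
        by blast
    next
      show "\<forall>\<eta>\<in>{\<eta>\<in>configs V. Q \<eta>} - {\<eta>\<in>configs V. \<eta> \<in> {\<eta>. Q \<eta> \<and> c \<subseteq>\<^sub>m \<eta>}}.
          gibbs V E J (act c h) \<eta> = 0"
      proof
        fix \<eta> assume "\<eta> \<in> {\<eta>\<in>configs V. Q \<eta>} - {\<eta>\<in>configs V. \<eta> \<in> {\<eta>. Q \<eta> \<and> c \<subseteq>\<^sub>m \<eta>}}"
        then have "\<eta> \<in> configs V" "\<not> c \<subseteq>\<^sub>m \<eta>" by blast+
        then show "gibbs V E J (act c h) \<eta> = 0" using gibbs_act[OF assms] by simp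
      qed
    next
      fix \<eta> assume "\<eta> \<in> {\<eta>\<in>configs V. \<eta> \<in> {\<eta>. Q \<eta> \<and> c \<subseteq>\<^sub>m \<eta>}}"
      then have "\<eta> \<in> configs V" "c \<subseteq>\<^sub>m \<eta>" by blast+
      then show "ising_weight V E J h \<eta> = gibbs V E J (act c h) \<eta>" using gibbs_act[OF assms] by simp
    qed
    then show ?thesis by (simp only: prob_ising[OF assms(1)] Z_def)
  qed
  have "\<P>(\<eta> in ising V E J h. P \<eta> \<bar> c \<subseteq>\<^sub>m \<eta>) =
      measure_pmf.prob (ising V E J h) {\<eta>. P \<eta> \<and> c \<subseteq>\<^sub>m \<eta>} /
      measure_pmf.prob (ising V E J h) {\<eta>. True \<and> c \<subseteq>\<^sub>m \<eta>}"
    by (simp add: cond_prob_def)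
  also have "\<dots> = ?thesis_rhs"
    unfolding * using Z by simp
  finally show ?thesis .
qed

section \<open>The truncated tree of self-avoiding walks\<close>

locale graph =
  fixes n :: nat and E :: "nat set set"
  assumes edges: "E \<subseteq> nsets {..<n} 2"
begin

lemma edge_vertices: "{x, u} \<in> E \<Longrightarrow> x < n \<and> u < n \<and> x \<noteq> u"
  using subsetD[OF edges, of "{x, u}"] by simp

lemma finite_edges: "finite E"
  using finite_subset[OF edges] finite_imp_finite_nsets[of "{..<n}" 2] by simp

text \<open>
  As in the program, a vertex of the tree is given by its reversed walk, split into the terminal
  vertex \<open>x\<close> and the rest \<open>ys\<close>.
\<close>

definition children :: "nat \<Rightarrow> nat list \<Rightarrow> nat set" where
  "children x ys = (if x \<in> set ys then {} else {u. {x, u} \<in> E \<and> (ys = [] \<or> u \<noteq> hd ys)})"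

lemma children_subset: "children x ys \<subseteq> {..<n}"
  using edge_vertices by (auto simp: children_def)

lemma finite_children: "finite (children x ys)"
  using children_subset by (rule finite_subset) simp

primrec subtree :: "nat \<Rightarrow> nat \<Rightarrow> nat list \<Rightarrow> nat list set" where
  "subtree 0 x ys = {rev (x # ys)}"
| "subtree (Suc k) x ys = insert (rev (x # ys)) (\<Union>u\<in>children x ys. subtree k u (x # ys))"

lemma finite_subtree: "finite (subtree k x ys)"
  by (induction k arbitrary: x ys) (auto simp: finite_children)

lemma root_in_subtree: "rev (x # ys) \<in> subtree k x ys"
  by (cases k) auto

lemma subtree_extends: "w \<in> subtree k x ys \<Longrightarrow> \<exists>zs. w = rev (x # ys) @ zs"
proof (induction k arbitrary: x ys)
  case (Suc k)
  then consider "w = rev (x # ys)" | u where "w \<in> subtree k u (x # ys)" by auto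
  then show ?case
  proof cases
    case 2
    then obtain zs where "w = rev (u # x # ys) @ zs" using Suc.IH by blast
    then show ?thesis by (intro exI[of _ "u # zs"]) simp
  qed auto
qed auto

lemma root_notin_subtree: "rev (x # ys) \<notin> subtree k u (x # ys)"
  using subtree_extends[of "rev (x # ys)" k u "x # ys"] by auto

text \<open>The entry at position \<open>Suc (length ys)\<close> of a walk tells through which child
  it passes.\<close>

lemma disjoint_subtrees: "disjoint_family_on (\<lambda>u. subtree k u (x # ys)) I"
proof -
  have "w ! Suc (length ys) = u" if "w \<in> subtree k u (x # ys)" for w u
    using subtree_extends[OF that] by (auto simp: nth_append)
  then show ?thesis unfolding disjoint_family_on_def disjoint_iff by metis
qed

lemma closes_cycle_rev: "closes_cycle (rev (x # ys)) \<longleftrightarrow> x \<in> set ys"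
  by (simp add: closes_cycle_def)

text \<open>Translates the global definition of the tree into the local rule of the program.
  Distinctness of all but the last vertex of the longer walk says that the shorter walk has not
  closed a cycle; what remains of the clause on closing positions is the ban on
  backtracking.\<close>

lemma saw_tree_rev_Cons:
  "rev (u # x # ys) \<in> saw_tree E v \<longleftrightarrow> rev (x # ys) \<in> saw_tree E v \<and> u \<in> children x ys"
proof -
  let ?w = "rev (x # ys)"
  have len: "length ?w = Suc (length ys)" by simp
  have nth: "(?w @ [u]) ! i = ?w ! i" if "i \<le> length ys" for i
    using that by (simp add: nth_append)
  have edges_iff: "(\<forall>i. Suc i < length (?w @ [u]) \<longrightarrow> {(?w @ [u]) ! i, (?w @ [u]) ! Suc i} \<in> E) \<longleftrightarrow>
      (\<forall>i. Suc i < length ?w \<longrightarrow> {?w ! i, ?w ! Suc i} \<in> E) \<and> {x, u} \<in> E" (is "?A \<longleftrightarrow> ?B \<and> _")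
  proof (intro iffI conjI)
    assume A: ?A
    show ?B
    proof (intro allI impI)
      fix i assume "Suc i < length ?w"
      then show "{?w ! i, ?w ! Suc i} \<in> E" using A[rule_format, of i] nth[of i] nth[of "Suc i"] by simp
    qed
    show "{x, u} \<in> E" using A[rule_format, of "length ys"] by (simp add: nth_append)
  next
    assume B: "?B \<and> {x, u} \<in> E"
    show ?A
    proof (intro allI impI)
      fix i assume "Suc i < length (?w @ [u])"
      then consider "i = length ys" | "Suc i < length ?w" by fastforce
      then show "{(?w @ [u]) ! i, (?w @ [u]) ! Suc i} \<in> E"
      proof cases
        case 1 then show ?thesis using B by (simp add: nth_append)
      next
        case 2 then show ?thesis using B nth[of i] nth[of "Suc i"] by simp
      qed
    qed
  qed
  \<comment> \<open>The new vertex has position \<open>Suc (length ys)\<close>, so the bound on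
    \<open>j\<close> admits the positions of all visited vertices except \<open>x\<close> and
    \<open>hd ys\<close>. As \<open>u \<noteq> x\<close>, only the step back to \<open>hd ys\<close>
    is excluded.\<close>
  have cyc: "\<not> closes_cycle (?w @ [u]) \<or> (\<exists>j. j + 2 < length (?w @ [u]) - 1 \<and> (?w @ [u]) ! j = u) \<longleftrightarrow>
     ys = [] \<or> u \<noteq> hd ys" if "distinct ?w" "u \<noteq> x"
  proof (cases ys)
    case Nil
    then show ?thesis using that by (simp add: closes_cycle_def)
  next
    case (Cons y zs)
    have *: "(\<exists>j. j + 2 < length (?w @ [u]) - 1 \<and> (?w @ [u]) ! j = u) \<longleftrightarrow> u \<in> set zs"
      (is "?L \<longleftrightarrow> _")
    proof
      assume ?L
      then obtain j where "j < length zs" "(?w @ [u]) ! j = u" using Cons by auto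
      then have "rev zs ! j = u" by (simp add: Cons nth_append)
      then show "u \<in> set zs" using \<open>j < length zs\<close> by (metis length_rev nth_mem set_rev)
    next
      assume "u \<in> set zs"
      then obtain j where "j < length zs" "rev zs ! j = u" by (metis in_set_conv_nth length_rev set_rev)
      then show ?L by (intro exI[of _ j]) (simp add: Cons nth_append)
    qed
    have "closes_cycle (?w @ [u]) \<longleftrightarrow> u \<in> set ys"
      unfolding closes_cycle_def butlast_snoc last_snoc using that by auto
    then show ?thesis using * Cons that by auto
  qed
  have "hd (?w @ [u]) = hd ?w" by (cases "rev ys") auto
  have "rev (u # x # ys) \<in> saw_tree E v \<longleftrightarrow> hd ?w = v \<and>
      (\<forall>i. Suc i < length ?w \<longrightarrow> {?w ! i, ?w ! Suc i} \<in> E) \<and> {x, u} \<in> E \<and> distinct ?w \<and>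
      (\<not> closes_cycle (?w @ [u]) \<or> (\<exists>j. j + 2 < length (?w @ [u]) - 1 \<and> (?w @ [u]) ! j = u))"
  proof -
    have eq: "rev (u # x # ys) = ?w @ [u]" by simp
    show ?thesis
      unfolding eq saw_tree_def mem_Collect_eq edges_iff \<open>hd (?w @ [u]) = hd ?w\<close> butlast_snoc last_snoc
      by blast
  qed
  also have "\<dots> \<longleftrightarrow> hd ?w = v \<and>
      (\<forall>i. Suc i < length ?w \<longrightarrow> {?w ! i, ?w ! Suc i} \<in> E) \<and> {x, u} \<in> E \<and> distinct ?w \<and>
      (ys = [] \<or> u \<noteq> hd ys)"
    using cyc edge_vertices[of x u] by blast
  also have "\<dots> \<longleftrightarrow> rev (x # ys) \<in> saw_tree E v \<and> u \<in> children x ys"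
  proof -
    have d: "distinct ?w \<longleftrightarrow> distinct (butlast ?w) \<and> \<not> closes_cycle ?w"
      unfolding closes_cycle_rev by auto
    show ?thesis
      unfolding saw_tree_def mem_Collect_eq d children_def
      using closes_cycle_rev[of x ys] by auto
  qed
  finally show ?thesis .
qed

lemma saw_tree_prefix:
  assumes "w @ zs \<in> saw_tree E v" "w \<noteq> []"
  shows "w \<in> saw_tree E v"
  using assms
proof (induction zs rule: rev_induct)
  case (snoc u zs)
  obtain x ys where "rev (w @ zs) = x # ys"
    using snoc.prems(2) by (metis append_is_Nil_conv neq_Nil_conv rev_is_Nil_conv)
  then have w: "w @ zs = rev (x # ys)" by (metis rev_rev_ident)
  have "rev (u # x # ys) \<in> saw_tree E v"
    using snoc.prems(1) w by (metis append_assoc rev.simps(2))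
  then show ?case using saw_tree_rev_Cons snoc.IH snoc.prems(2) w by metis
qed simp

text \<open>An extension of the starting walk shows in its first additional vertex through which
  child it passes, and prefixes of tree walks are tree walks. The recursion over the children
  therefore exhausts all extensions of bounded length.\<close>

lemma subtree_eq:
  assumes "rev (x # ys) \<in> saw_tree E v"
  shows "subtree k x ys =
    {w \<in> saw_tree E v. (\<exists>zs. w = rev (x # ys) @ zs) \<and> length w \<le> Suc (length ys + k)}"
  using assms
proof (induction k arbitrary: x ys)
  case 0
  then show ?case by auto
next
  case (Suc k)
  have IH: "subtree k u (x # ys) = {w \<in> saw_tree E v. (\<exists>zs. w = rev (u # x # ys) @ zs) \<and>
      length w \<le> Suc (length (x # ys) + k)}" if "u \<in> children x ys" for u
    using Suc.IH[of u "x # ys"] that Suc.prems saw_tree_rev_Cons by blast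
  show ?case
  proof (intro equalityI subsetI)
    fix w assume "w \<in> subtree (Suc k) x ys"
    then consider "w = rev (x # ys)" | u where "u \<in> children x ys" "w \<in> subtree k u (x # ys)" by auto
    then show "w \<in> {w \<in> saw_tree E v. (\<exists>zs. w = rev (x # ys) @ zs) \<and> length w \<le> Suc (length ys + Suc k)}"
    proof cases
      case 1 then show ?thesis using Suc.prems by simp
    next
      case 2
      then show ?thesis using IH[OF 2(1)] by auto
    qed
  next
    fix w assume w: "w \<in> {w \<in> saw_tree E v. (\<exists>zs. w = rev (x # ys) @ zs) \<and> length w \<le> Suc (length ys + Suc k)}"
    then obtain zs where zs: "w = rev (x # ys) @ zs" by blast
    show "w \<in> subtree (Suc k) x ys"
    proof (cases zs)
      case Nil then show ?thesis using zs by simp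
    next
      case (Cons u us)
      have w': "w = rev (u # x # ys) @ us" using zs Cons by simp
      then have "rev (u # x # ys) \<in> saw_tree E v" using w saw_tree_prefix by blast
      then have u: "u \<in> children x ys" using saw_tree_rev_Cons by blast
      then have "w \<in> subtree k u (x # ys)" using IH[OF u] w w' by auto
      then show ?thesis using u by auto
    qed
  qed
qed

lemma root_in_saw_tree: "[v] \<in> saw_tree E v"
  by (simp add: saw_tree_def closes_cycle_def)

lemma saw_tree_extends_root: "w \<in> saw_tree E v \<Longrightarrow> \<exists>zs. w = [v] @ zs"
  by (cases w) (auto simp: saw_tree_def)

lemma saw_tree_upto_eq: "saw_tree_upto E L v = subtree L v []"
  using subtree_eq[of v "[]" v L] root_in_saw_tree saw_tree_extends_root
  by (auto simp: saw_tree_upto_def)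

section \<open>Weights and partition functions of subtrees\<close>

primrec subtree_weight ::
  "(nat set \<Rightarrow> real) \<Rightarrow> (nat list \<Rightarrow> bool \<Rightarrow> real) \<Rightarrow> nat \<Rightarrow> nat \<Rightarrow> nat list \<Rightarrow> (nat list \<rightharpoonup> bool) \<Rightarrow> real" where
  "subtree_weight J f 0 x ys \<eta> = f (rev (x # ys)) (\<eta> (rev (x # ys)) = Some True)"
| "subtree_weight J f (Suc k) x ys \<eta> =
     f (rev (x # ys)) (\<eta> (rev (x # ys)) = Some True) *
     (\<Prod>u\<in>children x ys. exp (J {x, u} * spin \<eta> (rev (x # ys)) * spin \<eta> (rev (u # x # ys))) *
        subtree_weight J f k u (x # ys) \<eta>)"

lemma subtree_weight_local:
  "(\<And>w. w \<in> subtree k x ys \<Longrightarrow> \<eta> w = \<eta>' w) \<Longrightarrow> subtree_weight J f k x ys \<eta> = subtree_weight J f k x ys \<eta>'"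
proof (induction k arbitrary: x ys)
  case 0
  then show ?case by simp
next
  case (Suc k)
  have root: "\<eta> (rev (x # ys)) = \<eta>' (rev (x # ys))"
    by (rule Suc.prems) (rule root_in_subtree)
  have child: "\<eta> (rev (u # x # ys)) = \<eta>' (rev (u # x # ys))" if "u \<in> children x ys" for u
    using that root_in_subtree[of u "x # ys" k] by (intro Suc.prems) (auto simp del: rev.simps)
  have "subtree_weight J f k u (x # ys) \<eta> = subtree_weight J f k u (x # ys) \<eta>'"
    if "u \<in> children x ys" for u
    using that by (intro Suc.IH Suc.prems) auto
  then show ?case
    using root child by (simp add: spin_def del: rev.simps cong: prod.cong)
qed

text \<open>The recursion charges the edge between a vertex and its child at the vertex; the flat
  product charges it at the child \<open>w\<close>, as the edge from \<open>butlast w\<close>. Every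
  vertex but the root has exactly one such edge.\<close>

lemma subtree_weight_eq:
  "subtree_weight J f k x ys \<eta> =
     (\<Prod>w\<in>subtree k x ys. f w (\<eta> w = Some True)) *
     (\<Prod>w\<in>subtree k x ys - {rev (x # ys)}.
        exp (J {last (butlast w), last w} * spin \<eta> (butlast w) * spin \<eta> w))"
proof (induction k arbitrary: x ys)
  case 0
  show ?case by simp
next
  case (Suc k)
  let ?S = "\<lambda>u. subtree k u (x # ys)" and ?r = "rev (x # ys)"
  let ?f = "\<lambda>w. f w (\<eta> w = Some True)"
  let ?g = "\<lambda>w. exp (J {last (butlast w), last w} * spin \<eta> (butlast w) * spin \<eta> w)"
  have disj: "\<forall>u\<in>children x ys. \<forall>u'\<in>children x ys. u \<noteq> u' \<longrightarrow> ?S u \<inter> ?S u' = {}"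
    using disjoint_subtrees[of k x ys UNIV] by (auto simp: disjoint_family_on_def)
  have fin: "\<forall>u\<in>children x ys. finite (?S u)" using finite_subtree by blast
  have r: "?r \<notin> (\<Union>u\<in>children x ys. ?S u)" using root_notin_subtree by blast
  have F: "(\<Prod>w\<in>subtree (Suc k) x ys. ?f w) = ?f ?r * (\<Prod>u\<in>children x ys. \<Prod>w\<in>?S u. ?f w)"
    using r fin prod.UNION_disjoint[OF finite_children fin disj, of ?f]
    by (simp add: finite_children del: rev.simps)
  have D: "subtree (Suc k) x ys - {?r} = (\<Union>u\<in>children x ys. ?S u)"
    using r by auto
  have "(\<Prod>w\<in>?S u. ?g w) = exp (J {x, u} * spin \<eta> ?r * spin \<eta> (rev (u # x # ys))) *
      (\<Prod>w\<in>?S u - {rev (u # x # ys)}. ?g w)" for u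
  proof -
    have "exp (J {x, u} * spin \<eta> ?r * spin \<eta> (rev (u # x # ys))) = ?g (rev (u # x # ys))"
      by (simp add: butlast_append)
    then show ?thesis
      by (simp only: prod.remove[OF finite_subtree root_in_subtree])
  qed
  then have G: "(\<Prod>w\<in>subtree (Suc k) x ys - {?r}. ?g w) =
      (\<Prod>u\<in>children x ys. exp (J {x, u} * spin \<eta> ?r * spin \<eta> (rev (u # x # ys))) *
        (\<Prod>w\<in>?S u - {rev (u # x # ys)}. ?g w))"
    unfolding D using prod.UNION_disjoint[OF finite_children fin disj, of ?g] by simp
  show ?case
    unfolding F G subtree_weight.simps(2) Suc.IH prod.distrib by (simp only: mult_ac)
qed

definition subtree_pf :: "(nat set \<Rightarrow> real) \<Rightarrow> (nat list \<Rightarrow> bool \<Rightarrow> real) \<Rightarrow> nat \<Rightarrow> nat \<Rightarrow> nat list \<Rightarrow> bool \<Rightarrow> real" where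
  "subtree_pf J f k x ys s =
     (\<Sum>\<eta>\<in>configs (subtree k x ys). if \<eta> (rev (x # ys)) = Some s then subtree_weight J f k x ys \<eta> else 0)"

lemma subtree_pf_0: "subtree_pf J f 0 x ys s = f (rev (x # ys)) s"
proof -
  have "[w \<mapsto> True] \<noteq> [w \<mapsto> False]" for w :: "nat list"
    by (metis fun_upd_same option.inject)
  then show ?thesis
    by (cases s) (simp_all add: subtree_pf_def configs_singleton)
qed

text \<open>Once the spin of the root is fixed, the subtrees of its children no longer interact, and
  the sum over configurations becomes a product over the children. In each factor the two spins of
  the child are separated.\<close>

lemma subtree_pf_Suc:
  "subtree_pf J f (Suc k) x ys s = f (rev (x # ys)) s *
     (\<Prod>u\<in>children x ys. exp (J {x, u} * sg s) * subtree_pf J f k u (x # ys) True +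
                          exp (- (J {x, u} * sg s)) * subtree_pf J f k u (x # ys) False)"
proof -
  let ?r = "rev (x # ys)" and ?S = "\<lambda>u. subtree k u (x # ys)"
  let ?B = "\<Union>u\<in>children x ys. ?S u"
  let ?W = "\<lambda>u \<eta>. exp (J {x, u} * sg s * spin \<eta> (rev (u # x # ys))) * subtree_weight J f k u (x # ys) \<eta>"
  have r: "?r \<notin> ?B" using root_notin_subtree by blast
  have C: "(\<Sum>\<eta>\<in>configs (?S u). ?W u \<eta>) = exp (J {x, u} * sg s) * subtree_pf J f k u (x # ys) True +
      exp (- (J {x, u} * sg s)) * subtree_pf J f k u (x # ys) False" for u
    unfolding subtree_pf_def sum_distrib_left sum.distrib[symmetric]
  proof (rule sum.cong[OF refl])
    fix \<eta> assume \<eta>: "\<eta> \<in> configs (?S u)"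
    obtain t where "\<eta> (rev (u # x # ys)) = Some t"
      using configs_value[OF \<eta> root_in_subtree] by blast
    then show "?W u \<eta> = exp (J {x, u} * sg s) *
          (if \<eta> (rev (u # x # ys)) = Some True then subtree_weight J f k u (x # ys) \<eta> else 0) +
        exp (- (J {x, u} * sg s)) *
          (if \<eta> (rev (u # x # ys)) = Some False then subtree_weight J f k u (x # ys) \<eta> else 0)"
      by (cases t) (simp_all add: spin_def del: rev.simps)
  qed
  have "subtree_weight J f (Suc k) x ys (\<eta>(?r \<mapsto> s)) = f ?r s * (\<Prod>u\<in>children x ys. ?W u \<eta>)" for \<eta>
  proof -
    have "spin (\<eta>(?r \<mapsto> s)) ?r = sg s" by (simp add: spin_def sg_def)
    moreover have "spin (\<eta>(?r \<mapsto> s)) (rev (u # x # ys)) = spin \<eta> (rev (u # x # ys))" for u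
      by (simp add: spin_def)
    moreover have "subtree_weight J f k u (x # ys) (\<eta>(?r \<mapsto> s)) = subtree_weight J f k u (x # ys) \<eta>" for u
      using root_notin_subtree by (intro subtree_weight_local) (auto simp del: rev.simps)
    ultimately show ?thesis by (simp del: rev.simps)
  qed
  then have "subtree_pf J f (Suc k) x ys s = (\<Sum>\<eta>\<in>configs ?B. f ?r s * (\<Prod>u\<in>children x ys. ?W u \<eta>))"
    unfolding subtree_pf_def subtree.simps(2) sum_configs_insert[OF r]
    by (cases s) (simp_all del: rev.simps subtree_weight.simps)
  also have "\<dots> = f ?r s * (\<Sum>\<eta>\<in>configs ?B. \<Prod>u\<in>children x ys. ?W u \<eta>)"
    by (simp add: sum_distrib_left)
  also have "(\<Sum>\<eta>\<in>configs ?B. \<Prod>u\<in>children x ys. ?W u \<eta>) =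
      (\<Prod>u\<in>children x ys. \<Sum>\<eta>\<in>configs (?S u). ?W u \<eta>)"
  proof (rule sum_configs_UN[OF finite_children disjoint_subtrees])
    fix u and \<eta> \<eta>' :: "nat list \<rightharpoonup> bool"
    assume *: "\<And>w. w \<in> ?S u \<Longrightarrow> \<eta> w = \<eta>' w"
    have "subtree_weight J f k u (x # ys) \<eta> = subtree_weight J f k u (x # ys) \<eta>'"
      by (rule subtree_weight_local) (rule *)
    then show "?W u \<eta> = ?W u \<eta>'"
      unfolding spin_def *[OF root_in_subtree] by simp
  qed
  finally show ?thesis unfolding C .
qed

text \<open>The edges of a tree correspond to its non-root vertices, each joined to its parent; this
  turns the product over edges into the product of \<open>subtree_weight_eq\<close>.\<close>

lemma gibbs_saw_tree:
  "gibbs (saw_tree_upto E L v) (tree_edges (saw_tree_upto E L v)) (\<lambda>e. J (last ` e)) f \<eta> =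
     subtree_weight J f L v [] \<eta>"
proof -
  let ?T = "subtree L v []"
  have nonempty: "w \<noteq> []" if "w \<in> ?T" for w using subtree_extends[OF that] by auto
  have long: "length w \<ge> 2" if w: "w \<in> ?T - {[v]}" for w
  proof -
    obtain zs where "w = v # zs" using subtree_extends[of w L v "[]"] w by auto
    then show ?thesis using w by (cases zs) auto
  qed
  then have T: "{w \<in> ?T. length w \<ge> 2} = ?T - {[v]}" by auto
  have inj: "inj_on (\<lambda>w. {butlast w, w}) (?T - {[v]})"
  proof (rule inj_onI)
    fix w w' assume *: "w \<in> ?T - {[v]}" "w' \<in> ?T - {[v]}" "{butlast w, w} = {butlast w', w'}"
    show "w = w'"
    proof (rule ccontr)
      assume "w \<noteq> w'"
      then have "w = butlast w'" "w' = butlast w" using *(3) by (auto simp: doubleton_eq_iff)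
      then have "length w = length w - 1 - 1" by (metis length_butlast)
      then show False using long[OF *(1)] by simp
    qed
  qed
  have "tree_edges ?T = (\<lambda>w. {butlast w, w}) ` (?T - {[v]})"
    unfolding tree_edges_def T[symmetric] by blast
  then have "(\<Prod>e\<in>tree_edges ?T. exp (J (last ` e) * (\<Prod>w\<in>e. spin \<eta> w))) =
      (\<Prod>w\<in>?T - {[v]}. exp (J (last ` {butlast w, w}) * (\<Prod>w\<in>{butlast w, w}. spin \<eta> w)))"
    by (simp add: prod.reindex[OF inj])
  also have "\<dots> = (\<Prod>w\<in>?T - {[v]}. exp (J {last (butlast w), last w} * spin \<eta> (butlast w) * spin \<eta> w))"
  proof (rule prod.cong[OF refl])
    fix w assume "w \<in> ?T - {[v]}"
    then have "butlast w \<noteq> w" using long[of w] by (cases w rule: rev_cases) auto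
    then show "exp (J (last ` {butlast w, w}) * (\<Prod>w\<in>{butlast w, w}. spin \<eta> w)) =
        exp (J {last (butlast w), last w} * spin \<eta> (butlast w) * spin \<eta> w)"
      by (simp add: mult.assoc)
  qed
  finally show ?thesis
    unfolding gibbs_def saw_tree_upto_eq subtree_weight_eq by (simp add: mult.commute)
qed

end

section \<open>The program\<close>

lemma fst_next_after_visit_eq_None: "fst (next_after_visit x p ys) = None \<longleftrightarrow> x \<notin> set ys"
  by (induction ys arbitrary: p) (auto simp: Let_def split_beta)

lemma snd_next_after_visit: "snd (next_after_visit x p ys) \<le> 2 * length ys + 2"
proof (induction ys arbitrary: p)
  case (Cons y ys)
  show ?case using Cons[of y] by (simp add: Let_def split_beta)
qed simp

text \<open>The position \<open>j\<close> counts from the start of the walk, whereas the search runs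
  from its end; as no vertex is repeated, both find the same visit.\<close>

lemma fst_next_after_visit:
  assumes "distinct ys" "j < length ys" "rev ys ! j = x"
  shows "fst (next_after_visit x p ys) = Some (rev (p # ys) ! Suc j)"
  using assms
proof (induction ys arbitrary: p)
  case (Cons y ys)
  show ?case
  proof (cases "y = x")
    case True
    have "j = length ys"
    proof (rule ccontr)
      assume "j \<noteq> length ys"
      then have "j < length ys" using Cons.prems(2) by simp
      then have "rev ys ! j = x" using Cons.prems(3) by (simp add: nth_append)
      then have "x \<in> set ys" using \<open>j < length ys\<close> by (metis length_rev nth_mem set_rev)
      then show False using Cons.prems(1) True by simp
    qed
    then show ?thesis using True by (simp add: nth_append)
  next
    case False
    have j: "j < length ys"
    proof (rule ccontr)
      assume "\<not> j < length ys"
      then have "j = length ys" using Cons.prems(2) by simp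
      then show False using Cons.prems(3) False by (simp add: nth_append)
    qed
    then have "rev ys ! j = x" using Cons.prems(3) by (simp add: nth_append)
    then have "fst (next_after_visit x y ys) = Some (rev (y # ys) ! Suc j)"
      using Cons.IH[of y] Cons.prems(1) j by simp
    then show ?thesis using False j by (simp add: Let_def split_beta nth_append)
  qed
qed simp

text \<open>Distinctness makes the closing position \<open>j\<close> unique. The search returns the
  vertex after the visit at \<open>j\<close>, and \<open>hd ys\<close> is the vertex from which the
  cycle is closed.\<close>

lemma saw_tau_rev:
  assumes "distinct ys" "x \<in> set ys"
  shows "saw_tau ord (rev (x # ys)) = precedes ord x (the (fst (next_after_visit x x ys))) (hd ys)"
proof -
  obtain j where j: "j < length ys" "rev ys ! j = x"
    using assms(2) by (metis in_set_conv_nth length_rev set_rev)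
  have "ys \<noteq> []" using assms(2) by auto
  then have last: "rev (x # ys) ! (length ys - 1) = hd ys"
    by (cases ys) (simp_all add: nth_append)
  have "(THE j. j < length ys \<and> rev (x # ys) ! j = x) = j"
  proof (rule the_equality)
    show "j < length ys \<and> rev (x # ys) ! j = x" using j by (simp add: nth_append)
  next
    fix i assume "i < length ys \<and> rev (x # ys) ! i = x"
    then have "i < length ys" "rev ys ! i = x" by (auto simp: nth_append)
    then show "i = j" using j assms(1) by (metis distinct_rev length_rev nth_eq_iff_index_eq)
  qed
  then show "saw_tau ord (rev (x # ys)) = precedes ord x (the (fst (next_after_visit x x ys))) (hd ys)"
    using fst_next_after_visit[OF assms(1) j, of x] last by (simp add: saw_tau_def Let_def)
qed

lemma product_over_eq:
  assumes "distinct us"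
  shows "fst (product_over f us) = ((\<Prod>u\<in>set us. fst (fst (f u))), (\<Prod>u\<in>set us. snd (fst (f u))))"
    and "snd (product_over f us) = (\<Sum>u\<in>set us. snd (f u) + 3) + 1"
  using assms by (induction us) (auto simp: Let_def split_beta)

text \<open>The condition as the program sees it, from the walk and the level alone. The order of
  the cases matters: an assigned spin overrides \<tau>, and \<tau> overrides the boundary condition
  even at the bottom.\<close>

definition local_condition ::
  "(nat \<Rightarrow> nat rel) \<Rightarrow> ((nat \<rightharpoonup> bool) \<Rightarrow> nat list \<rightharpoonup> bool) \<Rightarrow> (nat \<rightharpoonup> bool) \<Rightarrow> bool \<Rightarrow> nat \<Rightarrow> nat list \<Rightarrow> bool option" where
  "local_condition ord bc \<sigma> at_bottom x ys = (case \<sigma> x of Some s \<Rightarrow> Some s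
     | None \<Rightarrow> (case fst (next_after_visit x x ys) of Some y \<Rightarrow> Some (precedes ord x y (hd ys))
       | None \<Rightarrow> if at_bottom then bc \<sigma> (rev (x # ys)) else None))"

section \<open>Correctness of the program\<close>

context graph
begin

lemma fst_eval_vertex:
  "fst (eval_vertex n E J h ord bc \<sigma> at_bottom x ys rec) =
     (let P = (\<lambda>s. act (\<lambda>_. local_condition ord bc \<sigma> at_bottom x ys) h x s *
        (if at_bottom then 1 else \<Prod>u\<in>children x ys. exp (J {x, u} * sg s) * fst (fst (rec u)) +
             exp (- (J {x, u} * sg s)) * snd (fst (rec u)))) in (P True, P False))"
proof -
  define g where "g u = (if {x, u} \<in> E \<and> (ys = [] \<or> u \<noteq> hd ys)
       then let ((a, b), t) = rec u; e = exp (J {x, u})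
            in ((e * a + b / e, a / e + e * b), t + 14)
       else ((1, 1), 6 :: nat))" for u
  \<comment> \<open>The neighbours to which a step does not backtrack; all other indices contribute
    the factor 1. On a walk that has closed a cycle the program skips the product, so
    \<open>N\<close> matters only where it equals \<open>children x ys\<close>.\<close>
  define N where "N = {u. {x, u} \<in> E \<and> (ys = [] \<or> u \<noteq> hd ys)}"
  have N: "N \<subseteq> {..<n}" using edge_vertices by (auto simp: N_def)
  have "(\<Prod>u\<in>{..<n}. fst (fst (g u))) = (\<Prod>u\<in>N. exp (J {x, u}) * fst (fst (rec u)) + exp (- J {x, u}) * snd (fst (rec u)))"
    using N by (intro prod.mono_neutral_cong_right) (auto simp: g_def N_def Let_def split_beta exp_minus field_simps)
  moreover have "(\<Prod>u\<in>{..<n}. snd (fst (g u))) = (\<Prod>u\<in>N. exp (- J {x, u}) * fst (fst (rec u)) + exp (J {x, u}) * snd (fst (rec u)))"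
    using N by (intro prod.mono_neutral_cong_right) (auto simp: g_def N_def Let_def split_beta exp_minus field_simps)
  ultimately have "fst (product_over g [0..<n]) =
    ((\<Prod>u\<in>N. exp (J {x, u}) * fst (fst (rec u)) + exp (- J {x, u}) * snd (fst (rec u))),
     (\<Prod>u\<in>N. exp (- J {x, u}) * fst (fst (rec u)) + exp (J {x, u}) * snd (fst (rec u))))"
    by (simp add: product_over_eq atLeast0LessThan)
  moreover have "N = children x ys" if "x \<notin> set ys" using that by (simp add: N_def children_def)
  moreover have "children x ys = {}" if "x \<in> set ys" using that by (simp add: children_def)
  ultimately show ?thesis
    unfolding eval_vertex_def g_def[symmetric, abs_def]
    using fst_next_after_visit_eq_None[of x x ys]
    by (auto simp: Let_def split_beta local_condition_def act_def split: option.splits)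
qed

text \<open>The search takes at most \<open>2 * length ys + 2\<close> steps, the condition at most 6
  or \<open>length ys + 4\<close>, and 9 are overhead. The 17 for each candidate \<open>u\<close>
  are 14 for the edge and 3 for \<open>product_over\<close>.\<close>

lemma snd_eval_vertex:
  "snd (eval_vertex n E J h ord bc \<sigma> at_bottom x ys rec) \<le> 3 * length ys + 17 +
     (if x \<in> set ys \<or> at_bottom then 2 else 1 + 17 * n + (\<Sum>u\<in>children x ys. snd (rec u)))"
proof -
  define g where "g u = (if {x, u} \<in> E \<and> (ys = [] \<or> u \<noteq> hd ys)
       then let ((a, b), t) = rec u; e = exp (J {x, u})
            in ((e * a + b / e, a / e + e * b), t + 14)
       else ((1, 1), 6 :: nat))" for u
  have g: "snd (product_over g [0..<n]) \<le> 1 + 17 * n + (\<Sum>u\<in>children x ys. snd (rec u))" if "x \<notin> set ys"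
  proof -
    have "(\<Sum>u<n. snd (g u) + 3) \<le> (\<Sum>u<n. 17 + (if u \<in> children x ys then snd (rec u) else 0))"
      using that by (intro sum_mono) (auto simp: g_def children_def Let_def split_beta)
    also have "\<dots> = 17 * n + (\<Sum>u\<in>children x ys. snd (rec u))"
      using children_subset[of x ys] by (simp add: sum.distrib sum.If_cases Int_absorb1)
    finally show ?thesis by (simp add: product_over_eq atLeast0LessThan)
  qed
  show ?thesis
    unfolding eval_vertex_def g_def[symmetric, abs_def]
    using fst_next_after_visit_eq_None[of x x ys] snd_next_after_visit[of x x ys] g
    by (auto simp: Let_def split_beta split: option.splits)
qed

lemma local_condition_eq:
  assumes "rev (x # ys) \<in> saw_tree E v" "length ys + k = L"
  shows "local_condition ord bc \<sigma> (k = 0) x ys = saw_condition E ord bc L \<sigma> v (rev (x # ys))"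
proof -
  have dist: "distinct ys" using assms(1) by (simp add: saw_tree_def)
  have in_tree: "rev (x # ys) \<in> saw_tree_upto E L v"
    using assms by (simp add: saw_tree_upto_def del: rev.simps)
  have cond: "saw_condition E ord bc L \<sigma> v (rev (x # ys)) =
      (if x \<in> dom \<sigma> then \<sigma> x else if x \<in> set ys then Some (saw_tau ord (rev (x # ys)))
       else if k = 0 then bc \<sigma> (rev (x # ys)) else None)"
    using in_tree assms(2) closes_cycle_rev[of x ys]
    by (auto simp: saw_condition_def simp del: rev.simps) auto
  show ?thesis
  proof (cases "x \<in> set ys")
    case True
    obtain y where "fst (next_after_visit x x ys) = Some y"
      using fst_next_after_visit_eq_None[of x x ys] True by auto
    then show ?thesis
      using True saw_tau_rev[OF dist True, of ord] cond
      by (auto simp: local_condition_def domIff simp del: rev.simps split: option.splits)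
  next
    case False
    then have "fst (next_after_visit x x ys) = None"
      by (simp add: fst_next_after_visit_eq_None)
    then show ?thesis
      using False cond
      by (auto simp: local_condition_def domIff simp del: rev.simps split: option.splits)
  qed
qed

lemma eval_subtree_eq:
  fixes h :: "nat \<Rightarrow> real" and ord bc \<sigma>
  assumes "rev (x # ys) \<in> saw_tree E v" "length ys + k = L"
  defines "f \<equiv> act (saw_condition E ord bc L \<sigma> v) (\<lambda>w. h (last w))"
  shows "fst (eval_subtree n E J h ord bc \<sigma> k x ys) = (subtree_pf J f k x ys True, subtree_pf J f k x ys False)"
  using assms(1,2)
proof (induction k arbitrary: x ys)
  case 0
  have "act (\<lambda>_. local_condition ord bc \<sigma> True x ys) h x s = f (rev (x # ys)) s" for s
    using local_condition_eq[OF 0, of ord bc \<sigma>] by (simp add: act_def f_def)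
  then show ?case by (simp add: fst_eval_vertex subtree_pf_0 Let_def del: rev.simps)
next
  case (Suc k)
  have "act (\<lambda>_. local_condition ord bc \<sigma> False x ys) h x s = f (rev (x # ys)) s" for s
    using local_condition_eq[OF Suc.prems, of ord bc \<sigma>] by (simp add: act_def f_def)
  moreover have "fst (eval_subtree n E J h ord bc \<sigma> k u (x # ys)) =
      (subtree_pf J f k u (x # ys) True, subtree_pf J f k u (x # ys) False)" if "u \<in> children x ys" for u
    using Suc.prems that saw_tree_rev_Cons by (intro Suc.IH) auto
  ultimately show ?case
    by (simp add: fst_eval_vertex subtree_pf_Suc Let_def del: rev.simps cong: prod.cong)
qed

text \<open>The two values at the root are the conditioned partition functions with the spin of the
  root fixed. Their sum is the full conditioned partition function, so the quotient is the
  conditional probability.\<close>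

lemma compute_prob_eq_saw_prob:
  "fst (compute_prob n E J h ord bc L \<sigma> v) = saw_prob E J h ord bc L \<sigma> v"
proof -
  let ?T = "saw_tree_upto E L v"
  define c where "c = saw_condition E ord bc L \<sigma> v"
  define f where "f = act c (\<lambda>w. h (last w))"
  have fin: "finite ?T" by (simp add: saw_tree_upto_eq finite_subtree)
  have "dom c \<subseteq> ?T" by (auto simp: c_def saw_condition_def split: if_splits)
  moreover have "finite (tree_edges ?T)"
    using finite_imageI[OF fin, of "\<lambda>w. {butlast w, w}"]
    by (rule finite_subset[rotated]) (auto simp: tree_edges_def)
  ultimately have "saw_prob E J h ord bc L \<sigma> v =
      (\<Sum>\<eta>\<in>{\<eta>\<in>configs ?T. \<eta> [v] = Some True}. subtree_weight J f L v [] \<eta>) /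
      (\<Sum>\<eta>\<in>configs ?T. subtree_weight J f L v [] \<eta>)"
    unfolding saw_prob_def saw_ising_def c_def[symmetric] by (simp add: cond_prob_ising[OF fin] gibbs_saw_tree f_def)
  also have "(\<Sum>\<eta>\<in>{\<eta>\<in>configs ?T. \<eta> [v] = Some True}. subtree_weight J f L v [] \<eta>) = subtree_pf J f L v [] True"
    unfolding subtree_pf_def saw_tree_upto_eq[symmetric]
    using fin by (subst sum.inter_filter) (simp_all add: finite_configs)
  also have "(\<Sum>\<eta>\<in>configs ?T. subtree_weight J f L v [] \<eta>) = subtree_pf J f L v [] True + subtree_pf J f L v [] False"
    unfolding subtree_pf_def saw_tree_upto_eq[symmetric] sum.distrib[symmetric]
  proof (rule sum.cong[OF refl])
    fix \<eta> assume \<eta>: "\<eta> \<in> configs ?T"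
    have "[v] \<in> ?T" using root_in_saw_tree by (simp add: saw_tree_upto_def)
    then obtain s where "\<eta> [v] = Some s" using configs_value[OF \<eta>] by blast
    then show "subtree_weight J f L v [] \<eta> =
        (if \<eta> (rev [v]) = Some True then subtree_weight J f L v [] \<eta> else 0) +
        (if \<eta> (rev [v]) = Some False then subtree_weight J f L v [] \<eta> else 0)"
      by (cases s) simp_all
  qed
  finally show ?thesis
    using eval_subtree_eq[of v "[]" v L L J h ord bc \<sigma>] root_in_saw_tree
    by (simp add: compute_prob_def split_beta f_def c_def)
qed

lemma run_sampler_implements:
  "map_pmf fst (run_sampler n E J h ord bc L vs \<sigma>) = saw_output E J h ord bc L vs \<sigma>"
proof (induction vs arbitrary: \<sigma>)
  case (Cons v vs)
  have "(\<lambda>p. fst (case p of (\<sigma>', t') \<Rightarrow> (\<sigma>', t + t' + 4))) = (fst :: (nat \<rightharpoonup> bool) \<times> nat \<Rightarrow> _)" for t :: nat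
    by auto
  then show ?case
    using Cons compute_prob_eq_saw_prob[of J h ord bc L \<sigma> v]
    by (simp add: Let_def split_beta map_bind_pmf pmf.map_comp o_def del: fun_upd_apply)
qed simp

end

section \<open>Running time in terms of the number of self-avoiding walks\<close>

primrec saw_count :: "nat \<Rightarrow> nat set set \<Rightarrow> nat \<Rightarrow> nat \<Rightarrow> nat list \<Rightarrow> nat" where
  "saw_count n E 0 x ys = 1"
| "saw_count n E (Suc k) x ys =
     (\<Sum>u<n. if {x, u} \<in> E \<and> u \<notin> set (x # ys) then saw_count n E k u (x # ys) else 0)"

context graph
begin

text \<open>\<open>saw_count\<close> counts only walks that stay self-avoiding. A leaf that closes a
  cycle is charged to its parent: each self-avoiding walk pays for itself and for up to
  \<open>n\<close> such leaves of cost at most \<open>3 * L + 19\<close>, altogether at most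
  \<open>B\<close>.\<close>

lemma snd_eval_subtree:
  fixes L :: nat
  assumes "x \<notin> set ys" "length ys + k \<le> L"
  defines "B \<equiv> 3 * L + 19 + n * (3 * L + 39)"
  shows "snd (eval_subtree n E J h ord bc \<sigma> k x ys) \<le> B * (\<Sum>j\<le>k. saw_count n E j x ys)"
  using assms(1,2)
proof (induction k arbitrary: x ys)
  case 0
  then show ?case
    using snd_eval_vertex[of J h ord bc \<sigma> True x ys "\<lambda>u. ((1, 1), 0)"] by (simp add: B_def)
next
  case (Suc k)
  let ?t = "\<lambda>u. snd (eval_subtree n E J h ord bc \<sigma> k u (x # ys))"
  let ?b = "\<lambda>u. if {x, u} \<in> E \<and> u \<notin> set (x # ys) then B * (\<Sum>j\<le>k. saw_count n E j u (x # ys)) else 0"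
  have t: "?t u \<le> (3 * L + 19) + ?b u" if "u \<in> children x ys" for u
  proof (cases "u \<in> set ys")
    case True
    then have "?t u \<le> 3 * length (x # ys) + 19"
      using snd_eval_vertex[of J h ord bc \<sigma> True u "x # ys"] snd_eval_vertex[of J h ord bc \<sigma> False u "x # ys"]
      by (cases k) (auto split: if_splits)
    then show ?thesis using Suc.prems(2) by simp
  next
    case False
    have e: "{x, u} \<in> E" using that by (auto simp: children_def split: if_splits)
    then have u: "u \<notin> set (x # ys)" using False edge_vertices[of x u] by auto
    then have "?t u \<le> B * (\<Sum>j\<le>k. saw_count n E j u (x # ys))"
      using Suc.prems(2) by (intro Suc.IH) auto
    then show ?thesis using e u by simp
  qed
  have "snd (eval_subtree n E J h ord bc \<sigma> (Suc k) x ys) \<le> 3 * length ys + 17 + (1 + 17 * n + (\<Sum>u\<in>children x ys. ?t u))"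
    using snd_eval_vertex[of J h ord bc \<sigma> False x ys "\<lambda>u. eval_subtree n E J h ord bc \<sigma> k u (x # ys)"] Suc.prems(1)
    by simp
  also have "(\<Sum>u\<in>children x ys. ?t u) \<le> (\<Sum>u\<in>children x ys. (3 * L + 19) + ?b u)"
    using t by (intro sum_mono) blast
  also have "\<dots> \<le> (\<Sum>u<n. (3 * L + 19) + ?b u)"
    using children_subset by (intro sum_mono2) auto
  also have "\<dots> = n * (3 * L + 19) + (\<Sum>u<n. ?b u)"
    by (simp add: sum.distrib)
  also have "(\<Sum>u<n. ?b u) = B * (\<Sum>j\<le>k. saw_count n E (Suc j) x ys)"
  proof -
    have "(\<Sum>u<n. ?b u) = (\<Sum>u<n. \<Sum>j\<le>k. B * (if {x, u} \<in> E \<and> u \<notin> set (x # ys) then saw_count n E j u (x # ys) else 0))"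
      by (intro sum.cong) (auto simp: sum_distrib_left)
    also have "\<dots> = (\<Sum>j\<le>k. \<Sum>u<n. B * (if {x, u} \<in> E \<and> u \<notin> set (x # ys) then saw_count n E j u (x # ys) else 0))"
      by (rule sum.swap)
    finally show ?thesis by (simp add: sum_distrib_left)
  qed
  finally have "snd (eval_subtree n E J h ord bc \<sigma> (Suc k) x ys) \<le>
      (3 * length ys + 18 + 17 * n + n * (3 * L + 19)) + B * (\<Sum>j\<le>k. saw_count n E (Suc j) x ys)"
    by simp
  also have "3 * length ys + 18 + 17 * n + n * (3 * L + 19) \<le> B"
    using Suc.prems(2) by (simp add: B_def algebra_simps)
  also have "B + B * (\<Sum>j\<le>k. saw_count n E (Suc j) x ys) = B * (\<Sum>j\<le>Suc k. saw_count n E j x ys)"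
    by (subst sum.atMost_Suc_shift) (simp add: algebra_simps)
  finally show ?case by simp
qed

text \<open>The 7 steps per vertex are 3 in \<open>compute_prob\<close> and 4 in
  \<open>run_sampler\<close>.\<close>

lemma run_sampler_time:
  fixes L :: nat
  defines "B \<equiv> 3 * L + 19 + n * (3 * L + 39)"
  assumes "(\<sigma>', t) \<in> set_pmf (run_sampler n E J h ord bc L vs \<sigma>)"
  shows "t \<le> (\<Sum>v\<leftarrow>vs. B * (\<Sum>j\<le>L. saw_count n E j v []) + 7) + 1"
  using assms(2)
proof (induction vs arbitrary: \<sigma> \<sigma>' t)
  case Nil
  then show ?case by simp
next
  case (Cons v vs)
  let ?c = "compute_prob n E J h ord bc L \<sigma> v"
  from Cons.prems obtain s t' where t: "t = snd ?c + t' + 4"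
    "(\<sigma>', t') \<in> set_pmf (run_sampler n E J h ord bc L vs (\<sigma>(v \<mapsto> s)))"
    by (auto simp: split_beta Let_def)
  have "snd ?c \<le> B * (\<Sum>j\<le>L. saw_count n E j v []) + 3"
    using snd_eval_subtree[of v "[]" L L J h ord bc \<sigma>] by (simp add: compute_prob_def split_beta Let_def B_def)
  then show ?case using Cons.IH[OF t(2)] t(1) by simp
qed

end

section \<open>Weitz's recursion\<close>

text \<open>With \<open>M\<close> listed in increasing order, each factor compares the set of
  elements before \<open>u\<close> with the set that includes \<open>u\<close>, and consecutive
  factors cancel. The induction removes the greatest element, whose predecessors are the rest of
  \<open>M\<close>.\<close>

lemma prod_telescope_order:
  fixes G :: "'a set \<Rightarrow> real"
  assumes "finite M"
    and trans: "\<And>a b c. a \<in> M \<Longrightarrow> b \<in> M \<Longrightarrow> c \<in> M \<Longrightarrow> P a b \<Longrightarrow> P b c \<Longrightarrow> P a c"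
    and irrefl: "\<And>a. \<not> P a a"
    and total: "\<And>a b. a \<in> M \<Longrightarrow> b \<in> M \<Longrightarrow> a \<noteq> b \<Longrightarrow> P a b \<or> P b a"
    and pos: "\<And>S. G S > 0"
  shows "(\<Prod>u\<in>M. G {w\<in>M. P w u} / G (insert u {w\<in>M. P w u})) = G {} / G M"
  using assms(1,2,4)
proof (induction "card M" arbitrary: M)
  case 0
  then show ?case using pos[of "{}"] by simp
next
  case (Suc m)
  have "\<exists>a\<in>M. \<forall>b\<in>M. b \<noteq> a \<longrightarrow> \<not> P a b"
  proof (rule Finite_Set.bex_max_element[OF Suc.prems(1)])
    show "transp_on M P" using Suc.prems(2) by (intro transp_onI)
    show "asymp_on M P"
    proof (rule asymp_onI)
      show "\<not> P y x" if "x \<in> M" "y \<in> M" "P x y" for x y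
        using Suc.prems(2)[of x y x] that irrefl[of x] by blast
    qed
    show "M \<noteq> {}" using Suc.hyps(2) by auto
  qed
  then obtain a where a: "a \<in> M" "\<And>b. b \<in> M \<Longrightarrow> \<not> P a b" using irrefl by metis
  define M' where "M' = M - {a}"
  have below_a: "{w\<in>M. P w a} = M'"
    using a Suc.prems(3) irrefl by (auto simp: M'_def)
  have below: "{w\<in>M. P w u} = {w\<in>M'. P w u}" if "u \<in> M'" for u
    using a that by (auto simp: M'_def)
  have IH: "(\<Prod>u\<in>M'. G {w\<in>M'. P w u} / G (insert u {w\<in>M'. P w u})) = G {} / G M'"
  proof (rule Suc.hyps(1))
    show "m = card M'" using Suc.hyps(2) a(1) Suc.prems(1) by (simp add: M'_def)
    show "finite M'" using Suc.prems(1) by (simp add: M'_def)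
    show "P x z" if "x \<in> M'" "y \<in> M'" "z \<in> M'" "P x y" "P y z" for x y z
      using that Suc.prems(2)[of x y z] by (simp add: M'_def)
    show "P x y \<or> P y x" if "x \<in> M'" "y \<in> M'" "x \<noteq> y" for x y
      using that Suc.prems(3)[of x y] by (simp add: M'_def)
  qed
  have "(\<Prod>u\<in>M. G {w\<in>M. P w u} / G (insert u {w\<in>M. P w u})) =
      G M' / G (insert a M') * (\<Prod>u\<in>M'. G {w\<in>M'. P w u} / G (insert u {w\<in>M'. P w u}))"
    using prod.remove[OF Suc.prems(1) a(1), of "\<lambda>u. G {w\<in>M. P w u} / G (insert u {w\<in>M. P w u})"]
    unfolding below_a M'_def[symmetric] using below by simp
  also have "\<dots> = G {} / G M"
    unfolding IH using pos[of M'] insert_Diff[OF a(1)] by (simp add: M'_def)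
  finally show ?case .
qed

lemma act_add: "act \<sigma> (\<lambda>u. g u + t u) v s = act \<sigma> g v s * exp (t v * sg s)"
  by (simp add: act_def exp_add algebra_simps)

section \<open>The Ising model on part of the graph\<close>

context graph
begin

text \<open>The external fields are a separate argument because removing a vertex of known spin
  amounts to changing the fields at its neighbours.\<close>

definition graph_weight :: "(nat set \<Rightarrow> real) \<Rightarrow> (nat \<rightharpoonup> bool) \<Rightarrow> nat set \<Rightarrow> (nat \<Rightarrow> real) \<Rightarrow> (nat \<rightharpoonup> bool) \<Rightarrow> real" where
  "graph_weight J \<sigma> U g = gibbs U {e \<in> E. e \<subseteq> U} J (act \<sigma> g)"

definition graph_total :: "(nat set \<Rightarrow> real) \<Rightarrow> (nat \<rightharpoonup> bool) \<Rightarrow> nat set \<Rightarrow> (nat \<Rightarrow> real) \<Rightarrow> real" where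
  "graph_total J \<sigma> U g = (\<Sum>\<eta>\<in>configs U. graph_weight J \<sigma> U g \<eta>)"

definition graph_pf :: "(nat set \<Rightarrow> real) \<Rightarrow> (nat \<rightharpoonup> bool) \<Rightarrow> nat set \<Rightarrow> (nat \<Rightarrow> real) \<Rightarrow> nat \<Rightarrow> bool \<Rightarrow> real" where
  "graph_pf J \<sigma> U g x s = (\<Sum>\<eta>\<in>configs U. if \<eta> x = Some s then graph_weight J \<sigma> U g \<eta> else 0)"

lemma graph_weight_cong:
  "(\<And>u. u \<in> U \<Longrightarrow> g u = g' u) \<Longrightarrow> graph_weight J \<sigma> U g \<eta> = graph_weight J \<sigma> U g' \<eta>"
  unfolding graph_weight_def gibbs_def by (intro arg_cong2[of _ _ _ _ "(*)"] prod.cong refl) (simp add: act_def)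

lemma graph_total_cong:
  "(\<And>u. u \<in> U \<Longrightarrow> g u = g' u) \<Longrightarrow> graph_total J \<sigma> U g = graph_total J \<sigma> U g'"
  unfolding graph_total_def by (intro sum.cong refl graph_weight_cong)

lemma graph_weight_nonneg: "0 \<le> graph_weight J \<sigma> U g \<eta>"
  unfolding graph_weight_def by (intro gibbs_nonneg act_nonneg)

lemma graph_total_pos:
  assumes "finite U"
  shows "graph_total J \<sigma> U g > 0"
proof -
  \<comment> \<open>A configuration that respects the conditioning, with spin + wherever \<sigma> is
    silent.\<close>
  define \<eta> where "\<eta> v = (if v \<in> U then Some (\<sigma> v \<noteq> Some False) else None)" for v
  have "\<eta> \<in> configs U" by (auto simp: configs_def \<eta>_def split: if_splits)
  moreover have "act \<sigma> g v (\<eta> v = Some True) > 0" if "v \<in> U" for v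
    using that by (cases "\<sigma> v") (auto simp: act_def \<eta>_def)
  then have "graph_weight J \<sigma> U g \<eta> > 0"
    unfolding graph_weight_def gibbs_def by (intro mult_pos_pos prod_pos) auto
  ultimately show ?thesis
    unfolding graph_total_def using assms graph_weight_nonneg
    by (intro sum_pos2[of _ \<eta>]) (auto simp: finite_configs)
qed

lemma graph_total_split:
  assumes "x \<in> U"
  shows "graph_total J \<sigma> U g = graph_pf J \<sigma> U g x True + graph_pf J \<sigma> U g x False"
  unfolding graph_total_def graph_pf_def sum.distrib[symmetric]
proof (rule sum.cong[OF refl])
  fix \<eta> :: "nat \<rightharpoonup> bool" assume "\<eta> \<in> configs U"
  then obtain s where "\<eta> x = Some s" using configs_value[OF _ assms] by blast
  then show "graph_weight J \<sigma> U g \<eta> = (if \<eta> x = Some True then graph_weight J \<sigma> U g \<eta> else 0) +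
      (if \<eta> x = Some False then graph_weight J \<sigma> U g \<eta> else 0)"
    by (cases s) simp_all
qed

text \<open>An extra field at the vertex whose spin is fixed is a constant factor. In the recursion
  this field is the interaction with one copy of the removed vertex.\<close>

lemma graph_pf_shift:
  assumes "finite U" "x \<in> U"
  shows "graph_pf J \<sigma> U (g(x := g x + a)) x s = exp (a * sg s) * graph_pf J \<sigma> U g x s"
proof -
  have "graph_weight J \<sigma> U (g(x := g x + a)) \<eta> = exp (a * sg s) * graph_weight J \<sigma> U g \<eta>"
    if "\<eta> x = Some s" for \<eta>
  proof -
    have "(\<Prod>v\<in>U. act \<sigma> (g(x := g x + a)) v (\<eta> v = Some True)) =
        (\<Prod>v\<in>U. act \<sigma> g v (\<eta> v = Some True) * (if v = x then exp (a * sg s) else 1))"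
    proof (rule prod.cong[OF refl])
      fix v
      show "act \<sigma> (g(x := g x + a)) v (\<eta> v = Some True) =
          act \<sigma> g v (\<eta> v = Some True) * (if v = x then exp (a * sg s) else 1)"
        using that by (cases "v = x") (simp_all add: act_def exp_add distrib_right)
    qed
    also have "\<dots> = (\<Prod>v\<in>U. act \<sigma> g v (\<eta> v = Some True)) * exp (a * sg s)"
      using assms by (simp add: prod.distrib)
    finally show ?thesis by (simp add: graph_weight_def gibbs_def)
  qed
  then show ?thesis
    unfolding graph_pf_def sum_distrib_left by (intro sum.cong) auto
qed

text \<open>An interaction with a vertex of fixed spin is an external field. The edges within
  \<open>U\<close> are those that avoid \<open>x\<close> and the star of \<open>x\<close>; the star
  becomes the shift of \<open>g\<close>.\<close>

lemma graph_pf_peel: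
  assumes "finite U" "x \<in> U"
  shows "graph_pf J \<sigma> U g x s = act \<sigma> g x s *
    graph_total J \<sigma> (U - {x}) (\<lambda>u. g u + (if {x, u} \<in> E then J {x, u} * sg s else 0))"
proof -
  define U' where "U' = U - {x}"
  let ?t = "\<lambda>u. if {x, u} \<in> E then J {x, u} * sg s else 0"
  have x: "x \<notin> U'" and U: "U = insert x U'" and fin: "finite U'"
    using assms by (auto simp: U'_def)
  define N where "N = {u \<in> U'. {x, u} \<in> E}"
  have finN: "finite N" using fin by (simp add: N_def)
  have edges_U: "{e \<in> E. e \<subseteq> U} = {e \<in> E. e \<subseteq> U'} \<union> (\<lambda>u. {x, u}) ` N"
  proof (intro equalityI subsetI)
    fix e assume e: "e \<in> {e \<in> E. e \<subseteq> U}"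
    then have "e \<in> nsets {..<n} 2" using edges by blast
    then obtain a b where ab: "e = {a, b}" "a \<noteq> b" by (rule nsets2_E)
    show "e \<in> {e \<in> E. e \<subseteq> U'} \<union> (\<lambda>u. {x, u}) ` N"
    proof (cases "x \<in> e")
      case True
      then obtain u where "e = {x, u}" "u \<noteq> x" using ab by auto
      then show ?thesis using e by (auto simp: N_def U)
    next
      case False
      then show ?thesis using e by (auto simp: U)
    qed
  qed (auto simp: N_def U)
  have disj: "{e \<in> E. e \<subseteq> U'} \<inter> (\<lambda>u. {x, u}) ` N = {}" using x by auto
  have inj: "inj_on (\<lambda>u. {x, u}) N" by (auto simp: inj_on_def doubleton_eq_iff)
  have finE: "finite {e \<in> E. e \<subseteq> U'}" using finite_edges by simp
  have weight: "graph_weight J \<sigma> U g (\<eta>(x \<mapsto> s)) = act \<sigma> g x s * graph_weight J \<sigma> U' (\<lambda>u. g u + ?t u) \<eta>" for \<eta>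
  proof -
    let ?\<eta> = "\<eta>(x \<mapsto> s)"
    have spin_x: "spin ?\<eta> x = sg s" by (simp add: spin_def sg_def)
    have spin_u: "spin ?\<eta> u = spin \<eta> u" if "u \<noteq> x" for u using that by (simp add: spin_def)
    have "(\<Prod>e\<in>{e \<in> E. e \<subseteq> U}. exp (J e * (\<Prod>v\<in>e. spin ?\<eta> v))) =
        (\<Prod>e\<in>{e \<in> E. e \<subseteq> U'}. exp (J e * (\<Prod>v\<in>e. spin ?\<eta> v))) *
        (\<Prod>u\<in>N. exp (J {x, u} * (\<Prod>v\<in>{x, u}. spin ?\<eta> v)))"
      unfolding edges_U using finN finE disj by (simp add: prod.union_disjoint prod.reindex[OF inj])
    also have "(\<Prod>e\<in>{e \<in> E. e \<subseteq> U'}. exp (J e * (\<Prod>v\<in>e. spin ?\<eta> v))) =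
        (\<Prod>e\<in>{e \<in> E. e \<subseteq> U'}. exp (J e * (\<Prod>v\<in>e. spin \<eta> v)))"
    proof (rule prod.cong[OF refl])
      fix e assume "e \<in> {e \<in> E. e \<subseteq> U'}"
      then have "(\<Prod>v\<in>e. spin ?\<eta> v) = (\<Prod>v\<in>e. spin \<eta> v)" using x by (intro prod.cong spin_u) auto
      then show "exp (J e * (\<Prod>v\<in>e. spin ?\<eta> v)) = exp (J e * (\<Prod>v\<in>e. spin \<eta> v))" by simp
    qed
    also have "(\<Prod>u\<in>N. exp (J {x, u} * (\<Prod>v\<in>{x, u}. spin ?\<eta> v))) = (\<Prod>u\<in>N. exp (?t u * spin \<eta> u))"
    proof (rule prod.cong[OF refl])
      fix u assume u: "u \<in> N"
      then have "u \<noteq> x" using x by (auto simp: N_def)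
      then show "exp (J {x, u} * (\<Prod>v\<in>{x, u}. spin ?\<eta> v)) = exp (?t u * spin \<eta> u)"
        using u by (simp add: spin_x spin_u N_def)
    qed
    also have "\<dots> = (\<Prod>u\<in>U'. exp (?t u * spin \<eta> u))"
      using fin by (intro prod.mono_neutral_left) (auto simp: N_def)
    finally have edges: "(\<Prod>e\<in>{e \<in> E. e \<subseteq> U}. exp (J e * (\<Prod>v\<in>e. spin ?\<eta> v))) =
        (\<Prod>e\<in>{e \<in> E. e \<subseteq> U'}. exp (J e * (\<Prod>v\<in>e. spin \<eta> v))) * (\<Prod>u\<in>U'. exp (?t u * spin \<eta> u))" .
    have "(\<Prod>v\<in>U'. act \<sigma> g v (?\<eta> v = Some True)) = (\<Prod>v\<in>U'. act \<sigma> g v (\<eta> v = Some True))"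
      using x by (intro prod.cong) auto
    then have "(\<Prod>v\<in>U. act \<sigma> g v (?\<eta> v = Some True)) = act \<sigma> g x s * (\<Prod>v\<in>U'. act \<sigma> g v (\<eta> v = Some True))"
      unfolding U using x fin by simp
    moreover have "(\<Prod>v\<in>U'. act \<sigma> (\<lambda>u. g u + ?t u) v (\<eta> v = Some True)) =
        (\<Prod>v\<in>U'. act \<sigma> g v (\<eta> v = Some True)) * (\<Prod>u\<in>U'. exp (?t u * spin \<eta> u))"
      unfolding act_add prod.distrib spin_eq_sg ..
    ultimately show ?thesis
      unfolding graph_weight_def gibbs_def edges by (simp only: mult_ac)
  qed
  have "graph_pf J \<sigma> U g x s = (\<Sum>\<eta>\<in>configs U'. graph_weight J \<sigma> U g (\<eta>(x \<mapsto> s)))"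
    unfolding graph_pf_def U sum_configs_insert[OF x] by (cases s) simp_all
  then show ?thesis
    unfolding weight graph_total_def U'_def[symmetric] by (simp add: sum_distrib_left)
qed

lemma graph_pf_pos:
  assumes "finite U" "x \<in> U" "\<sigma> x \<noteq> Some (\<not> s)"
  shows "graph_pf J \<sigma> U g x s > 0"
  unfolding graph_pf_peel[OF assms(1,2)] using assms
  by (intro mult_pos_pos graph_total_pos) (auto simp: act_def)

lemma graph_pf_eq_0:
  assumes "finite U" "x \<in> U" "\<sigma> x = Some (\<not> s)"
  shows "graph_pf J \<sigma> U g x s = 0"
  unfolding graph_pf_peel[OF assms(1,2)] using assms(3) by (simp add: act_def)

section \<open>Orders of the neighbours and the fields of a walk\<close>

definition valid_order :: "(nat \<Rightarrow> nat rel) \<Rightarrow> bool" where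
  "valid_order ord \<longleftrightarrow> (\<forall>u<n. linear_order_on {w. {u, w} \<in> E} (ord u))"

lemma precedes_trans:
  assumes "valid_order ord" "x < n" "precedes ord x a b" "precedes ord x b c"
  shows "precedes ord x a c"
proof -
  have "trans (ord x)" "antisym (ord x)"
    using assms(1,2) by (auto simp: valid_order_def linear_order_on_def partial_order_on_def preorder_on_def)
  then show ?thesis
    using assms(3,4) unfolding precedes_def by (meson antisymD transD)
qed

lemma precedes_antisym:
  assumes "valid_order ord" "x < n" "precedes ord x a b"
  shows "\<not> precedes ord x b a"
  using precedes_trans[OF assms(1,2,3), of a] by (auto simp: precedes_def)

lemma precedes_total:
  assumes "valid_order ord" "{x, a} \<in> E" "{x, b} \<in> E" "a \<noteq> b"
  shows "precedes ord x a b \<or> precedes ord x b a"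
proof -
  have "total_on {w. {x, w} \<in> E} (ord x)"
    using assms(1) edge_vertices[OF assms(2)] by (auto simp: valid_order_def linear_order_on_def)
  then show ?thesis
    using assms(2-4) by (auto simp: total_on_def precedes_def)
qed

text \<open>
  The orientation with which a walk turning at \<open>y\<close> towards \<open>z\<close> fixes \<open>y\<close> when seen from another
  neighbour \<open>u\<close> of \<open>y\<close>; the edge to \<open>z\<close> itself is left to the recursion.
\<close>

definition turn_sign :: "(nat \<Rightarrow> nat rel) \<Rightarrow> nat \<Rightarrow> nat \<Rightarrow> nat \<Rightarrow> real" where
  "turn_sign ord y z u = (if precedes ord y z u then 1 else if precedes ord y u z then - 1 else 0)"

text \<open>\<open>z\<close> is the vertex visited directly after \<open>y\<close>, so the recursion
  down the reversed walk reads off the turn taken at each vertex. The sign agrees with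
  \<open>saw_tau\<close>: a leaf reached from \<open>u\<close> that closes a cycle at
  \<open>y\<close> has spin + exactly if \<open>z\<close> precedes \<open>u\<close>.\<close>

primrec walk_field :: "(nat set \<Rightarrow> real) \<Rightarrow> (nat \<Rightarrow> nat rel) \<Rightarrow> nat \<Rightarrow> nat \<Rightarrow> nat list \<Rightarrow> real" where
  "walk_field J ord u z [] = 0"
| "walk_field J ord u z (y # ys) =
     (if {y, u} \<in> E then J {y, u} * turn_sign ord y z u else 0) + walk_field J ord u y ys"

text \<open>
  The model on the vertices that the walk has not left yet; the copies of the vertices that it has
  left, fixed by the turn signs, act on their neighbours as external fields.
\<close>

definition walk_pf ::
  "(nat set \<Rightarrow> real) \<Rightarrow> (nat \<Rightarrow> real) \<Rightarrow> (nat \<Rightarrow> nat rel) \<Rightarrow> (nat \<rightharpoonup> bool) \<Rightarrow> nat \<Rightarrow> nat list \<Rightarrow> bool \<Rightarrow> real" where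
  "walk_pf J h ord \<sigma> x ys s =
     graph_pf J \<sigma> ({..<n} - set ys) (\<lambda>u. h u + walk_field J ord u x ys) x s"

lemma walk_pf_pos:
  assumes "x < n" "x \<notin> set ys" "\<sigma> x \<noteq> Some (\<not> s)"
  shows "walk_pf J h ord \<sigma> x ys s > 0"
  unfolding walk_pf_def using assms by (intro graph_pf_pos) auto

lemma walk_pf_eq_0:
  assumes "x < n" "x \<notin> set ys" "\<sigma> x = Some (\<not> s)"
  shows "walk_pf J h ord \<sigma> x ys s = 0"
  unfolding walk_pf_def using assms by (intro graph_pf_eq_0) auto

text \<open>
  Weitz's recursion: the spin of \<open>x\<close> is flipped edge by edge, in the order of the neighbours,
  by giving every edge at \<open>x\<close> its own copy of \<open>x\<close>.
\<close>

lemma walk_pf_recursion: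
  fixes J h ord \<sigma> x ys
  assumes "valid_order ord" "x < n" "x \<notin> set ys" "\<sigma> x = None"
  defines "p \<equiv> walk_pf J h ord \<sigma>"
  shows "p x ys True / p x ys False = exp (2 * (h x + walk_field J ord x x ys)) *
    (\<Prod>u\<in>{u. {x, u} \<in> E \<and> u \<notin> set (x # ys)}.
       (exp (J {x, u}) * p u (x # ys) True + exp (- J {x, u}) * p u (x # ys) False) /
       (exp (- J {x, u}) * p u (x # ys) True + exp (J {x, u}) * p u (x # ys) False))"
proof -
  define U where "U = {..<n} - set ys"
  define U' where "U' = {..<n} - set (x # ys)"
  define g where "g u = h u + walk_field J ord u x ys" for u
  define N where "N = {u. {x, u} \<in> E \<and> u \<notin> set (x # ys)}"
  \<comment> \<open>Every edge at \<open>x\<close> has its own copy of \<open>x\<close>; in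
    \<open>G M\<close> the copies on the edges to \<open>M\<close> have spin - and the others spin
    +.\<close>
  define G where "G M = graph_total J \<sigma> U' (\<lambda>u. g u + (if {x, u} \<in> E then J {x, u} * (if u \<in> M then - 1 else 1) else 0))" for M
  have U: "finite U" "x \<in> U" "U - {x} = U'" using assms(2,3) by (auto simp: U_def U'_def)
  have finU': "finite U'" by (simp add: U'_def)
  have N: "N = {u \<in> U'. {x, u} \<in> E}" using edge_vertices by (auto simp: N_def U'_def)
  have finN: "finite N" using finU' by (simp add: N)
  have pos: "G M > 0" for M unfolding G_def by (rule graph_total_pos[OF finU'])
  \<comment> \<open>Only the copy of \<open>x\<close> at \<open>u\<close> is flipped; copies at
    smaller neighbours are already -, those at larger ones still +. This is the pattern of turn
    signs of the walk that continues to \<open>u\<close>, so both totals are combinations of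
    \<open>walk_pf\<close> at \<open>u\<close>.\<close>
  have split: "(exp (J {x, u}) * p u (x # ys) True + exp (- J {x, u}) * p u (x # ys) False) /
       (exp (- J {x, u}) * p u (x # ys) True + exp (J {x, u}) * p u (x # ys) False) =
       G {w\<in>N. precedes ord x w u} / G (insert u {w\<in>N. precedes ord x w u})" if u: "u \<in> N" for u
  proof -
    have uU: "u \<in> U'" and ux: "{x, u} \<in> E" using u by (auto simp: N)
    define gu where "gu w = h w + walk_field J ord w u (x # ys)" for w
    have gu: "gu w = g w + (if {x, w} \<in> E then J {x, w} * turn_sign ord x u w else 0)" for w
      by (simp add: gu_def g_def)
    have sign_u: "turn_sign ord x u u = 0" by (simp add: turn_sign_def precedes_def)
    have sign: "turn_sign ord x u w = (if w \<in> {w\<in>N. precedes ord x w u} then - 1 else 1)"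
      if "w \<in> U'" "{x, w} \<in> E" "w \<noteq> u" for w
      using that precedes_total[OF assms(1) ux that(2)] precedes_antisym[OF assms(1,2)]
      by (auto simp: turn_sign_def N)
    have total: "graph_total J \<sigma> U' (gu(u := gu u + a)) =
        exp a * p u (x # ys) True + exp (- a) * p u (x # ys) False" for a
      using graph_total_split[OF uU, of J \<sigma> "gu(u := gu u + a)"] graph_pf_shift[OF finU' uU, of J \<sigma> gu a]
      by (simp add: p_def walk_pf_def U'_def gu_def[abs_def])
    have "G {w\<in>N. precedes ord x w u} = graph_total J \<sigma> U' (gu(u := gu u + J {x, u}))"
      unfolding G_def using sign sign_u ux
      by (intro graph_total_cong) (auto simp: gu precedes_def)
    moreover have "G (insert u {w\<in>N. precedes ord x w u}) = graph_total J \<sigma> U' (gu(u := gu u + (- J {x, u})))"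
      unfolding G_def using sign sign_u ux
      by (intro graph_total_cong) (auto simp: gu precedes_def)
    ultimately show ?thesis unfolding total by simp
  qed
  \<comment> \<open>The product leads from all copies + to all copies -, that is, from one spin of
    \<open>x\<close> itself to the other.\<close>
  have "(\<Prod>u\<in>N. G {w\<in>N. precedes ord x w u} / G (insert u {w\<in>N. precedes ord x w u})) = G {} / G N"
  proof (rule prod_telescope_order[OF finN])
    show "precedes ord x a c" if "precedes ord x a b" "precedes ord x b c" for a b c
      using precedes_trans[OF assms(1,2) that] .
    show "\<not> precedes ord x a a" for a by (simp add: precedes_def)
    show "precedes ord x a b \<or> precedes ord x b a" if "a \<in> N" "b \<in> N" "a \<noteq> b" for a b
      using precedes_total[OF assms(1)] that by (simp add: N)
  qed (rule pos)
  then have "(\<Prod>u\<in>N. (exp (J {x, u}) * p u (x # ys) True + exp (- J {x, u}) * p u (x # ys) False) /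
       (exp (- J {x, u}) * p u (x # ys) True + exp (J {x, u}) * p u (x # ys) False)) = G {} / G N"
    using split by simp
  moreover have "p x ys True = exp (g x) * G {}"
  proof -
    have "graph_total J \<sigma> U' (\<lambda>u. g u + (if {x, u} \<in> E then J {x, u} * sg True else 0)) = G {}"
      unfolding G_def by (intro graph_total_cong) simp
    then show ?thesis
      using graph_pf_peel[OF U(1,2), of J \<sigma> g True] assms(4)
      by (simp add: p_def walk_pf_def U(3) act_def U_def[symmetric] g_def[abs_def])
  qed
  moreover have "p x ys False = exp (- g x) * G N"
  proof -
    have "graph_total J \<sigma> U' (\<lambda>u. g u + (if {x, u} \<in> E then J {x, u} * sg False else 0)) = G N"
      unfolding G_def by (intro graph_total_cong) (auto simp: N)
    then show ?thesis
      using graph_pf_peel[OF U(1,2), of J \<sigma> g False] assms(4)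
      by (simp add: p_def walk_pf_def U(3) act_def U_def[symmetric] g_def[abs_def])
  qed
  moreover have "exp (g x) / exp (- g x) = exp (2 * g x)"
    by (simp add: exp_diff[symmetric])
  ultimately show ?thesis
    unfolding N_def[symmetric] g_def[symmetric] by (metis times_divide_times_eq)
qed

end

section \<open>Contraction along the edges\<close>

text \<open>The message through an edge of interaction \<open>J\<close> from a vertex with weights
  \<open>a\<close> for + and \<open>b\<close> for -. For positive weights it is 2 artanh (tanh J
  tanh (ln (a/b) / 2)); weights as arguments also admit a vertex of fixed spin.\<close>

definition edge_ratio :: "real \<Rightarrow> real \<Rightarrow> real \<Rightarrow> real" where
  "edge_ratio J a b = ln ((exp J * a + exp (- J) * b) / (exp (- J) * a + exp J * b))"

lemma exp_combination_pos:
  fixes a b s t :: real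
  assumes "a \<ge> 0" "b \<ge> 0" "a + b > 0"
  shows "exp s * a + exp t * b > 0"
proof (cases "a = 0")
  case True
  then show ?thesis using assms by simp
next
  case False
  then show ?thesis using assms by (intro add_pos_nonneg) auto
qed

lemma ln_exp_mult_prod:
  fixes f :: "'a \<Rightarrow> real"
  assumes "finite A" "\<And>a. a \<in> A \<Longrightarrow> f a > 0"
  shows "ln (exp c * (\<Prod>a\<in>A. f a)) = c + (\<Sum>a\<in>A. ln (f a))"
proof -
  have "(\<Prod>a\<in>A. f a) > 0" using assms(2) by (rule prod_pos)
  then have "ln (exp c * (\<Prod>a\<in>A. f a)) = c + ln (\<Prod>a\<in>A. f a)" by (simp add: ln_mult_pos)
  moreover have "ln (\<Prod>a\<in>A. f a) = (\<Sum>a\<in>A. ln (f a))"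
    by (rule ln_prod) (use assms in \<open>auto dest: assms(2)\<close>)
  ultimately show ?thesis by simp
qed

text \<open>The extreme messages are those of a vertex with fixed spin, and all others lie between
  them.\<close>

lemma abs_edge_ratio_le:
  assumes "J \<ge> 0" "a \<ge> 0" "b \<ge> 0" "a + b > 0"
  shows "\<bar>edge_ratio J a b\<bar> \<le> 2 * J"
proof -
  have pos: "exp J' * a + exp (- J') * b > 0" for J'
    using assms(2-4) by (rule exp_combination_pos)
  have "exp (- J) \<le> exp (3 * J)" "exp (- (3 * J)) \<le> exp J" using assms by simp_all
  then have "exp (- J) * b \<le> exp (3 * J) * b" "exp (- (3 * J)) * a \<le> exp J * a"
    using assms by (auto intro: mult_right_mono)
  moreover have "exp (2 * J) * (exp (- J) * a + exp J * b) = exp J * a + exp (3 * J) * b"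
    "exp (- (2 * J)) * (exp (- J) * a + exp J * b) = exp (- (3 * J)) * a + exp (- J) * b"
    by (simp_all add: distrib_left mult.assoc[symmetric] exp_add[symmetric])
  ultimately have "exp J * a + exp (- J) * b \<le> exp (2 * J) * (exp (- J) * a + exp J * b)"
    "exp (- (2 * J)) * (exp (- J) * a + exp J * b) \<le> exp J * a + exp (- J) * b"
    by linarith+
  then have "(exp J * a + exp (- J) * b) / (exp (- J) * a + exp J * b) \<le> exp (2 * J)"
    "exp (- (2 * J)) \<le> (exp J * a + exp (- J) * b) / (exp (- J) * a + exp J * b)"
    using pos[of "- J"] by (simp_all add: field_simps)
  moreover have "(exp J * a + exp (- J) * b) / (exp (- J) * a + exp J * b) > 0"
    using pos[of J] pos[of "- J"] by simp
  ultimately have "edge_ratio J a b \<le> ln (exp (2 * J))" "ln (exp (- (2 * J))) \<le> edge_ratio J a b"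
    unfolding edge_ratio_def by (simp_all only: ln_le_cancel_iff exp_gt_zero)
  then show ?thesis by simp
qed

lemma edge_ratio_extreme:
  "a > 0 \<Longrightarrow> edge_ratio J a 0 = 2 * J" "b > 0 \<Longrightarrow> edge_ratio J 0 b = - 2 * J"
  by (simp_all add: edge_ratio_def exp_diff[symmetric])

lemma edge_ratio_eq:
  assumes "a > 0" "b > 0"
  shows "edge_ratio J a b = ln (exp (J + ln (a / b)) + exp (- J)) - ln (exp (- J + ln (a / b)) + exp J)"
proof -
  have eq: "exp (J' + ln (a / b)) + exp (- J') = (exp J' * a + exp (- J') * b) / b" for J'
    using assms by (simp add: exp_add field_simps)
  have eq': "exp (- J + ln (a / b)) + exp J = (exp (- J) * a + exp J * b) / b"
    using eq[of "- J"] by simp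
  have "exp J * a + exp (- J) * b > 0" "exp (- J) * a + exp J * b > 0"
    using assms by (simp_all add: add_pos_pos)
  then show ?thesis
    using assms unfolding edge_ratio_def eq eq' by (simp add: ln_div)
qed

text \<open>The expression is the derivative of the message with respect to the log-odds
  \<open>x\<close>. It is largest for an unbiased vertex, \<open>x = 0\<close>, where it equals
  \<open>tanh J\<close>.\<close>

lemma tanh_derivative_bound:
  fixes J x :: real
  assumes "J \<ge> 0"
  shows "\<bar>exp (J + x) / (exp (J + x) + exp (- J)) - exp (- J + x) / (exp (- J + x) + exp J)\<bar> \<le> tanh J"
proof -
  define E where "E = exp x"
  define t where "t = exp J"
  have E: "E > 0" and t: "t \<ge> 1" using assms by (simp_all add: E_def t_def)
  define s where "s = t * t"
  have s: "s \<ge> 1" using mult_mono[OF t t] t by (simp add: s_def)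
  have pos: "s * E + 1 > 0" "E + s > 0" using s E by (auto intro!: add_pos_pos)
  have "exp (J + x) / (exp (J + x) + exp (- J)) - exp (- J + x) / (exp (- J + x) + exp J) =
      s * E / (s * E + 1) - E / (E + s)"
    using t E unfolding exp_add exp_minus E_def[symmetric] t_def[symmetric] s_def
    by (simp add: field_simps)
  also have "\<dots> = E * (s * s - 1) / ((s * E + 1) * (E + s))"
    using pos by (simp add: diff_frac_eq algebra_simps)
  finally have eq: "exp (J + x) / (exp (J + x) + exp (- J)) - exp (- J + x) / (exp (- J + x) + exp J) =
      E * (s * s - 1) / ((s * E + 1) * (E + s))" .
  have "s * s \<ge> 1" using mult_mono[OF s s] s by simp
  then have nonneg: "E * (s * s - 1) / ((s * E + 1) * (E + s)) \<ge> 0"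
    using pos E by (intro divide_nonneg_nonneg mult_nonneg_nonneg) auto
  have "E * (s * s - 1) / ((s * E + 1) * (E + s)) \<le> (s - 1) / (s + 1)"
  proof -
    \<comment> \<open>This is the difference of the two sides of the next inequality, with equality
      at \<open>E = 1\<close>.\<close>
    have "0 \<le> s * (E - 1)\<^sup>2" using s by simp
    then have "E * (s + 1)\<^sup>2 \<le> (s * E + 1) * (E + s)"
      by (simp add: power2_eq_square algebra_simps)
    then have "(s - 1) * (E * (s + 1)\<^sup>2) \<le> (s - 1) * ((s * E + 1) * (E + s))"
      using s by (intro mult_left_mono) auto
    then have "E * (s * s - 1) * (s + 1) \<le> (s - 1) * ((s * E + 1) * (E + s))"
      by (simp add: power2_eq_square algebra_simps)
    then have "E * (s * s - 1) \<le> (s - 1) * ((s * E + 1) * (E + s)) / (s + 1)"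
      using s by (subst pos_le_divide_eq) auto
    then show ?thesis
      using pos by (subst pos_divide_le_eq) auto
  qed
  also have "\<dots> = tanh J"
  proof -
    have "t - inverse t = (s - 1) / t" "t + inverse t = (s + 1) / t"
      using t by (simp_all add: s_def field_simps)
    then show ?thesis
      using t unfolding tanh_altdef exp_minus t_def[symmetric] by simp
  qed
  finally show ?thesis unfolding eq abs_of_nonneg[OF nonneg] .
qed

text \<open>Mean value inequality for the message as a function of the log-odds. External fields
  only translate the log-odds and so do not affect the rate.\<close>

lemma edge_ratio_contraction:
  assumes "J \<ge> 0" "a > 0" "b > 0" "a' > 0" "b' > 0"
  shows "\<bar>edge_ratio J a b - edge_ratio J a' b'\<bar> \<le> tanh J * \<bar>ln (a / b) - ln (a' / b')\<bar>"
proof -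
  define \<psi> where "\<psi> x = ln (exp (J + x) + exp (- J)) - ln (exp (- J + x) + exp J)" for x :: real
  have "(\<psi> has_field_derivative
      exp (J + x) / (exp (J + x) + exp (- J)) - exp (- J + x) / (exp (- J + x) + exp J)) (at x within UNIV)" for x
    unfolding \<psi>_def[abs_def] by (auto intro!: derivative_eq_intros simp: add_pos_pos)
  then have "norm (\<psi> (ln (a / b)) - \<psi> (ln (a' / b'))) \<le> tanh J * norm (ln (a / b) - ln (a' / b'))"
    using tanh_derivative_bound[OF assms(1)] by (intro field_differentiable_bound[of UNIV]) auto
  then show ?thesis
    using assms by (simp add: edge_ratio_eq \<psi>_def)
qed

text \<open>A probability is the logistic function of its log-odds, whose derivative is at most
  1.\<close>

lemma probability_le_log_odds:
  fixes a b a' b' :: real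
  assumes "a > 0" "b > 0" "a' > 0" "b' > 0"
  shows "\<bar>a / (a + b) - a' / (a' + b')\<bar> \<le> \<bar>ln (a / b) - ln (a' / b')\<bar>"
proof -
  define f where "f x = exp x / (1 + exp x)" for x :: real
  have nz: "1 + exp x \<noteq> 0" for x :: real
    by (metis add_pos_pos exp_gt_zero less_irrefl zero_less_one)
  have "(f has_field_derivative exp x / (1 + exp x)\<^sup>2) (at x within UNIV)" for x
    unfolding f_def[abs_def] using nz
    by (auto intro!: derivative_eq_intros simp: power2_eq_square field_simps)
  moreover have "norm (exp x / (1 + exp x)\<^sup>2) \<le> 1" for x :: real
  proof -
    have "exp x \<le> (1 + exp x)\<^sup>2"
      by (simp add: power2_eq_square algebra_simps)
    then show ?thesis using nz[of x] by (simp add: divide_le_eq)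
  qed
  ultimately have "norm (f (ln (a / b)) - f (ln (a' / b'))) \<le> 1 * norm (ln (a / b) - ln (a' / b'))"
    by (intro field_differentiable_bound[of UNIV]) auto
  moreover have "f (ln (c / d)) = c / (c + d)" if "c > 0" "d > 0" for c d
    using that by (simp add: f_def field_simps)
  ultimately show ?thesis using assms by simp
qed

section \<open>Comparison of the truncated tree with the graph\<close>

context graph
begin

text \<open>A weight vanishes only through the condition at the vertex itself: every child has a
  positive weight for at least one spin, which makes both combinations across its edge positive.
  What lies below a conditioned vertex only scales its one nonzero weight.\<close>

lemma eval_subtree_form:
  fixes J h ord bc \<sigma> k x ys
  defines "c \<equiv> local_condition ord bc \<sigma> (k = 0) x ys"
  obtains P where "P True > 0" "P False > 0" "fst (eval_subtree n E J h ord bc \<sigma> k x ys) =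
    (act (\<lambda>_. c) h x True * P True, act (\<lambda>_. c) h x False * P False)"
proof -
  have "\<exists>P. (\<forall>s. P s > 0) \<and> fst (eval_subtree n E J h ord bc \<sigma> k x ys) =
    (act (\<lambda>_. local_condition ord bc \<sigma> (k = 0) x ys) h x True * P True,
     act (\<lambda>_. local_condition ord bc \<sigma> (k = 0) x ys) h x False * P False)"
  proof (induction k arbitrary: x ys)
    case 0
    show ?case by (intro exI[of _ "\<lambda>_. 1"]) (simp add: fst_eval_vertex Let_def)
  next
    case (Suc k)
    let ?R = "\<lambda>u. fst (eval_subtree n E J h ord bc \<sigma> k u (x # ys))"
    define P where "P s = (\<Prod>u\<in>children x ys. exp (J {x, u} * sg s) * fst (?R u) +
             exp (- (J {x, u} * sg s)) * snd (?R u))" for s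
    have "P s > 0" for s
      unfolding P_def
    proof (rule prod_pos)
      fix u assume "u \<in> children x ys"
      from Suc.IH[of u "x # ys"] obtain Q where Q: "\<forall>s. Q s > 0" "?R u =
        (act (\<lambda>_. local_condition ord bc \<sigma> (k = 0) u (x # ys)) h u True * Q True,
         act (\<lambda>_. local_condition ord bc \<sigma> (k = 0) u (x # ys)) h u False * Q False)" by blast
      have "Q True > 0" "Q False > 0" using Q(1) by auto
      then show "0 < exp (J {x, u} * sg s) * fst (?R u) + exp (- (J {x, u} * sg s)) * snd (?R u)"
        unfolding Q(2) by (intro exp_combination_pos) (auto simp: act_def add_pos_pos)
    qed
    then show ?case
      by (intro exI[of _ P]) (simp add: fst_eval_vertex Let_def P_def)
  qed
  then obtain P where "\<forall>s. P s > 0" "fst (eval_subtree n E J h ord bc \<sigma> k x ys) =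
      (act (\<lambda>_. c) h x True * P True, act (\<lambda>_. c) h x False * P False)"
    unfolding c_def by blast
  then show ?thesis by (intro that[of P]) simp_all
qed

lemma eval_subtree_bounds:
  fixes J h ord bc \<sigma> k x ys
  defines "R \<equiv> fst (eval_subtree n E J h ord bc \<sigma> k x ys)"
  shows "fst R \<ge> 0" "snd R \<ge> 0" "fst R + snd R > 0"
    and "local_condition ord bc \<sigma> (k = 0) x ys = None \<Longrightarrow> fst R > 0 \<and> snd R > 0"
    and "local_condition ord bc \<sigma> (k = 0) x ys = Some True \<Longrightarrow> fst R > 0 \<and> snd R = 0"
    and "local_condition ord bc \<sigma> (k = 0) x ys = Some False \<Longrightarrow> fst R = 0 \<and> snd R > 0"
proof -
  obtain P where pos: "P True > 0" "P False > 0" and P: "R =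
    (act (\<lambda>_. local_condition ord bc \<sigma> (k = 0) x ys) h x True * P True,
     act (\<lambda>_. local_condition ord bc \<sigma> (k = 0) x ys) h x False * P False)"
    unfolding R_def by (rule eval_subtree_form)
  from pos show "fst R + snd R > 0"
    unfolding P by (auto simp: act_def add_pos_pos)
  show "fst R \<ge> 0" "snd R \<ge> 0"
    and "local_condition ord bc \<sigma> (k = 0) x ys = None \<Longrightarrow> fst R > 0 \<and> snd R > 0"
    and "local_condition ord bc \<sigma> (k = 0) x ys = Some True \<Longrightarrow> fst R > 0 \<and> snd R = 0"
    and "local_condition ord bc \<sigma> (k = 0) x ys = Some False \<Longrightarrow> fst R = 0 \<and> snd R > 0"
    using pos unfolding P by (auto simp: act_def)
qed

text \<open>One term for each visited vertex, with the turn found by the search of the program: in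
  this form the field can be matched with the leaves that close a cycle.\<close>

lemma walk_field_eq_sum:
  assumes "distinct ys"
  shows "walk_field J ord u p ys = (\<Sum>y\<in>set ys. if {y, u} \<in> E
      then J {y, u} * turn_sign ord y (the (fst (next_after_visit y p ys))) u else 0)"
  using assms
proof (induction ys arbitrary: p)
  case (Cons z ys)
  have "next_after_visit y p (z # ys) = (fst (next_after_visit y z ys), snd (next_after_visit y z ys) + 2)"
    if "y \<in> set ys" for y
    using that Cons.prems by (auto simp: Let_def split_beta)
  then show ?case using Cons by (simp cong: sum.cong if_cong)
qed simp

text \<open>Only the parent \<open>hd ys\<close> is followed by \<open>x\<close>. Its turn sign
  towards \<open>x\<close> is 0, in agreement with the absence of backtracking from the tree; for
  any other visited neighbour of \<open>x\<close> the order compares two distinct vertices.\<close>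

lemma next_vertex:
  assumes "rev (x # ys) \<in> saw_tree E v" "x \<notin> set ys" "y \<in> set ys"
  obtains z where "fst (next_after_visit y x ys) = Some z" "{y, z} \<in> E" "y \<noteq> hd ys \<longrightarrow> z \<noteq> x" "y = hd ys \<longrightarrow> z = x"
proof -
  have dist: "distinct ys" using assms(1) by (simp add: saw_tree_def)
  have step: "{rev (x # ys) ! i, rev (x # ys) ! Suc i} \<in> E" if "i < length ys" for i
    using assms(1) that by (simp add: saw_tree_def)
  obtain j where j: "j < length ys" "rev ys ! j = y"
    using assms(3) by (metis in_set_conv_nth length_rev set_rev)
  let ?z = "rev (x # ys) ! Suc j"
  have "rev (x # ys) ! j = y" using j by (simp add: nth_append)
  then have "{y, ?z} \<in> E" using step[OF j(1)] by simp
  moreover have "?z \<noteq> x" if "y \<noteq> hd ys"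
  proof -
    have "j \<noteq> length ys - 1"
    proof
      assume "j = length ys - 1"
      then have "rev ys ! j = hd ys" using j(1) by (cases ys) (simp_all add: nth_append)
      then show False using j(2) that by simp
    qed
    then have "Suc j < length ys" using j(1) by simp
    then have "?z = rev ys ! Suc j" by (simp add: nth_append)
    then have "?z \<in> set ys" using \<open>Suc j < length ys\<close> by (metis length_rev nth_mem set_rev)
    then show ?thesis using assms(2) by auto
  qed
  moreover have "?z = x" if "y = hd ys"
  proof (cases ys)
    case (Cons a as)
    have "fst (next_after_visit y x ys) = Some x" using Cons that by simp
    then show ?thesis using fst_next_after_visit[OF dist j, of x] by simp
  qed (use assms(3) in simp)
  ultimately show ?thesis
    using that fst_next_after_visit[OF dist j, of x] by blast
qed

text \<open>An unvisited neighbour of \<open>x\<close> sends the message of its subtree. A visited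
  one other than the parent is a leaf with spin \<tau> and sends exactly 2J or -2J, twice its term
  in \<open>walk_field\<close>.\<close>

lemma log_odds_eval:
  fixes J h ord bc \<sigma> k x ys
  defines "R \<equiv> \<lambda>k u ys. fst (eval_subtree n E J h ord bc \<sigma> k u ys)"
  assumes ord: "valid_order ord" and walk: "rev (x # ys) \<in> saw_tree E v"
    and x: "x \<notin> set ys" "\<sigma> x = None" and ys: "set ys \<inter> dom \<sigma> = {}"
  shows "ln (fst (R (Suc k) x ys) / snd (R (Suc k) x ys)) = 2 * (h x + walk_field J ord x x ys) +
    (\<Sum>u\<in>{u. {x, u} \<in> E \<and> u \<notin> set (x # ys)}. edge_ratio (J {x, u}) (fst (R k u (x # ys))) (snd (R k u (x # ys))))"
proof -
  let ?N = "{u. {x, u} \<in> E \<and> u \<notin> set (x # ys)}"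
  let ?M = "{u \<in> set ys. {x, u} \<in> E \<and> u \<noteq> hd ys}"
  let ?r = "\<lambda>u. edge_ratio (J {x, u}) (fst (R k u (x # ys))) (snd (R k u (x # ys)))"
  have dist: "distinct ys" using walk by (simp add: saw_tree_def)
  have cond: "local_condition ord bc \<sigma> False x ys = None"
    using x fst_next_after_visit_eq_None[of x x ys] by (simp add: local_condition_def)
  have num: "exp (J {x, u} * t) * fst (R k u (x # ys)) + exp (- (J {x, u} * t)) * snd (R k u (x # ys)) > 0" for u t
    unfolding R_def by (intro exp_combination_pos eval_subtree_bounds)
  have ratio: "fst (R (Suc k) x ys) / snd (R (Suc k) x ys) = exp (2 * h x) *
      (\<Prod>u\<in>children x ys. (exp (J {x, u}) * fst (R k u (x # ys)) + exp (- J {x, u}) * snd (R k u (x # ys))) /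
        (exp (- J {x, u}) * fst (R k u (x # ys)) + exp (J {x, u}) * snd (R k u (x # ys))))"
  proof -
    have "exp (2 * h x) = exp (h x) / exp (- h x)" by (simp add: exp_diff[symmetric])
    then show ?thesis
      unfolding R_def by (simp add: fst_eval_vertex Let_def cond act_def prod_dividef)
  qed
  have log: "ln (fst (R (Suc k) x ys) / snd (R (Suc k) x ys)) = 2 * h x + (\<Sum>u\<in>children x ys. ?r u)"
  proof -
    have pos: "(exp (J {x, u}) * fst (R k u (x # ys)) + exp (- J {x, u}) * snd (R k u (x # ys))) /
        (exp (- J {x, u}) * fst (R k u (x # ys)) + exp (J {x, u}) * snd (R k u (x # ys))) > 0" for u
      using num[of u 1] num[of u "- 1"] by simp
    show ?thesis
      unfolding ratio edge_ratio_def by (rule ln_exp_mult_prod[OF finite_children pos])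
  qed
  have children: "children x ys = ?N \<union> ?M"
    using x edge_vertices by (auto simp: children_def dest: hd_in_set)
  have union: "(\<Sum>u\<in>?N \<union> ?M. ?r u) = (\<Sum>u\<in>?N. ?r u) + (\<Sum>u\<in>?M. ?r u)"
  proof (rule sum.union_disjoint)
    show "finite ?N" by (rule finite_subset[of _ "{..<n}"]) (use edge_vertices in auto)
  qed auto
  have "(\<Sum>u\<in>?M. ?r u) = (\<Sum>u\<in>?M. 2 * (J {u, x} * turn_sign ord u (the (fst (next_after_visit u x ys))) x))"
  proof (rule sum.cong[OF refl])
    fix u assume u: "u \<in> ?M"
    then have "u \<in> set ys" by simp
    then obtain z where z: "fst (next_after_visit u x ys) = Some z" "{u, z} \<in> E" "z \<noteq> x"
      using next_vertex[OF walk x(1)] u by blast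
    have ux: "{u, x} \<in> E" "{x, u} = {u, x}" using u by (auto simp: insert_commute)
    \<comment> \<open>The walk avoids assigned vertices, so the spin of the leaf is \<tau> and not
      an assigned one.\<close>
    have "\<sigma> u = None" using u ys by auto
    then have c: "local_condition ord bc \<sigma> (k = 0) u (x # ys) = Some (precedes ord u z x)"
      using z(1) u x by (auto simp: local_condition_def Let_def split_beta)
    show "?r u = 2 * (J {u, x} * turn_sign ord u (the (fst (next_after_visit u x ys))) x)"
    proof (cases "precedes ord u z x")
      case True
      then have "fst (R k u (x # ys)) > 0 \<and> snd (R k u (x # ys)) = 0"
        using eval_subtree_bounds(5)[of ord bc \<sigma> k u "x # ys" J h] c unfolding R_def by simp
      then show ?thesis using True z(1) ux by (simp add: edge_ratio_extreme turn_sign_def)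
    next
      case False
      then have "precedes ord u x z" using precedes_total[OF ord z(2) ux(1) z(3)] by blast
      moreover have "fst (R k u (x # ys)) = 0 \<and> snd (R k u (x # ys)) > 0"
        using False eval_subtree_bounds(6)[of ord bc \<sigma> k u "x # ys" J h] c unfolding R_def by simp
      ultimately show ?thesis using False z(1) ux by (simp add: edge_ratio_extreme turn_sign_def)
    qed
  qed
  also have "\<dots> = 2 * walk_field J ord x x ys"
  proof -
    have "walk_field J ord x x ys = (\<Sum>u\<in>?M. J {u, x} * turn_sign ord u (the (fst (next_after_visit u x ys))) x)"
      unfolding walk_field_eq_sum[OF dist]
    proof (rule sum.mono_neutral_cong_right)
      show "\<forall>u\<in>set ys - ?M. (if {u, x} \<in> E
          then J {u, x} * turn_sign ord u (the (fst (next_after_visit u x ys))) x else 0) = 0"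
      proof
        fix u assume u: "u \<in> set ys - ?M"
        show "(if {u, x} \<in> E
          then J {u, x} * turn_sign ord u (the (fst (next_after_visit u x ys))) x else 0) = 0"
        proof (cases "{u, x} \<in> E")
          case True
          then have "u = hd ys" using u by (auto simp: insert_commute)
          then have "fst (next_after_visit u x ys) = Some x"
            using next_vertex[OF walk x(1), of u] u by auto
          then show ?thesis by (simp add: turn_sign_def precedes_def)
        qed simp
      qed
    qed (auto simp: insert_commute)
    then show ?thesis by (simp add: sum_distrib_left)
  qed
  finally show ?thesis unfolding log children union by simp
qed

lemma walk_pf_bounds:
  assumes "x < n" "x \<notin> set ys"
  shows "walk_pf J h ord \<sigma> x ys s \<ge> 0" "walk_pf J h ord \<sigma> x ys True + walk_pf J h ord \<sigma> x ys False > 0"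
proof -
  have nonneg: "walk_pf J h ord \<sigma> x ys s \<ge> 0" for s
    using walk_pf_pos[of x ys \<sigma> s J h ord] walk_pf_eq_0[of x ys \<sigma> s J h ord] assms
    by (cases "\<sigma> x = Some (\<not> s)") (auto intro: less_imp_le)
  then show "walk_pf J h ord \<sigma> x ys s \<ge> 0" .
  show "walk_pf J h ord \<sigma> x ys True + walk_pf J h ord \<sigma> x ys False > 0"
  proof (cases "\<sigma> x = Some False")
    case True
    then show ?thesis
      using walk_pf_pos[of x ys \<sigma> False J h ord] assms nonneg[of True] by (intro add_nonneg_pos) auto
  next
    case False
    then show ?thesis
      using walk_pf_pos[of x ys \<sigma> True J h ord] assms nonneg[of False] by (intro add_pos_nonneg) auto
  qed
qed

text \<open>The logarithm of Weitz's recursion, in the shape of \<open>log_odds_eval\<close>: the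
  terms in \<open>h\<close> and \<open>walk_field\<close> are identical and cancel on
  subtraction.\<close>

lemma log_odds_walk_pf:
  fixes J h ord \<sigma>
  defines "p \<equiv> walk_pf J h ord \<sigma>"
  assumes "valid_order ord" "x < n" "x \<notin> set ys" "\<sigma> x = None"
  shows "ln (p x ys True / p x ys False) = 2 * (h x + walk_field J ord x x ys) +
    (\<Sum>u\<in>{u. {x, u} \<in> E \<and> u \<notin> set (x # ys)}. edge_ratio (J {x, u}) (p u (x # ys) True) (p u (x # ys) False))"
proof -
  let ?N = "{u. {x, u} \<in> E \<and> u \<notin> set (x # ys)}"
  have fin: "finite ?N" by (rule finite_subset[of _ "{..<n}"]) (use edge_vertices in auto)
  have num: "exp t * p u (x # ys) True + exp (- t) * p u (x # ys) False > 0" if u: "u \<in> ?N" for u t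
  proof -
    have "u < n" "u \<notin> set (x # ys)" using u edge_vertices by auto
    then show ?thesis
      unfolding p_def by (intro exp_combination_pos walk_pf_bounds)
  qed
  have pos: "(exp (J {x, u}) * p u (x # ys) True + exp (- J {x, u}) * p u (x # ys) False) /
       (exp (- J {x, u}) * p u (x # ys) True + exp (J {x, u}) * p u (x # ys) False) > 0" if "u \<in> ?N" for u
    using num[OF that, of "J {x, u}"] num[OF that, of "- J {x, u}"] by simp
  show ?thesis
    unfolding p_def walk_pf_recursion[where \<sigma> = \<sigma>, OF assms(2-5)] unfolding p_def[symmetric] edge_ratio_def
    by (rule ln_exp_mult_prod[OF fin pos])
qed

lemma saw_count_Suc_sum:
  "saw_count n E (Suc k) x ys = (\<Sum>u\<in>{u. {x, u} \<in> E \<and> u \<notin> set (x # ys)}. saw_count n E k u (x # ys))"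
  unfolding saw_count.simps using edge_vertices
  by (intro sum.mono_neutral_cong_right) auto

text \<open>\<open>K\<close> stands for the interaction of the edge above \<open>x\<close>. At an
  assigned vertex both messages are the same extreme value and the induction stops, so only walks
  that avoid assigned vertices occur. Elsewhere the difference of the log-odds is the sum of the
  differences of the messages from the unvisited neighbours, and crossing the edge above contributes
  tanh K \<le> tanh \<beta>.\<close>

lemma edge_ratio_error:
  fixes J h ord bc \<sigma> \<beta>
  defines "R \<equiv> \<lambda>k u ys. fst (eval_subtree n E J h ord bc \<sigma> k u ys)" and "p \<equiv> walk_pf J h ord \<sigma>"
  assumes ord: "valid_order ord" and J: "\<And>e. e \<in> E \<Longrightarrow> 0 \<le> J e \<and> J e \<le> \<beta>" and "\<beta> \<ge> 0"
    and "rev (x # ys) \<in> saw_tree E v" "x < n" "x \<notin> set ys" "set ys \<inter> dom \<sigma> = {}" "0 \<le> K" "K \<le> \<beta>"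
  shows "\<bar>edge_ratio K (fst (R k x ys)) (snd (R k x ys)) - edge_ratio K (p x ys True) (p x ys False)\<bar>
    \<le> 4 * \<beta> * tanh \<beta> ^ k * saw_count n E k x ys"
  using assms(6-)
proof (induction k arbitrary: x ys K)
  case 0
  \<comment> \<open>At the bottom the condition \<open>bc\<close> is arbitrary and only the range of
    the messages is available, hence 4 K \<le> 4 \<beta>.\<close>
  have "\<bar>edge_ratio K (p x ys True) (p x ys False)\<bar> \<le> 2 * K"
    unfolding p_def using 0 by (intro abs_edge_ratio_le walk_pf_bounds)
  moreover have "\<bar>edge_ratio K (fst (R 0 x ys)) (snd (R 0 x ys))\<bar> \<le> 2 * K"
    using eval_subtree_bounds(1-3) 0(5) unfolding R_def by (intro abs_edge_ratio_le)
  ultimately show ?case using 0(6) by simp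
next
  case (Suc k)
  show ?case
  proof (cases "\<sigma> x")
    case (Some s)
    then have c: "local_condition ord bc \<sigma> (Suc k = 0) x ys = Some s" by (simp add: local_condition_def)
    have "edge_ratio K (fst (R (Suc k) x ys)) (snd (R (Suc k) x ys)) = edge_ratio K (p x ys True) (p x ys False)"
    proof (cases s)
      case True
      then have "p x ys True > 0" "p x ys False = 0"
        using Some Suc.prems walk_pf_pos[of x ys \<sigma> True J h ord] walk_pf_eq_0[of x ys \<sigma> False J h ord]
        by (simp_all add: p_def)
      then show ?thesis
        using eval_subtree_bounds(5)[of ord bc \<sigma> "Suc k" x ys J h] c True unfolding R_def
        by (simp add: edge_ratio_extreme del: eval_subtree.simps)
    next
      case False
      then have "p x ys False > 0" "p x ys True = 0"
        using Some Suc.prems walk_pf_pos[of x ys \<sigma> False J h ord] walk_pf_eq_0[of x ys \<sigma> True J h ord]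
        by (simp_all add: p_def)
      then show ?thesis
        using eval_subtree_bounds(6)[of ord bc \<sigma> "Suc k" x ys J h] c False unfolding R_def
        by (simp add: edge_ratio_extreme del: eval_subtree.simps)
    qed
    then show ?thesis using \<open>\<beta> \<ge> 0\<close> by (simp del: saw_count.simps)
  next
    case None
    let ?N = "{u. {x, u} \<in> E \<and> u \<notin> set (x # ys)}"
    have c: "local_condition ord bc \<sigma> (Suc k = 0) x ys = None"
      using None Suc.prems fst_next_after_visit_eq_None[of x x ys] by (simp add: local_condition_def)
    have child: "\<bar>edge_ratio (J {x, u}) (fst (R k u (x # ys))) (snd (R k u (x # ys))) -
        edge_ratio (J {x, u}) (p u (x # ys) True) (p u (x # ys) False)\<bar>
        \<le> 4 * \<beta> * tanh \<beta> ^ k * saw_count n E k u (x # ys)" if u: "u \<in> ?N" for u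
    proof (rule Suc.IH)
      have "u \<in> children x ys" using u Suc.prems(3) by (auto simp: children_def dest: hd_in_set)
      then show "rev (u # x # ys) \<in> saw_tree E v" using Suc.prems(1) saw_tree_rev_Cons by blast
      show "set (x # ys) \<inter> dom \<sigma> = {}" using None Suc.prems(4) by auto
    qed (use u J edge_vertices in auto)
    have "\<bar>ln (fst (R (Suc k) x ys) / snd (R (Suc k) x ys)) - ln (p x ys True / p x ys False)\<bar> =
        \<bar>\<Sum>u\<in>?N. edge_ratio (J {x, u}) (fst (R k u (x # ys))) (snd (R k u (x # ys))) -
        edge_ratio (J {x, u}) (p u (x # ys) True) (p u (x # ys) False)\<bar>"
      unfolding R_def p_def sum_subtractf
      using log_odds_eval[where \<sigma> = \<sigma> and J = J and h = h and bc = bc and k = k, OF ord Suc.prems(1,3) None Suc.prems(4)]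
        log_odds_walk_pf[where \<sigma> = \<sigma> and J = J and h = h, OF ord Suc.prems(2,3) None] by (simp only: add_diff_add diff_self add_0)
    also have "\<dots> \<le> (\<Sum>u\<in>?N. 4 * \<beta> * tanh \<beta> ^ k * saw_count n E k u (x # ys))"
      using child by (intro order.trans[OF sum_abs] sum_mono) blast
    also have "\<dots> = 4 * \<beta> * tanh \<beta> ^ k * saw_count n E (Suc k) x ys"
      unfolding saw_count_Suc_sum by (simp add: sum_distrib_left)
    finally have diff: "\<bar>ln (fst (R (Suc k) x ys) / snd (R (Suc k) x ys)) - ln (p x ys True / p x ys False)\<bar>
        \<le> 4 * \<beta> * tanh \<beta> ^ k * saw_count n E (Suc k) x ys" .
    have "\<bar>edge_ratio K (fst (R (Suc k) x ys)) (snd (R (Suc k) x ys)) - edge_ratio K (p x ys True) (p x ys False)\<bar>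
        \<le> tanh K * \<bar>ln (fst (R (Suc k) x ys) / snd (R (Suc k) x ys)) - ln (p x ys True / p x ys False)\<bar>"
    proof (rule edge_ratio_contraction[OF Suc.prems(5)])
      show "fst (R (Suc k) x ys) > 0" "snd (R (Suc k) x ys) > 0"
        using eval_subtree_bounds(4)[OF c, of J h] unfolding R_def by blast+
      show "p x ys True > 0" "p x ys False > 0"
        using None Suc.prems by (auto simp: p_def intro!: walk_pf_pos)
    qed
    also have "\<dots> \<le> tanh \<beta> * (4 * \<beta> * tanh \<beta> ^ k * saw_count n E (Suc k) x ys)"
    proof (intro mult_mono diff)
      show "tanh K \<le> tanh \<beta>" using Suc.prems(6) by simp
    qed (use \<open>\<beta> \<ge> 0\<close> in auto)
    finally show ?thesis by (simp add: mult_ac del: saw_count.simps)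
  qed
qed

text \<open>The estimate for messages is applied at the neighbours of the root, \<open>k\<close>
  levels above the bottom; the passage from log-odds to probabilities costs no further
  factor.\<close>

lemma saw_prob_error:
  fixes J h ord bc \<sigma> \<beta>
  assumes ord: "valid_order ord" and J: "\<And>e. e \<in> E \<Longrightarrow> 0 \<le> J e \<and> J e \<le> \<beta>" and "\<beta> \<ge> 0"
    and v: "v < n" "\<sigma> v = None"
  defines "a \<equiv> graph_pf J \<sigma> {..<n} h v"
  shows "\<bar>saw_prob E J h ord bc (Suc k) \<sigma> v - a True / (a True + a False)\<bar>
    \<le> 4 * \<beta> * tanh \<beta> ^ k * saw_count n E (Suc k) v []"
proof -
  let ?N = "{u. {v, u} \<in> E \<and> u \<notin> set [v]}"
  define R where "R = (\<lambda>k u ys. fst (eval_subtree n E J h ord bc \<sigma> k u ys))"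
  define p where "p = walk_pf J h ord \<sigma>"
  have a: "a = p v []" by (simp add: a_def p_def walk_pf_def[abs_def])
  have c: "local_condition ord bc \<sigma> (Suc k = 0) v [] = None" by (simp add: local_condition_def v)
  have R: "fst (R (Suc k) v []) > 0" "snd (R (Suc k) v []) > 0"
    using eval_subtree_bounds(4)[OF c, of J h] unfolding R_def by blast+
  have p: "p v [] True > 0" "p v [] False > 0" using v by (auto simp: p_def intro!: walk_pf_pos)
  have root: "rev [v] \<in> saw_tree E v" using root_in_saw_tree by simp
  have "saw_prob E J h ord bc (Suc k) \<sigma> v = fst (R (Suc k) v []) / (fst (R (Suc k) v []) + snd (R (Suc k) v []))"
    unfolding compute_prob_eq_saw_prob[symmetric] R_def by (simp add: compute_prob_def split_beta Let_def del: eval_subtree.simps)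
  then have "\<bar>saw_prob E J h ord bc (Suc k) \<sigma> v - a True / (a True + a False)\<bar> \<le>
      \<bar>ln (fst (R (Suc k) v []) / snd (R (Suc k) v [])) - ln (p v [] True / p v [] False)\<bar>"
    unfolding a using probability_le_log_odds[OF R p] by simp
  also have "\<dots> = \<bar>\<Sum>u\<in>?N. edge_ratio (J {v, u}) (fst (R k u [v])) (snd (R k u [v])) -
        edge_ratio (J {v, u}) (p u [v] True) (p u [v] False)\<bar>"
    unfolding R_def p_def sum_subtractf
    using log_odds_eval[where \<sigma> = \<sigma> and J = J and h = h and bc = bc and k = k, OF ord root _ v(2)]
      log_odds_walk_pf[where \<sigma> = \<sigma> and J = J and h = h and ys = "[]", OF ord v(1) _ v(2)]
    by (simp del: eval_subtree.simps)
  also have "\<dots> \<le> (\<Sum>u\<in>?N. 4 * \<beta> * tanh \<beta> ^ k * saw_count n E k u [v])"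
  proof (intro order.trans[OF sum_abs] sum_mono)
    fix u assume u: "u \<in> ?N"
    have "u \<in> children v []" using u by (simp add: children_def)
    then have "rev [u, v] \<in> saw_tree E v" using saw_tree_rev_Cons root by blast
    then show "\<bar>edge_ratio (J {v, u}) (fst (R k u [v])) (snd (R k u [v])) -
        edge_ratio (J {v, u}) (p u [v] True) (p u [v] False)\<bar> \<le> 4 * \<beta> * tanh \<beta> ^ k * saw_count n E k u [v]"
      unfolding R_def p_def using u J edge_vertices v \<open>\<beta> \<ge> 0\<close>
      by (intro edge_ratio_error[OF ord J]) auto
  qed
  also have "\<dots> = 4 * \<beta> * tanh \<beta> ^ k * saw_count n E (Suc k) v []"
    unfolding saw_count_Suc_sum by (simp add: sum_distrib_left)
  finally show ?thesis .
qed

end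

section \<open>The sampling error\<close>

lemma prob_bind_bernoulli:
  assumes "0 \<le> p" "p \<le> 1"
  shows "measure_pmf.prob (bernoulli_pmf p \<bind> f) A =
    p * measure_pmf.prob (f True) A + (1 - p) * measure_pmf.prob (f False) A"
proof -
  have "measure_pmf.prob (bernoulli_pmf p \<bind> f) A = measure_pmf.expectation (bernoulli_pmf p) (\<lambda>s. measure_pmf.prob (f s) A)"
    unfolding measure_pmf_bind
    by (rule measure_pmf.measure_bind[where N = "count_space UNIV"]) (auto simp: measure_subprob)
  then show ?thesis using assms by (simp add: mult.commute)
qed

text \<open>The error of a two-stage experiment is that of the coin plus that of the continuation.
  The error of the coin is multiplied by a difference of two probabilities, hence by at most
  1.\<close>

lemma convex_combination_error:
  fixes p q a b a' b' e d :: real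
  assumes "0 \<le> p" "p \<le> 1" "\<bar>q - p\<bar> \<le> d" "\<bar>a - a'\<bar> \<le> e" "\<bar>b - b'\<bar> \<le> e"
    and "0 \<le> a" "a \<le> 1" "0 \<le> b" "b \<le> 1"
  shows "\<bar>(q * a + (1 - q) * b) - (p * a' + (1 - p) * b')\<bar> \<le> d + e"
proof -
  have "(q * a + (1 - q) * b) - (p * a' + (1 - p) * b') = (q - p) * (a - b) + (p * (a - a') + (1 - p) * (b - b'))"
    by (simp add: algebra_simps)
  also have "\<bar>\<dots>\<bar> \<le> \<bar>q - p\<bar> * \<bar>a - b\<bar> + (p * \<bar>a - a'\<bar> + (1 - p) * \<bar>b - b'\<bar>)"
    using assms(1,2) by (intro order.trans[OF abs_triangle_ineq] add_mono) (auto simp: abs_mult)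
  also have "\<bar>q - p\<bar> * \<bar>a - b\<bar> \<le> d * 1"
    using assms by (intro mult_mono) auto
  also have "p * \<bar>a - a'\<bar> + (1 - p) * \<bar>b - b'\<bar> \<le> p * e + (1 - p) * e"
    using assms by (intro add_mono mult_left_mono) auto
  also have "p * e + (1 - p) * e = e" by (simp add: algebra_simps)
  finally show ?thesis by simp
qed

section \<open>The conditional law on the graph and the output of the algorithm\<close>

context graph
begin

definition cond_mass :: "(nat set \<Rightarrow> real) \<Rightarrow> (nat \<Rightarrow> real) \<Rightarrow> (nat \<rightharpoonup> bool) \<Rightarrow> (nat \<rightharpoonup> bool) set \<Rightarrow> real" where
  "cond_mass J h \<sigma> A = (\<Sum>\<eta>\<in>configs {..<n}. if \<eta> \<in> A then graph_weight J \<sigma> {..<n} h \<eta> else 0)"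

definition cond_prob_graph :: "(nat set \<Rightarrow> real) \<Rightarrow> (nat \<Rightarrow> real) \<Rightarrow> (nat \<rightharpoonup> bool) \<Rightarrow> (nat \<rightharpoonup> bool) set \<Rightarrow> real" where
  "cond_prob_graph J h \<sigma> A = cond_mass J h \<sigma> A / graph_total J \<sigma> {..<n} h"

lemma cond_prob_graph_bounds: "0 \<le> cond_prob_graph J h \<sigma> A" "cond_prob_graph J h \<sigma> A \<le> 1"
proof -
  have "cond_mass J h \<sigma> A \<le> graph_total J \<sigma> {..<n} h"
    unfolding cond_mass_def graph_total_def by (intro sum_mono) (simp add: graph_weight_nonneg)
  moreover have "0 \<le> cond_mass J h \<sigma> A"
    unfolding cond_mass_def by (intro sum_nonneg) (simp add: graph_weight_nonneg)
  moreover have "graph_total J \<sigma> {..<n} h > 0" by (intro graph_total_pos) simp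
  ultimately show "0 \<le> cond_prob_graph J h \<sigma> A" "cond_prob_graph J h \<sigma> A \<le> 1"
    by (simp_all add: cond_prob_graph_def)
qed

lemma graph_weight_assign:
  assumes "v < n" "\<sigma> v = None" "\<eta> \<in> configs {..<n}"
  shows "graph_weight J (\<sigma>(v \<mapsto> s)) {..<n} h \<eta> = (if \<eta> v = Some s then graph_weight J \<sigma> {..<n} h \<eta> else 0)"
proof -
  obtain t where t: "\<eta> v = Some t" using configs_value[OF assms(3), of v] assms(1) by auto
  show ?thesis
  proof (cases "t = s")
    case True
    have "act (\<sigma>(v \<mapsto> s)) h u (\<eta> u = Some True) = act \<sigma> h u (\<eta> u = Some True)" for u
      using True t assms(2) by (cases s) (auto simp: act_def)
    then show ?thesis using True t by (simp add: graph_weight_def gibbs_def)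
  next
    case False
    then have "act (\<sigma>(v \<mapsto> s)) h v (\<eta> v = Some True) = 0"
      using t by (cases s; cases t) (auto simp: act_def)
    then have "(\<Prod>u<n. act (\<sigma>(v \<mapsto> s)) h u (\<eta> u = Some True)) = 0"
      using assms(1) by (intro prod_zero) (auto intro!: bexI[of _ v])
    then show ?thesis using False t by (simp add: graph_weight_def gibbs_def)
  qed
qed

lemma graph_total_assign:
  assumes "v < n" "\<sigma> v = None"
  shows "graph_total J (\<sigma>(v \<mapsto> s)) {..<n} h = graph_pf J \<sigma> {..<n} h v s"
  unfolding graph_total_def graph_pf_def using assms by (intro sum.cong refl graph_weight_assign)

text \<open>Law of total probability for the spin of \<open>v\<close>: assigning a spin restricts
  the Gibbs sum to the configurations that have it.\<close>

lemma cond_prob_graph_split: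
  fixes J h
  assumes "v < n" "\<sigma> v = None"
  defines "q \<equiv> graph_pf J \<sigma> {..<n} h v True / (graph_pf J \<sigma> {..<n} h v True + graph_pf J \<sigma> {..<n} h v False)"
  shows "cond_prob_graph J h \<sigma> A =
    q * cond_prob_graph J h (\<sigma>(v \<mapsto> True)) A + (1 - q) * cond_prob_graph J h (\<sigma>(v \<mapsto> False)) A"
proof -
  define a b where "a = graph_pf J \<sigma> {..<n} h v True" and "b = graph_pf J \<sigma> {..<n} h v False"
  have pos: "a > 0" "b > 0" using assms(1,2) by (auto simp: a_def b_def intro!: graph_pf_pos)
  have total: "graph_total J \<sigma> {..<n} h = a + b"
    using assms(1) by (simp add: a_def b_def graph_total_split[of v])
  have mass: "cond_mass J h \<sigma> A = cond_mass J h (\<sigma>(v \<mapsto> True)) A + cond_mass J h (\<sigma>(v \<mapsto> False)) A"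
    unfolding cond_mass_def sum.distrib[symmetric]
  proof (rule sum.cong[OF refl])
    fix \<eta> assume \<eta>: "\<eta> \<in> configs {..<n}"
    obtain t where "\<eta> v = Some t" using configs_value[OF \<eta>, of v] assms(1) by auto
    then show "(if \<eta> \<in> A then graph_weight J \<sigma> {..<n} h \<eta> else 0) =
       (if \<eta> \<in> A then graph_weight J (\<sigma>(v \<mapsto> True)) {..<n} h \<eta> else 0) +
       (if \<eta> \<in> A then graph_weight J (\<sigma>(v \<mapsto> False)) {..<n} h \<eta> else 0)"
      using assms(1,2) \<eta> by (cases t) (simp_all add: graph_weight_assign)
  qed
  have "1 - q = b / (a + b)" using pos by (simp add: q_def a_def[symmetric] b_def[symmetric] field_simps)
  then show ?thesis
    using pos unfolding cond_prob_graph_def total graph_total_assign[of v \<sigma>, OF assms(1,2)] mass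
      a_def[symmetric] b_def[symmetric]
    by (simp add: q_def a_def[symmetric] b_def[symmetric] add_divide_distrib)
qed

lemma cond_prob_graph_complete:
  assumes "dom \<sigma> = {..<n}"
  shows "cond_prob_graph J h \<sigma> A = indicator A \<sigma>"
proof -
  have \<sigma>: "\<sigma> \<in> configs {..<n}" using assms by (simp add: configs_def)
  have zero: "graph_weight J \<sigma> {..<n} h \<eta> = 0" if \<eta>: "\<eta> \<in> configs {..<n}" "\<eta> \<noteq> \<sigma>" for \<eta>
  proof -
    obtain v where v: "\<eta> v \<noteq> \<sigma> v" using \<eta>(2) by blast
    then have "v < n" using configs_None[OF \<sigma>, of v] configs_None[OF \<eta>(1), of v] by (cases "v < n") simp_all
    then obtain s t where st: "\<sigma> v = Some s" "\<eta> v = Some t"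
      using configs_value[OF \<sigma>, of v] configs_value[OF \<eta>(1), of v] by auto
    then have "act \<sigma> h v (\<eta> v = Some True) = 0"
      using v by (cases s; cases t) (auto simp: act_def)
    then have "(\<Prod>u<n. act \<sigma> h u (\<eta> u = Some True)) = 0"
      using \<open>v < n\<close> by (intro prod_zero) (auto intro!: bexI[of _ v])
    then show ?thesis by (simp add: graph_weight_def gibbs_def)
  qed
  have fin: "finite (configs {..<n})" by (simp add: finite_configs)
  have total: "graph_total J \<sigma> {..<n} h = graph_weight J \<sigma> {..<n} h \<sigma>"
    unfolding graph_total_def using zero \<sigma> fin by (subst sum.remove[OF fin \<sigma>]) simp
  have "(\<Sum>\<eta>\<in>configs {..<n} - {\<sigma>}. if \<eta> \<in> A then graph_weight J \<sigma> {..<n} h \<eta> else 0) = 0"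
    using zero by (intro sum.neutral) simp
  then have mass: "cond_mass J h \<sigma> A = (if \<sigma> \<in> A then graph_weight J \<sigma> {..<n} h \<sigma> else 0)"
    unfolding cond_mass_def by (subst sum.remove[OF fin \<sigma>]) simp
  have "graph_total J \<sigma> {..<n} h > 0" by (intro graph_total_pos) simp
  then show ?thesis by (simp add: cond_prob_graph_def mass total)
qed

text \<open>The starting point of the sampling, with nothing assigned;
  \<open>cond_prob_graph_complete\<close> is the end point, where one configuration remains.\<close>

lemma cond_prob_graph_empty:
  "cond_prob_graph J h Map.empty A = measure_pmf.prob (ising {..<n} E J h) A"
proof -
  have "{e \<in> E. e \<subseteq> {..<n}} = E"
    using edges by (auto simp: nsets_def)
  then have weight: "graph_weight J Map.empty {..<n} h \<eta> = ising_weight {..<n} E J h \<eta>" if "\<eta> \<in> configs {..<n}" for \<eta>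
    using gibbs_act[of "{..<n}" E Map.empty \<eta> J h] that finite_edges by (simp add: graph_weight_def)
  have "cond_mass J h Map.empty A = (\<Sum>\<eta>\<in>{\<eta>\<in>configs {..<n}. \<eta> \<in> A}. ising_weight {..<n} E J h \<eta>)"
    unfolding cond_mass_def using weight
    by (subst sum.inter_filter) (auto simp: finite_configs intro!: sum.cong)
  moreover have "graph_total J Map.empty {..<n} h = (\<Sum>\<eta>\<in>configs {..<n}. ising_weight {..<n} E J h \<eta>)"
    unfolding graph_total_def using weight by (rule sum.cong[OF refl])
  ultimately show ?thesis by (simp add: cond_prob_graph_def prob_ising)
qed

lemma saw_prob_bounds: "0 \<le> saw_prob E J h ord bc L \<sigma> v" "saw_prob E J h ord bc L \<sigma> v \<le> 1"
  using eval_subtree_bounds(1-3)[of J h ord bc \<sigma> L v "[]"]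
  unfolding compute_prob_eq_saw_prob[symmetric]
  by (simp_all add: compute_prob_def split_beta Let_def)

text \<open>The conditional law of the Ising model obeys the same recursion over \<open>vs\<close>
  as the output, with exact coins. The errors add up because the bound for one vertex is uniform in
  the spins assigned before.\<close>

lemma saw_output_error:
  fixes J h ord bc \<beta>
  assumes ord: "valid_order ord" and J: "\<And>e. e \<in> E \<Longrightarrow> 0 \<le> J e \<and> J e \<le> \<beta>" and "\<beta> \<ge> 0"
    and "distinct vs" "set vs \<inter> dom \<sigma> = {}" "set vs \<union> dom \<sigma> = {..<n}"
  shows "\<bar>cond_prob_graph J h \<sigma> A - measure_pmf.prob (saw_output E J h ord bc (Suc k) vs \<sigma>) A\<bar>
    \<le> (\<Sum>v\<in>set vs. 4 * \<beta> * tanh \<beta> ^ k * saw_count n E (Suc k) v [])"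
  using assms(4-)
proof (induction vs arbitrary: \<sigma>)
  case Nil
  then show ?case by (simp add: cond_prob_graph_complete)
next
  case (Cons v vs)
  let ?\<epsilon> = "\<lambda>v. 4 * \<beta> * tanh \<beta> ^ k * saw_count n E (Suc k) v []"
  have v: "v < n" "\<sigma> v = None" using Cons.prems by auto
  have IH: "\<bar>cond_prob_graph J h (\<sigma>(v \<mapsto> s)) A - measure_pmf.prob (saw_output E J h ord bc (Suc k) vs (\<sigma>(v \<mapsto> s))) A\<bar>
    \<le> (\<Sum>v\<in>set vs. ?\<epsilon> v)" for s
  proof (rule Cons.IH)
    show "distinct vs" using Cons.prems(1) by simp
    show "set vs \<inter> dom (\<sigma>(v \<mapsto> s)) = {}" "set vs \<union> dom (\<sigma>(v \<mapsto> s)) = {..<n}"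
      using Cons.prems unfolding dom_fun_upd by auto
  qed
  have "(\<Sum>v\<in>set (v # vs). ?\<epsilon> v) = ?\<epsilon> v + (\<Sum>v\<in>set vs. ?\<epsilon> v)"
    using Cons.prems(1) by (simp del: saw_count.simps)
  moreover have q: "\<bar>graph_pf J \<sigma> {..<n} h v True / (graph_pf J \<sigma> {..<n} h v True + graph_pf J \<sigma> {..<n} h v False) -
      saw_prob E J h ord bc (Suc k) \<sigma> v\<bar> \<le> ?\<epsilon> v"
    using saw_prob_error[where \<sigma> = \<sigma> and h = h and bc = bc and k = k, OF ord J \<open>\<beta> \<ge> 0\<close> v]
    by (subst abs_minus_commute)
  moreover note convex_combination_error[OF saw_prob_bounds q IH IH cond_prob_graph_bounds cond_prob_graph_bounds]
  ultimately show ?case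
    unfolding saw_output.simps prob_bind_bernoulli[OF saw_prob_bounds] cond_prob_graph_split[where \<sigma> = \<sigma>, OF v]
    by (simp only:)
qed

text \<open>Collects what is needed from the random graph in one number \<open>S\<close>, a bound on
  the number of short self-avoiding walks. It serves all labellings, orders and boundary conditions
  at once.\<close>

lemma sampler_guaranteeI:
  fixes J h \<beta> S T \<epsilon>
  assumes J: "\<And>e. e \<in> E \<Longrightarrow> 0 \<le> J e \<and> J e \<le> \<beta>" and "\<beta> \<ge> 0"
    and S: "real (\<Sum>v<n. \<Sum>j\<le>Suc k. saw_count n E j v []) \<le> S"
    and \<epsilon>: "4 * \<beta> * tanh \<beta> ^ k * S < \<epsilon>"
    and T: "real (3 * Suc k + 19 + n * (3 * Suc k + 39)) * S + 7 * n + 1 \<le> T"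
  shows "sampler_guarantee n E J h (Suc k) T \<epsilon>"
  unfolding sampler_guarantee_def Let_def
proof (intro allI impI conjI)
  fix vs ord bc
  assume vs: "distinct vs" "set vs = {..<n}" and "\<forall>u<n. linear_order_on {w. {u, w} \<in> E} (ord u)"
  then have ord: "valid_order ord" by (simp add: valid_order_def)
  let ?R = "run_sampler n E J h ord bc (Suc k) vs Map.empty"
  let ?Q = "saw_output E J h ord bc (Suc k) vs Map.empty"
  show "map_pmf fst ?R = ?Q" by (rule run_sampler_implements)
  let ?B = "3 * Suc k + 19 + n * (3 * Suc k + 39)"
  show "\<forall>(\<sigma>, t)\<in>set_pmf ?R. real t \<le> T"
  proof (intro ballI, clarify)
    fix \<sigma> t assume "(\<sigma>, t) \<in> set_pmf ?R"
    then have "t \<le> (\<Sum>v\<leftarrow>vs. ?B * (\<Sum>j\<le>Suc k. saw_count n E j v []) + 7) + 1"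
      by (rule run_sampler_time)
    also have "(\<Sum>v\<leftarrow>vs. ?B * (\<Sum>j\<le>Suc k. saw_count n E j v []) + 7) =
        (\<Sum>v<n. ?B * (\<Sum>j\<le>Suc k. saw_count n E j v []) + 7)"
      using vs by (simp only: sum_list_distinct_conv_sum_set)
    also have "\<dots> = ?B * (\<Sum>v<n. \<Sum>j\<le>Suc k. saw_count n E j v []) + 7 * n"
      unfolding sum.distrib sum_distrib_left[symmetric] sum_constant card_lessThan by simp
    finally have "real t \<le> real (?B * (\<Sum>v<n. \<Sum>j\<le>Suc k. saw_count n E j v []) + 7 * n + 1)"
      by (simp only: of_nat_le_iff)
    also have "\<dots> = real ?B * real (\<Sum>v<n. \<Sum>j\<le>Suc k. saw_count n E j v []) + 7 * n + 1"
      by (simp only: of_nat_add of_nat_mult of_nat_1 of_nat_numeral)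
    also have "\<dots> \<le> real ?B * S + 7 * n + 1"
      using S by (intro add_right_mono mult_left_mono) simp_all
    finally show "real t \<le> T" using T by linarith
  qed
  have "tv_dist (ising {..<n} E J h) ?Q \<le> (\<Sum>v\<in>set vs. 4 * \<beta> * tanh \<beta> ^ k * saw_count n E (Suc k) v [])"
    unfolding tv_dist_def
  proof (rule cSUP_least)
    fix A
    show "\<bar>measure_pmf.prob (ising {..<n} E J h) A - measure_pmf.prob ?Q A\<bar>
        \<le> (\<Sum>v\<in>set vs. 4 * \<beta> * tanh \<beta> ^ k * saw_count n E (Suc k) v [])"
      unfolding cond_prob_graph_empty[symmetric]
      using vs by (intro saw_output_error[OF ord J \<open>\<beta> \<ge> 0\<close>]) auto
  qed simp
  also have "\<dots> = 4 * \<beta> * tanh \<beta> ^ k * real (\<Sum>v<n. saw_count n E (Suc k) v [])"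
    using vs(2) by (simp only: sum_distrib_left of_nat_sum)
  also have "\<dots> \<le> 4 * \<beta> * tanh \<beta> ^ k * S"
  proof (rule mult_left_mono)
    have "(\<Sum>v<n. saw_count n E (Suc k) v []) \<le> (\<Sum>v<n. \<Sum>j\<le>Suc k. saw_count n E j v [])"
      by (intro sum_mono member_le_sum) auto
    then show "real (\<Sum>v<n. saw_count n E (Suc k) v []) \<le> S"
      using S by linarith
  qed (use \<open>\<beta> \<ge> 0\<close> in auto)
  finally show "tv_dist (ising {..<n} E J h) ?Q < \<epsilon>" using \<epsilon> by linarith
qed

end

section \<open>Random graphs\<close>

lemma set_pmf_gnp: "set_pmf (gnp n p) \<subseteq> Pow (nsets {..<n} 2)"
  by (auto simp: gnp_def)

lemma finite_set_pmf_gnp: "finite (set_pmf (gnp n p))"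
  using set_pmf_gnp by (rule finite_subset) (simp add: finite_imp_finite_nsets)

lemma integrable_gnp: "integrable (measure_pmf (gnp n p)) (f :: _ \<Rightarrow> real)"
  using finite_set_pmf_gnp by (rule integrable_measure_pmf_finite)

lemma prob_gnp_edges:
  assumes "F \<subseteq> nsets {..<n} 2" "0 \<le> p" "p \<le> 1"
  shows "measure_pmf.prob (gnp n p) {E. F \<subseteq> E} = p ^ card F"
proof -
  let ?N = "nsets {..<n} 2"
  have fin: "finite ?N" by (simp add: finite_imp_finite_nsets)
  have "(\<lambda>f. {e \<in> ?N. f e}) -` {E. F \<subseteq> E} = Pi ?N (\<lambda>e. if e \<in> F then {True} else UNIV)"
    using assms(1) by (auto simp: Pi_def)
  then have "measure_pmf.prob (gnp n p) {E. F \<subseteq> E} =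
      (\<Prod>e\<in>?N. measure_pmf.prob (bernoulli_pmf p) (if e \<in> F then {True} else UNIV))"
    unfolding gnp_def measure_map_pmf using measure_Pi_pmf_Pi[OF fin] by simp
  also have "\<dots> = (\<Prod>e\<in>F. p)"
    using assms fin by (intro prod.mono_neutral_cong_right) (auto simp: measure_pmf_single)
  finally show ?thesis by simp
qed

text \<open>
  The edge set \<open>F\<close> of the walk made so far is carried along, because the next edge is independent
  of it.
\<close>

lemma expectation_saw_count:
  assumes p: "0 \<le> p" "p \<le> 1"
    and "F \<subseteq> nsets {..<n} 2" "\<forall>e\<in>F. e \<subseteq> set (x # ys)" "x < n"
  shows "measure_pmf.expectation (gnp n p) (\<lambda>E. if F \<subseteq> E then real (saw_count n E k x ys) else 0)
    \<le> p ^ card F * (n * p) ^ k"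
  using assms(3-)
proof (induction k arbitrary: F x ys)
  case 0
  have "(\<lambda>E. if F \<subseteq> E then real (saw_count n E 0 x ys) else 0) = indicator {E. F \<subseteq> E}"
    by (auto simp: indicator_def)
  then show ?case using prob_gnp_edges[OF 0(1) p] by simp
next
  case (Suc k)
  \<comment> \<open>The presence of the next edge is absorbed into the set of edges that have to be
    present.\<close>
  let ?g = "\<lambda>u E. if u \<notin> set (x # ys) then if insert {x, u} F \<subseteq> E then real (saw_count n E k u (x # ys)) else 0 else 0"
  have "(\<lambda>E. if F \<subseteq> E then real (saw_count n E (Suc k) x ys) else 0) = (\<lambda>E. \<Sum>u<n. ?g u E)"
  proof
    fix E
    show "(if F \<subseteq> E then real (saw_count n E (Suc k) x ys) else 0) = (\<Sum>u<n. ?g u E)"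
    proof (cases "F \<subseteq> E")
      case True
      then show ?thesis by (auto intro!: sum.cong)
    next
      case False
      then have "?g u E = 0" for u by simp
      then show ?thesis using False by (simp only: if_False sum.neutral_const)
    qed
  qed
  then have "measure_pmf.expectation (gnp n p) (\<lambda>E. if F \<subseteq> E then real (saw_count n E (Suc k) x ys) else 0) =
      (\<Sum>u<n. measure_pmf.expectation (gnp n p) (?g u))"
    by (simp add: integrable_gnp)
  also have "\<dots> \<le> (\<Sum>u<n. p ^ Suc (card F) * (n * p) ^ k)"
  proof (rule sum_mono)
    fix u assume "u \<in> {..<n}"
    show "measure_pmf.expectation (gnp n p) (?g u) \<le> p ^ Suc (card F) * (n * p) ^ k"
    proof (cases "u \<in> set (x # ys)")
      case True
      then show ?thesis using p by simp
    next
      case False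
      \<comment> \<open>All edges of \<open>F\<close> join vertices of the walk and \<open>u\<close>
        is new, so the next edge brings a fresh factor \<open>p\<close>.\<close>
      have "{x, u} \<notin> F" using False Suc.prems(2) by auto
      moreover have "finite F"
        using Suc.prems(1) by (rule finite_subset) (simp add: finite_imp_finite_nsets)
      ultimately have card: "card (insert {x, u} F) = Suc (card F)" by simp
      have "measure_pmf.expectation (gnp n p)
          (\<lambda>E. if insert {x, u} F \<subseteq> E then real (saw_count n E k u (x # ys)) else 0)
        \<le> p ^ card (insert {x, u} F) * (n * p) ^ k"
      proof (rule Suc.IH)
        show "insert {x, u} F \<subseteq> nsets {..<n} 2"
          using Suc.prems False \<open>u \<in> {..<n}\<close> by auto
        show "\<forall>e\<in>insert {x, u} F. e \<subseteq> set (u # x # ys)"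
          using Suc.prems(2) by auto
        show "u < n" using \<open>u \<in> {..<n}\<close> by simp
      qed
      then show ?thesis using False unfolding card by simp
    qed
  qed
  also have "\<dots> = p ^ card F * (n * p) ^ Suc k"
    by (simp add: algebra_simps)
  finally show ?case .
qed

lemma prob_saw_count:
  fixes d :: real
  assumes "d \<ge> 1" "real n \<ge> d"
  shows "measure_pmf.prob (gnp n (d / n))
      {E. real (\<Sum>v<n. \<Sum>j\<le>L. saw_count n E j v []) \<le> real n ^ 2 * (real L + 1) * d ^ L} \<ge> 1 - 1 / n"
proof -
  let ?M = "gnp n (d / n)"
  define X where "X E = real (\<Sum>v<n. \<Sum>j\<le>L. saw_count n E j v [])" for E
  define c where "c = real n ^ 2 * (real L + 1) * d ^ L"
  have n: "real n > 0" using assms by linarith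
  have c: "c > 0" using n assms by (simp add: c_def)
  have p: "0 \<le> d / n" "d / n \<le> 1" using assms n by (auto simp: divide_le_eq)
  have "measure_pmf.expectation ?M X =
      (\<Sum>v<n. \<Sum>j\<le>L. measure_pmf.expectation ?M (\<lambda>E. real (saw_count n E j v [])))"
    unfolding X_def by (simp add: integrable_gnp)
  also have "\<dots> \<le> (\<Sum>v<n. \<Sum>j\<le>L. d ^ L)"
  proof (intro sum_mono)
    fix v j assume "v \<in> {..<n}" "j \<in> {..L}"
    then have "measure_pmf.expectation ?M (\<lambda>E. real (saw_count n E j v [])) \<le> d ^ j"
      using expectation_saw_count[where n = n and F = "{}" and x = v and ys = "[]" and k = j, OF p] n by simp
    \<comment> \<open>Since \<open>d \<ge> 1\<close>, the bound for the greatest length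
      dominates.\<close>
    also have "\<dots> \<le> d ^ L" using assms \<open>j \<in> {..L}\<close> by (intro power_increasing) auto
    finally show "measure_pmf.expectation ?M (\<lambda>E. real (saw_count n E j v [])) \<le> d ^ L" .
  qed
  also have "\<dots> = c / n" using n by (simp add: c_def power2_eq_square)
  finally have exp: "measure_pmf.expectation ?M X \<le> c / n" .
  have "measure_pmf.prob ?M {E \<in> space ?M. X E \<ge> c} \<le> measure_pmf.expectation ?M X / c"
    using c
  proof (intro integral_Markov_inequality_measure[of _ _ "{}"] integrable_gnp)
    show "AE E in ?M. 0 \<le> X E" unfolding X_def by (intro AE_I2 of_nat_0_le_iff)
  qed auto
  also have "\<dots> \<le> 1 / n" using exp c n by (simp add: divide_le_eq)
  finally have "measure_pmf.prob ?M {E. X E \<ge> c} \<le> 1 / n" by simp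
  moreover have "measure_pmf.prob ?M {E. \<not> X E \<ge> c} = 1 - measure_pmf.prob ?M {E. X E \<ge> c}"
    using measure_pmf.prob_compl[of "{E. X E \<ge> c}" ?M] by (simp add: Compl_eq_Diff_UNIV[symmetric] Collect_neg_eq)
  moreover have "measure_pmf.prob ?M {E. \<not> X E \<ge> c} \<le> measure_pmf.prob ?M {E. X E \<le> c}"
    by (intro measure_pmf.finite_measure_mono) auto
  ultimately show ?thesis unfolding X_def c_def by linarith
qed

section \<open>Choice of the depth and of the constants\<close>

lemma depth_bounds:
  fixes r :: real
  assumes "r > 0" "n \<ge> 1"
  defines "L \<equiv> nat \<lfloor>r * ln (real n)\<rfloor>"
  shows "real L \<le> r * ln n" "r * ln n \<le> real L + 1" "real L + 1 \<le> (r + 1) * n"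
proof -
  have ln: "0 \<le> ln (real n)" "ln (real n) \<le> n"
    using assms(2) ln_bound[of "real n"] by auto
  then have "0 \<le> r * ln n" using assms(1) by simp
  then show L: "real L \<le> r * ln n" "r * ln n \<le> real L + 1"
    unfolding L_def by linarith+
  have "r * ln n \<le> r * n" using ln assms(1) by (intro mult_left_mono) auto
  then show "real L + 1 \<le> (r + 1) * n" using L assms(2) by (simp add: algebra_simps)
qed

text \<open>The depth makes \<open>q ^ L\<close> of order n^(-\<gamma> - 4). The factor
  \<open>n ^ 2\<close> in \<open>S\<close> and the linear bound on the depth cost n^3; the remaining
  power of \<open>n\<close> beats the constants, which is what \<open>large\<close>
  provides.\<close>

lemma error_bound:
  fixes d \<beta> \<gamma> q r S :: real
  assumes "d \<ge> 1" "\<beta> \<ge> 0" and q: "0 < q" "q < 1" and "d * tanh \<beta> \<le> q" "\<gamma> > 0"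
    and r: "r = (\<gamma> + 4) / ln (1 / q)" and n: "n \<ge> 1" and L: "Suc k = nat \<lfloor>r * ln (real n)\<rfloor>"
    and large: "real n > 4 * \<beta> * d * (r + 1) / q ^ 2"
    and S: "S = real n ^ 2 * (real (Suc k) + 1) * d ^ Suc k"
  shows "4 * \<beta> * tanh \<beta> ^ k * S < n powr (- \<gamma>)"
proof -
  have lnq: "ln (1 / q) > 0" using assms by simp
  then have r0: "r > 0" using assms by simp
  have bounds: "r * ln n \<le> real (Suc k) + 1" "real (Suc k) + 1 \<le> (r + 1) * n"
    using depth_bounds[OF r0 n] unfolding L by auto
  have n0: "real n > 0" using n by simp
  have "q ^ k = q powr k" using assms by (simp add: powr_realpow)
  \<comment> \<open>One is lost to rounding and one because \<open>k\<close> is the depth minus 1;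
    this is the origin of \<open>q ^ 2\<close>.\<close>
  also have "\<dots> \<le> q powr (r * ln n - 2)"
  proof (rule powr_mono')
    show "r * ln n - 2 \<le> real k" using bounds(1) by simp
  qed (use q in auto)
  also have "\<dots> = q powr (r * ln n) / q ^ 2"
    using assms by (simp add: powr_diff powr_realpow)
  also have "q powr (r * ln n) = n powr (- (\<gamma> + 4))"
  proof -
    have "r * ln q = - (\<gamma> + 4)" using lnq assms by (simp add: r ln_div field_simps)
    then have "r * ln n * ln q = - (\<gamma> + 4) * ln n"
      by (metis mult.assoc mult.commute)
    then show ?thesis using q n0 by (simp add: powr_def)
  qed
  finally have qk: "q ^ k \<le> n powr (- (\<gamma> + 4)) / q ^ 2" .
  have "4 * \<beta> * tanh \<beta> ^ k * S = 4 * \<beta> * d * real n ^ 2 * (real (Suc k) + 1) * (d * tanh \<beta>) ^ k"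
    by (simp add: S power_mult_distrib)
  also have "\<dots> \<le> 4 * \<beta> * d * real n ^ 2 * ((r + 1) * n) * (n powr (- (\<gamma> + 4)) / q ^ 2)"
  proof (rule mult_mono)
    show "4 * \<beta> * d * real n ^ 2 * (real (Suc k) + 1) \<le> 4 * \<beta> * d * real n ^ 2 * ((r + 1) * n)"
      using bounds assms by (intro mult_left_mono) auto
    have "(d * tanh \<beta>) ^ k \<le> q ^ k" using assms by (intro power_mono) auto
    then show "(d * tanh \<beta>) ^ k \<le> n powr (- (\<gamma> + 4)) / q ^ 2" using qk by linarith
  qed (use assms r0 in auto)
  also have "\<dots> = 4 * \<beta> * d * (r + 1) / q ^ 2 * (real n ^ 3 * n powr (- (\<gamma> + 4)))"
    by (simp add: power3_eq_cube power2_eq_square)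
  also have "real n ^ 3 * n powr (- (\<gamma> + 4)) = n powr (- \<gamma>) / n"
  proof -
    have "real n ^ 3 * n powr (- (\<gamma> + 4)) = n powr 3 * n powr (- (\<gamma> + 4))"
      using n0 by simp
    also have "\<dots> = n powr (- \<gamma> - 1)"
      unfolding powr_add[symmetric] by (rule arg_cong[of _ _ "\<lambda>t. real n powr t"]) simp
    finally show ?thesis using n0 by (simp add: powr_diff)
  qed
  also have "4 * \<beta> * d * (r + 1) / q ^ 2 * (n powr (- \<gamma>) / n) < n * (n powr (- \<gamma>) / n)"
    using large n0 by (intro mult_strict_right_mono) auto
  also have "\<dots> = n powr (- \<gamma>)" using n0 by simp
  finally show ?thesis .
qed

text \<open>The work per walk is of order n (L + 1), hence n^2, and \<open>S\<close> is of order n^3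
  d^L; this gives the exponent 5. The logarithmic depth turns \<open>d ^ L\<close> into a power of
  \<open>n\<close>.\<close>

lemma time_bound:
  fixes d r S :: real
  assumes "d \<ge> 1" "r > 0" and n: "n \<ge> 1" and L: "L = nat \<lfloor>r * ln (real n)\<rfloor>"
    and S: "S = real n ^ 2 * (real L + 1) * d ^ L"
  shows "real (3 * L + 19 + n * (3 * L + 39)) * S + 7 * n + 1 \<le>
    (78 * (r + 1) ^ 2 + 8) * n powr (5 + r * ln d)"
proof -
  have n1: "real n \<ge> 1" using n by simp
  have bounds: "real L \<le> r * ln n" "real L + 1 \<le> (r + 1) * n"
    using depth_bounds[OF assms(2) n] unfolding L by auto
  have "d ^ L = d powr L" using assms(1) by (simp add: powr_realpow)
  also have "\<dots> \<le> d powr (r * ln n)" using bounds assms(1) by (intro powr_mono) auto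
  also have "\<dots> = n powr (r * ln d)" using assms(1) n1 by (simp add: powr_def algebra_simps)
  finally have dL: "d ^ L \<le> n powr (r * ln d)" .
  define a where "a = n powr (r * ln d)"
  have a: "a \<ge> 1" unfolding a_def using assms n1 by (intro ge_one_powr_ge_zero) auto
  have "real (3 * L + 19 + n * (3 * L + 39)) \<le> 78 * n * (real L + 1)"
  proof -
    have "real (3 * L + 19) \<le> n * (3 * real L + 19)" using n1 by (simp add: mult_le_cancel_right1)
    then have "real (3 * L + 19 + n * (3 * L + 39)) \<le> n * (6 * real L + 58)"
      by (simp add: algebra_simps)
    also have "\<dots> \<le> n * (78 * (real L + 1))" by (intro mult_left_mono) auto
    finally show ?thesis by (simp add: algebra_simps)
  qed
  also have "\<dots> \<le> 78 * n * ((r + 1) * n)" using bounds by (intro mult_left_mono) auto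
  finally have B: "real (3 * L + 19 + n * (3 * L + 39)) \<le> 78 * n * ((r + 1) * n)" .
  have "S \<le> real n ^ 2 * ((r + 1) * n) * a"
    unfolding S a_def using bounds dL assms by (intro mult_mono) auto
  then have "real (3 * L + 19 + n * (3 * L + 39)) * S \<le> 78 * n * ((r + 1) * n) * (real n ^ 2 * ((r + 1) * n) * a)"
    using B assms n1 by (intro mult_mono) (auto simp: S)
  also have "\<dots> = 78 * (r + 1) ^ 2 * (real n ^ 5 * a)"
    by (simp add: power2_eq_square power_numeral_reduce)
  finally have "real (3 * L + 19 + n * (3 * L + 39)) * S \<le> 78 * (r + 1) ^ 2 * (real n ^ 5 * a)" .
  moreover have "7 * real n + 1 \<le> 8 * (real n ^ 5 * a)"
  proof -
    have "real n \<le> real n ^ 5" using n1 by (intro self_le_power) auto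
    also have "\<dots> \<le> real n ^ 5 * a" using a by (simp add: mult_le_cancel_left1)
    finally show ?thesis using n1 by linarith
  qed
  moreover have "real n ^ 5 * a = n powr (5 + r * ln d)"
    unfolding powr_add a_def using n1 by simp
  ultimately show ?thesis by (simp add: distrib_right)
qed

theorem theorem1p12:
  fixes d \<beta> \<gamma> :: real
  assumes "d \<ge> 1" and "\<beta> \<ge> 0" and "tanh \<beta> < 1 / d" and "\<gamma> > 0"
  shows "\<exists>r C K. r > 0 \<and> C > 0 \<and> K > 0 \<and>
    (\<lambda>n. measure_pmf.prob (gnp n (d / real n))
      {E. let guarantee = (\<lambda>J h. sampler_guarantee n E J h (nat \<lfloor>r * ln (real n)\<rfloor>)
                                   (K * real n powr C) (real n powr (- \<gamma>)))
          in guarantee (\<lambda>_. \<beta>) (\<lambda>_. 0)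
             \<and> (\<forall>J h. has_inverse_temperature E J \<beta> \<longrightarrow> guarantee J h)})
      \<longlonglongrightarrow> 1"
proof -
  \<comment> \<open>The maximum keeps \<open>q\<close> positive for \<beta> = 0, so that
    \<open>r\<close> is a positive number.\<close>
  define q where "q = max (d * tanh \<beta>) (1 / 2)"
  have q: "0 < q" "q < 1" "d * tanh \<beta> \<le> q"
    using assms by (auto simp: q_def field_simps)
  define r where "r = (\<gamma> + 4) / ln (1 / q)"
  define C where "C = 5 + r * ln d"
  define K where "K = 78 * (r + 1) ^ 2 + 8"
  have r: "r > 0" using q assms by (simp add: r_def)
  have C: "C > 0" using r assms by (simp add: C_def add_pos_nonneg)
  have K: "K > 0" by (simp add: K_def add_nonneg_pos)
  define good where "good n = {E. let guarantee = (\<lambda>J h. sampler_guarantee n E J h (nat \<lfloor>r * ln (real n)\<rfloor>)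
                                   (K * real n powr C) (real n powr (- \<gamma>)))
          in guarantee (\<lambda>_. \<beta>) (\<lambda>_. 0)
             \<and> (\<forall>J h. has_inverse_temperature E J \<beta> \<longrightarrow> guarantee J h)}" for n
  \<comment> \<open>The lower bounds on \<open>n\<close> make \<open>d / n\<close> a probability,
    beat the constants and make the depth at least 1. They involve only d, \<beta> and
    \<gamma>.\<close>
  have lower: "1 - 1 / real n \<le> measure_pmf.prob (gnp n (d / n)) (good n)"
    if n: "n \<ge> 1" and nd: "real n \<ge> d" and large: "real n > 4 * \<beta> * d * (r + 1) / q ^ 2"
      and depth: "r * ln n \<ge> 1" for n
  proof -
    define L where "L = nat \<lfloor>r * ln (real n)\<rfloor>"
    have "L > 0" using depth by (simp add: L_def)
    then obtain k where k: "L = Suc k" by (cases L) auto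
    define S where "S = real n ^ 2 * (real L + 1) * d ^ L"
    have guarantee: "sampler_guarantee n E J h L (K * real n powr C) (real n powr (- \<gamma>))"
      if E: "E \<in> set_pmf (gnp n (d / n))" and X: "real (\<Sum>v<n. \<Sum>j\<le>L. saw_count n E j v []) \<le> S"
        and J: "\<And>e. e \<in> E \<Longrightarrow> 0 \<le> J e \<and> J e \<le> \<beta>" for E J h
    proof -
      interpret graph n E
        using E set_pmf_gnp by unfold_locales blast
      show ?thesis
        unfolding k
      proof (rule sampler_guaranteeI[OF J \<open>\<beta> \<ge> 0\<close>])
        show "real (\<Sum>v<n. \<Sum>j\<le>Suc k. saw_count n E j v []) \<le> S" using X unfolding k .
        show "4 * \<beta> * tanh \<beta> ^ k * S < real n powr - \<gamma>"
          using error_bound[OF assms(1,2) q assms(4) r_def n _ large, of k S] by (simp only: S_def k[symmetric] L_def)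
        show "real (3 * Suc k + 19 + n * (3 * Suc k + 39)) * S + real (7 * n) + 1 \<le> K * real n powr C"
          using time_bound[OF assms(1) r n L_def S_def] by (simp only: K_def C_def k of_nat_mult of_nat_numeral)
      qed
    qed
    have "1 - 1 / n \<le> measure_pmf.prob (gnp n (d / n)) {E. real (\<Sum>v<n. \<Sum>j\<le>L. saw_count n E j v []) \<le> S}"
      using prob_saw_count[OF assms(1) nd, of L] unfolding S_def .
    \<comment> \<open>The event on the left speaks of walks only, so one event serves all
      interactions and fields. The inclusion is needed only for edge sets in the support, where the
      locale applies.\<close>
    also have "\<dots> \<le> measure_pmf.prob (gnp n (d / n)) (good n)"
    proof (rule measure_pmf.finite_measure_mono_AE)
      show "AE E in gnp n (d / n). E \<in> {E. real (\<Sum>v<n. \<Sum>j\<le>L. saw_count n E j v []) \<le> S} \<longrightarrow> E \<in> good n"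
        unfolding AE_measure_pmf_iff
      proof (intro ballI impI)
        fix E assume E: "E \<in> set_pmf (gnp n (d / n))"
          and "E \<in> {E. real (\<Sum>v<n. \<Sum>j\<le>L. saw_count n E j v []) \<le> S}"
        then have X: "real (\<Sum>v<n. \<Sum>j\<le>L. saw_count n E j v []) \<le> S" by simp
        interpret graph n E
          using E set_pmf_gnp by unfold_locales blast
        have "0 \<le> J e \<and> J e \<le> \<beta>" if "has_inverse_temperature E J \<beta>" "e \<in> E" for J e
        proof -
          have "J e \<le> Max (J ` E)" using that(2) finite_edges by (intro Max_ge) auto
          then show ?thesis using that by (auto simp: has_inverse_temperature_def)
        qed
        then show "E \<in> good n"
          unfolding good_def Let_def L_def[symmetric] using guarantee[OF E X] assms(2) by simp
      qed
    qed simp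
    finally show ?thesis .
  qed
  have lower_ev: "eventually (\<lambda>n. 1 - 1 / real n \<le> measure_pmf.prob (gnp n (d / n)) (good n)) sequentially"
  proof -
    have "filterlim (\<lambda>n. r * ln (real n)) at_top sequentially"
      using r by real_asymp
    then have "eventually (\<lambda>n. r * ln (real n) \<ge> 1) sequentially"
      by (rule eventually_compose_filterlim[OF eventually_ge_at_top])
    moreover have "eventually (\<lambda>n. real n \<ge> d) sequentially"
      by (rule eventually_compose_filterlim[OF eventually_ge_at_top filterlim_real_sequentially])
    moreover have "eventually (\<lambda>n. real n > 4 * \<beta> * d * (r + 1) / q ^ 2) sequentially"
      by (rule eventually_compose_filterlim[OF eventually_gt_at_top filterlim_real_sequentially])
    ultimately show ?thesis
      using eventually_ge_at_top[of 1] by eventually_elim (rule lower)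
  qed
  have upper_ev: "eventually (\<lambda>n. measure_pmf.prob (gnp n (d / n)) (good n) \<le> 1) sequentially"
    by (simp add: always_eventually)
  have lim: "(\<lambda>n. 1 - 1 / real n) \<longlonglongrightarrow> 1"
    by real_asymp
  have "(\<lambda>n. measure_pmf.prob (gnp n (d / n)) (good n)) \<longlonglongrightarrow> 1"
    by (rule tendsto_sandwich[OF lower_ev upper_ev lim tendsto_const])
  then have "r > 0 \<and> C > 0 \<and> K > 0 \<and> (\<lambda>n. measure_pmf.prob (gnp n (d / n)) (good n)) \<longlonglongrightarrow> 1"
    using r C K by blast
  then show ?thesis
    unfolding good_def by (intro exI)
qed

end
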